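(* Let $\xi$ be a bi-infinite word. Then $\mathsf{MTh}(\xi)$ is decidable if and only if $\xi$ has a recursive type-function.
   Context: A bi-infinite word is a map $\xi\colon\mathbb Z\to\{0,1\}$, viewed as the structure $(\mathbb Z,\le,\xi^{-1}(1))$; $\mathsf{MTh}(\xi)$ is the set of monadic second-order sentences over $\{\le,P\}$ true in it. For $i\le j$, $\xi[i,j]=\xi(i)\cdots\xi(j)$. Two finite words are $k$-equivalent ($\equiv_k$) if they satisfy the same MSO-sentences of quantifier rank at most $k$. For $u,v,w\in\{0,1\}^+$, $k\in\mathbb N$ and infinite $H_\leftarrow,H_\rightarrow\subseteq\mathbb Z$, $(H_\leftarrow,H_\rightarrow)$ is a $k$-homogeneous factorisation of $\xi$ into $(u,v,w)$ if $\xi[i,j-1]\equiv_k u$ for all $i<j$ in $H_\leftarrow$, $\xi[i,j-1]\equiv_k v$ for all $i\in H_\leftarrow$, $j\in H_\rightarrow$ with $i<j$, and $\xi[i,j-1]\equiv_k w$ for all $i<j$ in $H_\rightarrow$. A type-function for $\xi$ is a function $\mathrm{tp}\colon\mathbb N\to\{0,1\}^+\times\{0,1\}^+\times\{0,1\}^+$ such that for every $k\in\mathbb N$, $\xi$ has a $k$-homogeneous factorisation into $\mathrm{tp}(k)$; it is recursive if it is computable.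
   Formalization: In a k-homogeneous factorisation, H_← is required to be unbounded to the left and H_→ unbounded to the right, instead of both merely being infinite subsets of ℤ; with mere infinitude the equivalence fails. *)

theory Defs
  imports "HOL-Library.Nat_Bijection"
begin

text \<open>First-order and set variables are both named by natural numbers, in separate name spaces.\<close>

datatype mso =
    Eq nat nat
  | Le nat nat
  | InP nat
  | Mem nat nat
  | Neg mso
  | Conj mso mso
  | ExElem nat mso
  | ExSet nat mso

primrec free1 :: "mso \<Rightarrow> nat set" where
  "free1 (Eq x y) = {x, y}"
| "free1 (Le x y) = {x, y}"
| "free1 (InP x) = {x}"
| "free1 (Mem x X) = {x}"
| "free1 (Neg f) = free1 f"
| "free1 (Conj f g) = free1 f \<union> free1 g"
| "free1 (ExElem x f) = free1 f - {x}"
| "free1 (ExSet X f) = free1 f"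

primrec free2 :: "mso \<Rightarrow> nat set" where
  "free2 (Eq x y) = {}"
| "free2 (Le x y) = {}"
| "free2 (InP x) = {}"
| "free2 (Mem x X) = {X}"
| "free2 (Neg f) = free2 f"
| "free2 (Conj f g) = free2 f \<union> free2 g"
| "free2 (ExElem x f) = free2 f"
| "free2 (ExSet X f) = free2 f - {X}"

definition sentence :: "mso \<Rightarrow> bool" where
  "sentence f \<longleftrightarrow> free1 f = {} \<and> free2 f = {}"

primrec qrank :: "mso \<Rightarrow> nat" where
  "qrank (Eq x y) = 0"
| "qrank (Le x y) = 0"
| "qrank (InP x) = 0"
| "qrank (Mem x X) = 0"
| "qrank (Neg f) = qrank f"
| "qrank (Conj f g) = max (qrank f) (qrank g)"
| "qrank (ExElem x f) = Suc (qrank f)"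
| "qrank (ExSet X f) = Suc (qrank f)"

text \<open>
  The structure has universe \<open>D\<close>, the order of the ambient type restricted to \<open>D\<close>, and the
  predicate \<open>P\<close>; \<open>e\<close> and \<open>E\<close> assign values to the first-order and the set variables.
\<close>

primrec sat :: "'a::linorder set \<Rightarrow> 'a set \<Rightarrow> (nat \<Rightarrow> 'a) \<Rightarrow> (nat \<Rightarrow> 'a set) \<Rightarrow> mso \<Rightarrow> bool" where
  "sat D P e E (Eq x y) \<longleftrightarrow> e x = e y"
| "sat D P e E (Le x y) \<longleftrightarrow> e x \<le> e y"
| "sat D P e E (InP x) \<longleftrightarrow> e x \<in> P"
| "sat D P e E (Mem x X) \<longleftrightarrow> e x \<in> E X"
| "sat D P e E (Neg f) \<longleftrightarrow> \<not> sat D P e E f"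
| "sat D P e E (Conj f g) \<longleftrightarrow> sat D P e E f \<and> sat D P e E g"
| "sat D P e E (ExElem x f) \<longleftrightarrow> (\<exists>a\<in>D. sat D P (e(x := a)) E f)"
| "sat D P e E (ExSet X f) \<longleftrightarrow> (\<exists>A\<subseteq>D. sat D P e (E(X := A)) f)"

lemma sat_cong:
  assumes "\<And>x. x \<in> free1 f \<Longrightarrow> e x = e' x" and "\<And>X. X \<in> free2 f \<Longrightarrow> E X = E' X"
  shows "sat D P e E f \<longleftrightarrow> sat D P e' E' f"
  using assms
proof (induction f arbitrary: e e' E E')
  case (Neg f)
  have "sat D P e E f \<longleftrightarrow> sat D P e' E' f"
    by (rule Neg.IH) (use Neg.prems in auto)
  then show ?case by simp
next
  case (Conj f g)
  have "sat D P e E f \<longleftrightarrow> sat D P e' E' f"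
    by (rule Conj.IH(1)) (use Conj.prems in auto)
  moreover have "sat D P e E g \<longleftrightarrow> sat D P e' E' g"
    by (rule Conj.IH(2)) (use Conj.prems in auto)
  ultimately show ?case by simp
next
  case (ExElem x f)
  have "sat D P (e(x := a)) E f \<longleftrightarrow> sat D P (e'(x := a)) E' f" for a
    by (rule ExElem.IH) (use ExElem.prems in auto)
  then show ?case by simp
next
  case (ExSet X f)
  have "sat D P e (E(X := A)) f \<longleftrightarrow> sat D P e' (E'(X := A)) f" for A
    by (rule ExSet.IH) (use ExSet.prems in auto)
  then show ?case by simp
qed auto

definition models :: "'a::linorder set \<Rightarrow> 'a set \<Rightarrow> mso \<Rightarrow> bool" where
  "models D P f \<longleftrightarrow> (\<forall>e E. sat D P e E f)"

lemma models_iff_sat: "sentence f \<Longrightarrow> models D P f \<longleftrightarrow> sat D P e E f"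
  unfolding models_def sentence_def
  using sat_cong[of f _ e _ E D P] by auto

text \<open>The letters \<open>1\<close> and \<open>0\<close> are represented by \<^term>\<open>True\<close> and \<^term>\<open>False\<close>.\<close>

type_synonym word = "bool list"
type_synonym biword = "int \<Rightarrow> bool"

definition word_models :: "word \<Rightarrow> mso \<Rightarrow> bool" where
  "word_models w f \<longleftrightarrow> models {..<length w} {i. i < length w \<and> w ! i} f"

definition MTh :: "biword \<Rightarrow> mso set" where
  "MTh \<xi> = {f. sentence f \<and> models UNIV {i. \<xi> i} f}"

definition kequiv :: "nat \<Rightarrow> word \<Rightarrow> word \<Rightarrow> bool" where
  "kequiv k u v \<longleftrightarrow>
     (\<forall>f. sentence f \<and> qrank f \<le> k \<longrightarrow> (word_models u f \<longleftrightarrow> word_models v f))"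

definition factor :: "biword \<Rightarrow> int \<Rightarrow> int \<Rightarrow> word" where
  "factor \<xi> i j = map \<xi> [i..j]"

text \<open>
  The arrows in the names of the two infinite sets are part of their meaning: the first set
  extends infinitely to the left and the second one infinitely to the right. Without this
  requirement both sets could lie in the same half of \<open>\<xi>\<close>, and a type-function would say nothing
  about the other half.
\<close>

definition homogeneous_factorisation ::
    "nat \<Rightarrow> biword \<Rightarrow> int set \<Rightarrow> int set \<Rightarrow> word \<times> word \<times> word \<Rightarrow> bool" where
  "homogeneous_factorisation k \<xi> Hl Hr = (\<lambda>(u, v, w).
     \<not> bdd_below Hl \<and> \<not> bdd_above Hr \<and>
     (\<forall>i\<in>Hl. \<forall>j\<in>Hl. i < j \<longrightarrow> kequiv k (factor \<xi> i (j - 1)) u) \<and>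
     (\<forall>i\<in>Hl. \<forall>j\<in>Hr. i < j \<longrightarrow> kequiv k (factor \<xi> i (j - 1)) v) \<and>
     (\<forall>i\<in>Hr. \<forall>j\<in>Hr. i < j \<longrightarrow> kequiv k (factor \<xi> i (j - 1)) w))"

definition type_function :: "biword \<Rightarrow> (nat \<Rightarrow> word \<times> word \<times> word) \<Rightarrow> bool" where
  "type_function \<xi> tp \<longleftrightarrow>
     (\<forall>k. (case tp k of (u, v, w) \<Rightarrow> u \<noteq> [] \<and> v \<noteq> [] \<and> w \<noteq> []) \<and>
          (\<exists>Hl Hr. homogeneous_factorisation k \<xi> Hl Hr (tp k)))"

text \<open>
  Kleene's partial recursive functions. A term \<open>r\<close> denotes the partial function
  that maps \<open>xs\<close> to the unique \<open>y\<close> with \<open>rec_eval r xs y\<close>, if there is one.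
\<close>

datatype recf =
    Zero
  | Succ
  | Proj nat
  | Comp recf "recf list"
  | PrimRec recf recf
  | Mu recf

inductive rec_eval :: "recf \<Rightarrow> nat list \<Rightarrow> nat \<Rightarrow> bool" where
  Zero: "rec_eval Zero xs 0"
| Succ: "rec_eval Succ [x] (Suc x)"
| Proj: "i < length xs \<Longrightarrow> rec_eval (Proj i) xs (xs ! i)"
| Comp: "list_all2 (\<lambda>g y. rec_eval g xs y) gs ys \<Longrightarrow> rec_eval f ys z \<Longrightarrow>
    rec_eval (Comp f gs) xs z"
| PrimRec_0: "rec_eval f xs y \<Longrightarrow> rec_eval (PrimRec f g) (0 # xs) y"
| PrimRec_Suc: "rec_eval (PrimRec f g) (n # xs) y \<Longrightarrow> rec_eval g (n # y # xs) z \<Longrightarrow>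
    rec_eval (PrimRec f g) (Suc n # xs) z"
| Mu: "rec_eval f (n # xs) 0 \<Longrightarrow> (\<And>m. m < n \<Longrightarrow> \<exists>y. rec_eval f (m # xs) (Suc y)) \<Longrightarrow>
    rec_eval (Mu f) xs n"

inductive_cases rec_eval_ZeroE: "rec_eval Zero xs y"
inductive_cases rec_eval_SuccE: "rec_eval Succ xs y"
inductive_cases rec_eval_ProjE: "rec_eval (Proj i) xs y"
inductive_cases rec_eval_CompE: "rec_eval (Comp f gs) xs y"
inductive_cases rec_eval_PrimRec_0E: "rec_eval (PrimRec f g) (0 # xs) y"
inductive_cases rec_eval_PrimRec_SucE: "rec_eval (PrimRec f g) (Suc n # xs) y"
inductive_cases rec_eval_MuE: "rec_eval (Mu f) xs y"

lemma rec_eval_unique: "rec_eval r xs y \<Longrightarrow> rec_eval r xs z \<Longrightarrow> y = z"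
proof (induction arbitrary: z rule: rec_eval.induct)
  case (Zero xs)
  then show ?case by (rule rec_eval_ZeroE) simp
next
  case (Succ x)
  then show ?case by (rule rec_eval_SuccE) simp
next
  case (Proj i xs)
  from Proj.prems show ?case by (rule rec_eval_ProjE) simp
next
  case (Comp xs gs ys f y)
  obtain ys' where ys': "list_all2 (\<lambda>g y. rec_eval g xs y) gs ys'" "rec_eval f ys' z"
    using Comp.prems by (rule rec_eval_CompE) (rule that)
  have "ys = ys'"
  proof (rule nth_equalityI)
    show len: "length ys = length ys'"
      using list_all2_lengthD[OF Comp.IH(1)] list_all2_lengthD[OF ys'(1)] by (rule trans[OF sym])
    fix i assume i: "i < length ys"
    have "rec_eval (gs ! i) xs (ys' ! i)"
      using list_all2_nthD2[OF ys'(1)] i len by simp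
    with list_all2_nthD2[OF Comp.IH(1) i] show "ys ! i = ys' ! i" by blast
  qed
  with Comp.IH(2) ys'(2) show ?case by blast
next
  case (PrimRec_0 f xs y g)
  from PrimRec_0.prems have "rec_eval f xs z" by (rule rec_eval_PrimRec_0E)
  then show ?case by (rule PrimRec_0.IH)
next
  case (PrimRec_Suc f g n xs y y')
  from PrimRec_Suc.prems obtain x where "rec_eval (PrimRec f g) (n # xs) x" "rec_eval g (n # x # xs) z"
    by (rule rec_eval_PrimRec_SucE)
  with PrimRec_Suc.IH show ?case by blast
next
  case (Mu f n xs)
  from Mu.prems have z0: "rec_eval f (z # xs) 0" by (rule rec_eval_MuE)
  from Mu.prems have zS: "\<exists>y. rec_eval f (m # xs) (Suc y)" if "m < z" for m
    by (rule rec_eval_MuE) (use that in simp)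
  show ?case
  proof (rule linorder_cases[of n z])
    assume "n < z"
    then obtain y where "rec_eval f (n # xs) (Suc y)" using zS by blast
    from Mu.IH(1)[OF this] show ?thesis by simp
  next
    assume "z < n"
    from Mu.IH(2)[OF this] z0 show ?thesis by blast
  qed
qed

primrec mso_encode :: "mso \<Rightarrow> nat" where
  "mso_encode (Eq x y) = prod_encode (0, prod_encode (x, y))"
| "mso_encode (Le x y) = prod_encode (1, prod_encode (x, y))"
| "mso_encode (InP x) = prod_encode (2, x)"
| "mso_encode (Mem x X) = prod_encode (3, prod_encode (x, X))"
| "mso_encode (Neg f) = prod_encode (4, mso_encode f)"
| "mso_encode (Conj f g) = prod_encode (5, prod_encode (mso_encode f, mso_encode g))"
| "mso_encode (ExElem x f) = prod_encode (6, prod_encode (x, mso_encode f))"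
| "mso_encode (ExSet X f) = prod_encode (7, prod_encode (X, mso_encode f))"

lemma mso_encode_inject: "mso_encode f = mso_encode g \<longleftrightarrow> f = g"
proof (induction f arbitrary: g)
  case (Eq x y) show ?case by (cases g) auto
next
  case (Le x y) show ?case by (cases g) auto
next
  case (InP x) show ?case by (cases g) auto
next
  case (Mem x X) show ?case by (cases g) auto
next
  case (Neg f) then show ?case by (cases g) auto
next
  case (Conj f1 f2) then show ?case by (cases g) auto
next
  case (ExElem x f) then show ?case by (cases g) auto
next
  case (ExSet X f) then show ?case by (cases g) auto
qed

definition word_encode :: "word \<Rightarrow> nat" where
  "word_encode w = list_encode (map of_bool w)"

definition triple_encode :: "word \<times> word \<times> word \<Rightarrow> nat" where
  "triple_encode = (\<lambda>(u, v, w).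
     prod_encode (word_encode u, prod_encode (word_encode v, word_encode w)))"

lemma inj_word_encode: "inj word_encode"
proof (rule injI)
  fix u v assume "word_encode u = word_encode v"
  then have "map (of_bool :: bool \<Rightarrow> nat) u = map of_bool v"
    unfolding word_encode_def by (rule injD[OF inj_list_encode])
  moreover have "inj (of_bool :: bool \<Rightarrow> nat)" by (auto simp: inj_def)
  ultimately show "u = v" using inj_map_eq_map by blast
qed

lemma inj_triple_encode: "inj triple_encode"
  by (auto intro!: injI simp: triple_encode_def inj_eq[OF inj_word_encode])

definition decidable :: "mso set \<Rightarrow> bool" where
  "decidable A \<longleftrightarrow> (\<exists>r. \<forall>n. rec_eval r [n] (of_bool (n \<in> mso_encode ` A)))"

definition recursive :: "(nat \<Rightarrow> word \<times> word \<times> word) \<Rightarrow> bool" where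
  "recursive tp \<longleftrightarrow> (\<exists>r. \<forall>k. rec_eval r [k] (triple_encode (tp k)))"

end

theory Submission
  imports Defs "HOL-Library.Ramsey"
begin

text \<open>
  The proof is Shelah's composition method. Equivalence up to quantifier rank \<open>k\<close> is replaced by
  equality of types, which are the trees of depth \<open>k\<close> of all choices of sets, coded as numbers. There
  are boundedly many of them, and the type of an ordered sum depends only on the types of the summands.

  Given a decision procedure for the theory of \<open>\<xi>\<close>, the words \<open>u\<close>, \<open>v\<close>, \<open>w\<close> are found by search: a
  sentence computable from them says that \<open>\<xi>\<close> factorises homogeneously into pieces of their types,
  and by Ramsey's theorem it holds for some triple.

  Conversely, a homogeneous factorisation gives \<open>\<xi>\<close> the type of the ultimately periodic word
  \<open>\<dots>uuuvwww\<dots>\<close>. By Ramsey's theorem, a set of positions of that word may be replaced by an ultimately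
  periodic one without changing the type, and its periods can be taken to be labellings of the \<open>m\<close>-th
  powers of \<open>u\<close> and \<open>w\<close> for a fixed \<open>m\<close>, because the types of the powers of a word are eventually
  periodic. Set quantifiers thus range over finitely many labellings of finite words.
\<close>

section \<open>Recursive functions\<close>

text \<open>No type is ever computed. Only two things about types have to be effective: the bound
  \<open>ty_bound\<close> on their number, from which the exponent \<open>m\<close> is made, and the
  passage from a word to a formula \<open>type_fm\<close> that defines its type. Types are used
  instead of \<open>kequiv\<close> because one formula cannot list the infinitely many sentences of
  a given rank, and because types compose without loss of depth. The exchange costs a constant:
  types of depth \<open>k\<close> determine sentences of rank \<open>k\<close>, while sentences of
  rank \<open>k + 4\<close> determine types of depth \<open>k\<close>. Hence a sentence of rank at
  most \<open>k\<close> is decided from \<open>tp (k + 4)\<close>, whereas the search for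
  \<open>tp k\<close> works with types of depth \<open>k\<close> directly.

  The exponent has to be fixed before the set that is to be replaced is known. A factorial of the
  bound works for all sets at once, because every period found by pigeonhole is at most the bound
  and so divides it.\<close>

definition rec_fun :: "nat \<Rightarrow> (nat list \<Rightarrow> nat) \<Rightarrow> bool" where
  "rec_fun k F \<longleftrightarrow> (\<exists>r. \<forall>xs. length xs = k \<longrightarrow> rec_eval r xs (F xs))"

lemma rec_fun_eqI:
  "rec_fun l F \<Longrightarrow> l = k \<Longrightarrow> (\<And>xs. length xs = k \<Longrightarrow> F xs = G xs) \<Longrightarrow> rec_fun k G"
  by (simp add: rec_fun_def)

lemma rec_fun_zero: "rec_fun k (\<lambda>_. 0)"
  unfolding rec_fun_def using rec_eval.Zero by blast

lemma rec_fun_nth: "i < k \<Longrightarrow> rec_fun k (\<lambda>xs. xs ! i)"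
  unfolding rec_fun_def using rec_eval.Proj by blast

lemma rec_fun_comp1:
  assumes "rec_fun 1 F" "rec_fun k G"
  shows "rec_fun k (\<lambda>xs. F [G xs])"
proof -
  obtain f g where f: "\<And>xs. length xs = 1 \<Longrightarrow> rec_eval f xs (F xs)"
    and g: "\<And>xs. length xs = k \<Longrightarrow> rec_eval g xs (G xs)"
    using assms unfolding rec_fun_def by blast
  have "rec_eval (Comp f [g]) xs (F [G xs])" if "length xs = k" for xs
    using f g that by (auto intro!: rec_eval.Comp[where ys = "[G xs]"])
  then show ?thesis unfolding rec_fun_def by blast
qed

lemma rec_fun_comp2:
  assumes "rec_fun 2 F" "rec_fun k G" "rec_fun k H"
  shows "rec_fun k (\<lambda>xs. F [G xs, H xs])"
proof -
  obtain f g h where f: "\<And>xs. length xs = 2 \<Longrightarrow> rec_eval f xs (F xs)"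
    and g: "\<And>xs. length xs = k \<Longrightarrow> rec_eval g xs (G xs)"
    and h: "\<And>xs. length xs = k \<Longrightarrow> rec_eval h xs (H xs)"
    using assms unfolding rec_fun_def by blast
  have "rec_eval (Comp f [g, h]) xs (F [G xs, H xs])" if "length xs = k" for xs
    using f g h that by (auto intro!: rec_eval.Comp[where ys = "[G xs, H xs]"])
  then show ?thesis unfolding rec_fun_def by blast
qed

lemma rec_fun_Suc: "rec_fun k G \<Longrightarrow> rec_fun k (\<lambda>xs. Suc (G xs))"
proof -
  have "rec_fun 1 (\<lambda>xs. Suc (hd xs))"
    unfolding rec_fun_def
    by (auto simp: length_Suc_conv intro!: exI[where x = Succ] rec_eval.Succ)
  then show "rec_fun k G \<Longrightarrow> ?thesis" by (auto dest: rec_fun_comp1[rotated])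
qed

lemma rec_fun_rec_nat:
  assumes "rec_fun k F" "rec_fun (Suc (Suc k)) G"
  shows "rec_fun (Suc k) (\<lambda>xs. rec_nat (F (tl xs)) (\<lambda>i y. G (i # y # tl xs)) (hd xs))"
proof -
  obtain f g where f: "\<And>xs. length xs = k \<Longrightarrow> rec_eval f xs (F xs)"
    and g: "\<And>xs. length xs = Suc (Suc k) \<Longrightarrow> rec_eval g xs (G xs)"
    using assms unfolding rec_fun_def by blast
  have "rec_eval (PrimRec f g) (n # xs) (rec_nat (F xs) (\<lambda>i y. G (i # y # xs)) n)"
    if "length xs = k" for n xs
    by (induction n) (use f g that in \<open>auto intro: rec_eval.intros\<close>)
  then have "rec_eval (PrimRec f g) xs (rec_nat (F (tl xs)) (\<lambda>i y. G (i # y # tl xs)) (hd xs))"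
    if "length xs = Suc k" for xs
    using that by (cases xs) auto
  then show ?thesis unfolding rec_fun_def by blast
qed

lemma rec_fun_Least:
  assumes "rec_fun (Suc k) F" "\<And>xs. length xs = k \<Longrightarrow> \<exists>n. F (n # xs) = 0"
  shows "rec_fun k (\<lambda>xs. LEAST n. F (n # xs) = 0)"
proof -
  obtain f where f: "\<And>xs. length xs = Suc k \<Longrightarrow> rec_eval f xs (F xs)"
    using assms(1) unfolding rec_fun_def by blast
  have "rec_eval (Mu f) xs (LEAST n. F (n # xs) = 0)" if len: "length xs = k" for xs
  proof (rule rec_eval.Mu)
    have "F ((LEAST n. F (n # xs) = 0) # xs) = 0"
      using assms(2)[OF len] by (rule LeastI_ex)
    then show "rec_eval f ((LEAST n. F (n # xs) = 0) # xs) 0"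
      using f[of "(LEAST n. F (n # xs) = 0) # xs"] len by simp
  next
    fix m assume "m < (LEAST n. F (n # xs) = 0)"
    then have "F (m # xs) \<noteq> 0" by (rule not_less_Least)
    then obtain y where "F (m # xs) = Suc y" using not0_implies_Suc by blast
    then show "\<exists>y. rec_eval f (m # xs) (Suc y)"
      using f[of "m # xs"] len by auto
  qed
  then show ?thesis unfolding rec_fun_def by blast
qed

section \<open>Arithmetic and the inverse of the pairing function\<close>

lemma rec_fun_add: "rec_fun 2 (\<lambda>xs. xs ! 0 + xs ! 1)"
proof -
  have "rec_fun (Suc 1) (\<lambda>xs. rec_nat (tl xs ! 0) (\<lambda>i y. Suc ((i # y # tl xs) ! 1)) (hd xs))"
    by (intro rec_fun_rec_nat rec_fun_Suc rec_fun_nth) auto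
  moreover have "rec_nat m (\<lambda>i y. Suc y) n = n + m" for m n :: nat
    by (induction n) auto
  ultimately show ?thesis
    by - (erule rec_fun_eqI, auto simp: numeral_2_eq_2 length_Suc_conv)
qed

lemma rec_fun_pred: "rec_fun 1 (\<lambda>xs. xs ! 0 - 1)"
proof -
  have "rec_fun (Suc 0) (\<lambda>xs. rec_nat 0 (\<lambda>i y. (i # y # tl xs) ! 0) (hd xs))"
    by (intro rec_fun_rec_nat rec_fun_zero rec_fun_nth) auto
  moreover have "rec_nat 0 (\<lambda>i y. i) n = n - 1" for n :: nat
    by (cases n) auto
  ultimately show ?thesis
    by - (erule rec_fun_eqI, auto simp: length_Suc_conv)
qed

text \<open>The subtrahend comes first because primitive recursion runs on the first
  argument.\<close>

lemma rec_fun_diff: "rec_fun 2 (\<lambda>xs. xs ! 1 - xs ! 0)"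
proof -
  have "rec_fun (Suc 1) (\<lambda>xs. rec_nat (tl xs ! 0) (\<lambda>i y. [(i # y # tl xs) ! 1] ! 0 - 1) (hd xs))"
    by (intro rec_fun_rec_nat rec_fun_comp1[OF rec_fun_pred] rec_fun_nth) auto
  moreover have "rec_nat m (\<lambda>i y. y - Suc 0) n = m - n" for m n :: nat
    by (induction n) auto
  ultimately show ?thesis
    by - (erule rec_fun_eqI, auto simp: numeral_2_eq_2 length_Suc_conv)
qed

lemma rec_fun_triangle: "rec_fun 1 (\<lambda>xs. triangle (xs ! 0))"
proof -
  have "rec_fun (Suc 0) (\<lambda>xs. rec_nat 0
      (\<lambda>i y. [Suc ((i # y # tl xs) ! 0), (i # y # tl xs) ! 1] ! 0 +
             [Suc ((i # y # tl xs) ! 0), (i # y # tl xs) ! 1] ! 1) (hd xs))"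
    by (intro rec_fun_rec_nat rec_fun_comp2[OF rec_fun_add] rec_fun_Suc rec_fun_nth rec_fun_zero) auto
  moreover have "rec_nat 0 (\<lambda>i y. Suc (i + y)) n = triangle n" for n :: nat
    by (induction n) auto
  ultimately show ?thesis
    by - (erule rec_fun_eqI, auto simp: length_Suc_conv)
qed

lemma rec_fun_prod_encode: "rec_fun 2 (\<lambda>xs. prod_encode (xs ! 0, xs ! 1))"
proof -
  have "rec_fun 2 (\<lambda>xs. [triangle ([xs ! 0 + xs ! 1] ! 0), xs ! 0] ! 0 +
                        [triangle ([xs ! 0 + xs ! 1] ! 0), xs ! 0] ! 1)"
    by (rule rec_fun_comp2[OF rec_fun_add]
        rec_fun_comp1[OF rec_fun_triangle] rec_fun_add rec_fun_nth | simp)+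
  then show ?thesis by (simp add: prod_encode_def)
qed

lemma triangle_mono: "m \<le> n \<Longrightarrow> triangle m \<le> triangle n"
  by (induction rule: dec_induct) auto

text \<open>The code of \<open>(m, n)\<close> is \<open>triangle (m + n) + m\<close>, which is below
  \<open>triangle (Suc (m + n))\<close>. So the sum is found by searching for the first triangular
  number beyond the code; subtracting \<open>triangle (m + n)\<close> then yields \<open>m\<close>,
  and the sum yields \<open>n\<close>. Truncated subtraction brings the comparison into the form
  that \<open>Mu\<close> tests.\<close>

lemma Least_triangle:
  "(LEAST s. Suc (prod_encode (m, n)) - triangle (Suc s) = 0) = m + n"
proof (rule Least_equality)
  show "Suc (prod_encode (m, n)) - triangle (Suc (m + n)) = 0"
    by (simp add: prod_encode_def)
next
  fix s assume s: "Suc (prod_encode (m, n)) - triangle (Suc s) = 0"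
  show "m + n \<le> s"
  proof (rule ccontr)
    assume "\<not> m + n \<le> s"
    then have "triangle (Suc s) \<le> triangle (m + n)" by (intro triangle_mono) simp
    with s show False by (simp add: prod_encode_def)
  qed
qed

lemma rec_fun_sum: "rec_fun 1 (\<lambda>xs. case prod_decode (xs ! 0) of (m, n) \<Rightarrow> m + n)"
proof -
  have 1: "rec_fun (Suc 1) (\<lambda>xs. [triangle ([Suc (xs ! 0)] ! 0), Suc (xs ! 1)] ! 1 -
                           [triangle ([Suc (xs ! 0)] ! 0), Suc (xs ! 1)] ! 0)"
    by (rule rec_fun_comp2[OF rec_fun_diff] rec_fun_comp1[OF rec_fun_triangle]
        rec_fun_Suc rec_fun_nth | simp)+
  have "\<exists>n. Suc x - (triangle n + Suc n) = 0" for x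
    by (intro exI[of _ x]) simp
  then have "rec_fun 1 (\<lambda>xs. LEAST n.
      [triangle ([Suc ((n # xs) ! 0)] ! 0), Suc ((n # xs) ! 1)] ! 1 -
      [triangle ([Suc ((n # xs) ! 0)] ! 0), Suc ((n # xs) ! 1)] ! 0 = 0)"
    by (intro rec_fun_Least[OF 1]) auto
  then show ?thesis
  proof (rule rec_fun_eqI[OF _ refl])
    fix xs :: "nat list" assume "length xs = 1"
    then obtain x where x: "xs = [x]" by (auto simp: length_Suc_conv)
    obtain m n where "x = prod_encode (m, n)"
      using prod_decode_inverse[of x] by (cases "prod_decode x") auto
    then show "(LEAST n.
      [triangle ([Suc ((n # xs) ! 0)] ! 0), Suc ((n # xs) ! 1)] ! 1 -
      [triangle ([Suc ((n # xs) ! 0)] ! 0), Suc ((n # xs) ! 1)] ! 0 = 0) =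
      (case prod_decode (xs ! 0) of (m, n) \<Rightarrow> m + n)"
      using Least_triangle[of m n] x by simp
  qed
qed

definition pfst :: "nat \<Rightarrow> nat" where "pfst z = fst (prod_decode z)"
definition psnd :: "nat \<Rightarrow> nat" where "psnd z = snd (prod_decode z)"

lemma pfst_prod_encode [simp]: "pfst (prod_encode (m, n)) = m"
  and psnd_prod_encode [simp]: "psnd (prod_encode (m, n)) = n"
  by (simp_all add: pfst_def psnd_def)

lemma rec_fun_pfst: "rec_fun 1 (\<lambda>xs. pfst (xs ! 0))"
proof -
  let ?s = "\<lambda>xs. case prod_decode ([xs ! 0] ! 0) of (m, n) \<Rightarrow> m + n"
  have "rec_fun 1 (\<lambda>xs. [triangle ([?s xs] ! 0), xs ! 0] ! 1 - [triangle ([?s xs] ! 0), xs ! 0] ! 0)"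
    by (rule rec_fun_comp2[OF rec_fun_diff] rec_fun_comp1[OF rec_fun_triangle]
        rec_fun_comp1[OF rec_fun_sum] rec_fun_nth | simp)+
  then show ?thesis
  proof (rule rec_fun_eqI[OF _ refl])
    fix xs :: "nat list"
    obtain m n where "prod_decode (xs ! 0) = (m, n)" by fastforce
    moreover from this have "xs ! 0 = prod_encode (m, n)" by (metis prod_decode_inverse)
    ultimately show "[triangle ([?s xs] ! 0), xs ! 0] ! 1 - [triangle ([?s xs] ! 0), xs ! 0] ! 0
        = pfst (xs ! 0)"
      by (simp add: pfst_def) (simp add: prod_encode_def)
  qed
qed

lemma rec_fun_psnd: "rec_fun 1 (\<lambda>xs. psnd (xs ! 0))"
proof -
  let ?s = "\<lambda>xs. case prod_decode ([xs ! 0] ! 0) of (m, n) \<Rightarrow> m + n"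
  have "rec_fun 1 (\<lambda>xs. [pfst ([xs ! 0] ! 0), ?s xs] ! 1 - [pfst ([xs ! 0] ! 0), ?s xs] ! 0)"
    by (rule rec_fun_comp2[OF rec_fun_diff] rec_fun_comp1[OF rec_fun_pfst]
        rec_fun_comp1[OF rec_fun_sum] rec_fun_nth | simp)+
  then show ?thesis
    by - (erule rec_fun_eqI, auto simp: pfst_def psnd_def split: prod.splits)
qed

text \<open>Unary functions suffice from here on: pairing, now invertible, packs several arguments
  into one.\<close>

definition total_rec :: "(nat \<Rightarrow> nat) \<Rightarrow> bool" where
  "total_rec F \<longleftrightarrow> (\<exists>r. \<forall>n. rec_eval r [n] (F n))"

lemma total_rec_iff: "total_rec F \<longleftrightarrow> rec_fun 1 (\<lambda>xs. F (xs ! 0))"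
  unfolding total_rec_def rec_fun_def by (intro ex_cong1) (auto simp: length_Suc_conv)

lemma total_rec_id: "total_rec (\<lambda>n. n)"
  unfolding total_rec_iff by (simp add: rec_fun_nth)

lemma total_rec_const: "total_rec (\<lambda>_. c)"
  unfolding total_rec_iff by (induction c) (simp_all add: rec_fun_zero rec_fun_Suc)

lemma total_rec_Suc: "total_rec F \<Longrightarrow> total_rec (\<lambda>n. Suc (F n))"
  unfolding total_rec_iff by (rule rec_fun_Suc)

lemma total_rec_comp: "total_rec F \<Longrightarrow> total_rec G \<Longrightarrow> total_rec (\<lambda>n. F (G n))"
  unfolding total_rec_iff using rec_fun_comp1[of "\<lambda>xs. F (xs ! 0)"] by simp

lemma total_rec_prod_encode:
  "total_rec F \<Longrightarrow> total_rec G \<Longrightarrow> total_rec (\<lambda>n. prod_encode (F n, G n))"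
  unfolding total_rec_iff by (auto dest: rec_fun_comp2[OF rec_fun_prod_encode])

lemma total_rec_pfst: "total_rec F \<Longrightarrow> total_rec (\<lambda>n. pfst (F n))"
  unfolding total_rec_iff by (auto dest: rec_fun_comp1[OF rec_fun_pfst])

lemma total_rec_psnd: "total_rec F \<Longrightarrow> total_rec (\<lambda>n. psnd (F n))"
  unfolding total_rec_iff by (auto dest: rec_fun_comp1[OF rec_fun_psnd])

lemma total_rec_rec_nat:
  assumes "total_rec A" "total_rec H" "total_rec N"
  shows "total_rec (\<lambda>n. rec_nat (A n) (\<lambda>i y. H (prod_encode (n, prod_encode (i, y)))) (N n))"
proof -
  have H: "rec_fun (Suc (Suc 1)) (\<lambda>xs. H (prod_encode (xs ! 2, prod_encode (xs ! 0, xs ! 1))))"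
  proof -
    have "rec_fun (Suc (Suc 1)) (\<lambda>xs. prod_encode (xs ! 0, xs ! 1))"
      using rec_fun_comp2[OF rec_fun_prod_encode rec_fun_nth rec_fun_nth,
        of 0 "Suc (Suc 1)" 1] by simp
    from rec_fun_comp2[OF rec_fun_prod_encode rec_fun_nth this, of 2]
    have "rec_fun (Suc (Suc 1)) (\<lambda>xs. prod_encode (xs ! 2, prod_encode (xs ! 0, xs ! 1)))"
      by simp
    from rec_fun_comp1[OF assms(2)[unfolded total_rec_iff] this] show ?thesis by simp
  qed
  have "rec_fun (Suc 1) (\<lambda>xs. rec_nat (A (tl xs ! 0))
     (\<lambda>i y. H (prod_encode ((i # y # tl xs) ! 2, prod_encode ((i # y # tl xs) ! 0, (i # y # tl xs) ! 1)))) (hd xs))"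
    by (rule rec_fun_rec_nat[OF assms(1)[unfolded total_rec_iff] H])
  then have "rec_fun 2 (\<lambda>xs. rec_nat (A (xs ! 1))
     (\<lambda>i y. H (prod_encode (xs ! 1, prod_encode (i, y)))) (xs ! 0))"
    by - (erule rec_fun_eqI, auto simp: numeral_2_eq_2 length_Suc_conv)
  from rec_fun_comp2[OF this assms(3)[unfolded total_rec_iff] rec_fun_nth, of 0]
  show ?thesis unfolding total_rec_iff by simp
qed

lemma total_rec_Least:
  assumes "total_rec F" "\<And>x. \<exists>n. F (prod_encode (n, x)) = 0"
  shows "total_rec (\<lambda>x. LEAST n. F (prod_encode (n, x)) = 0)"
proof -
  have "rec_fun (Suc 1) (\<lambda>xs. F (prod_encode (xs ! 0, xs ! 1)))"
    using rec_fun_comp1[OF assms(1)[unfolded total_rec_iff] rec_fun_prod_encode]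
    by (simp add: numeral_2_eq_2)
  from rec_fun_Least[OF this] assms(2) show ?thesis
    unfolding total_rec_iff by simp
qed

subsection \<open>Computable functions on encodable types\<close>

class encodable =
  fixes enc :: "'a \<Rightarrow> nat"
  assumes inj_enc: "inj enc"

lemma enc_eq_iff [simp]: "enc x = enc y \<longleftrightarrow> x = y"
  using inj_enc by (auto dest: injD)

instantiation nat :: encodable
begin
definition enc_nat :: "nat \<Rightarrow> nat" where [simp]: "enc_nat n = n"
instance by standard (simp add: inj_def)
end

instantiation bool :: encodable
begin
definition enc_bool :: "bool \<Rightarrow> nat" where "enc_bool = of_bool"
instance by standard (auto simp: inj_def enc_bool_def)
end

instantiation prod :: (encodable, encodable) encodable
begin
definition enc_prod :: "'a \<times> 'b \<Rightarrow> nat" where "enc_prod p = prod_encode (enc (fst p), enc (snd p))"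
instance by standard (auto simp: inj_def enc_prod_def)
end

instantiation list :: (encodable) encodable
begin
definition enc_list :: "'a list \<Rightarrow> nat" where "enc_list xs = list_encode (map enc xs)"
instance
proof
  have "inj (list_encode \<circ> map (enc :: 'a \<Rightarrow> nat))"
    by (intro inj_compose inj_list_encode) (simp add: inj_enc)
  then show "inj (enc :: 'a list \<Rightarrow> nat)" by (simp add: enc_list_def inj_def)
qed
end

instantiation mso :: encodable
begin
definition enc_mso :: "mso \<Rightarrow> nat" where "enc_mso = mso_encode"
instance by standard (auto simp: inj_def enc_mso_def mso_encode_inject)
end

lemma enc_simps [simp]:
  "enc (a, b) = prod_encode (enc a, enc b)"
  "enc ([] :: 'c::encodable list) = 0" "enc (x # xs) = Suc (prod_encode (enc x, enc xs))"
  by (simp_all add: enc_prod_def enc_list_def)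

text \<open>The code of a list bounds the number of steps needed to traverse it, so list recursion
  becomes primitive recursion on the code.\<close>

lemma length_le_enc: "length xs \<le> enc xs"
proof (induction xs)
  case (Cons x xs)
  then show ?case using le_prod_encode_2[of "enc xs" "enc x"] by simp
qed simp

text \<open>
  The function on codes has to be total also on numbers that encode nothing: primitive
  recursion on codes evaluates its step function at such numbers.
\<close>

definition computable :: "('a::encodable \<Rightarrow> 'b::encodable) \<Rightarrow> bool" where
  "computable f \<longleftrightarrow> (\<exists>F. total_rec F \<and> (\<forall>x. F (enc x) = enc (f x)))"

named_theorems computable_intros

lemma computableI: "total_rec F \<Longrightarrow> (\<And>x. F (enc x) = enc (f x)) \<Longrightarrow> computable f"
  unfolding computable_def by blast

lemma computable_nat_iff: "computable (f :: nat \<Rightarrow> 'b::encodable) \<longleftrightarrow> total_rec (\<lambda>n. enc (f n))"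
proof
  assume "computable f"
  then obtain F where "total_rec F" "\<And>x. F x = enc (f x)" unfolding computable_def by auto
  moreover from this have "F = (\<lambda>n. enc (f n))" by auto
  ultimately show "total_rec (\<lambda>n. enc (f n))" by simp
qed (auto intro: computableI)

lemma computable_id [computable_intros]: "computable (\<lambda>x. x)"
  by (rule computableI[OF total_rec_id]) simp

lemma computable_const [computable_intros]: "computable (\<lambda>x. c)"
  by (rule computableI[OF total_rec_const]) simp

lemma computable_comp: "computable f \<Longrightarrow> computable g \<Longrightarrow> computable (\<lambda>x. f (g x))"
  unfolding computable_def by (metis total_rec_comp)

lemma computable_comp2:
  assumes "computable (\<lambda>z. f (fst z) (snd z))" "computable g" "computable h"
  shows "computable (\<lambda>x. f (g x) (h x))"
proof -
  obtain F G H where F: "total_rec F" "\<And>x y. F (enc (x, y)) = enc (f x y)"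
    and G: "total_rec G" "\<And>x. G (enc x) = enc (g x)" and H: "total_rec H" "\<And>x. H (enc x) = enc (h x)"
    using assms unfolding computable_def by force
  show ?thesis
    by (rule computableI[OF total_rec_comp[OF F(1) total_rec_prod_encode[OF G(1) H(1)]]])
      (use F G H in simp)
qed

lemma computable_Pair [computable_intros]:
  "computable f \<Longrightarrow> computable g \<Longrightarrow> computable (\<lambda>x. (f x, g x))"
  by (rule computable_comp2[where f = Pair]) (simp_all add: computable_id)

lemma computable_fst [computable_intros]: "computable f \<Longrightarrow> computable (\<lambda>x. fst (f x))"
  by (rule computable_comp[of fst]) (auto intro: computableI[OF total_rec_pfst[OF total_rec_id]])

lemma computable_snd [computable_intros]: "computable f \<Longrightarrow> computable (\<lambda>x. snd (f x))"
  by (rule computable_comp[of snd]) (auto intro: computableI[OF total_rec_psnd[OF total_rec_id]])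

lemma computable_comp3:
  assumes "computable (\<lambda>z. f (fst z) (fst (snd z)) (snd (snd z)))"
    "computable g" "computable h" "computable i"
  shows "computable (\<lambda>x. f (g x) (h x) (i x))"
  using computable_comp2[where f = "\<lambda>a p. f a (fst p) (snd p)" and h = "\<lambda>x. (h x, i x)"] assms
  by (auto intro: computable_intros)

lemma computable_Suc [computable_intros]: "computable f \<Longrightarrow> computable (\<lambda>x. Suc (f x))"
  by (rule computable_comp[of Suc]) (auto intro: computableI[OF total_rec_Suc[OF total_rec_id]])

lemma computable_enc [computable_intros]: "computable f \<Longrightarrow> computable (\<lambda>x. enc (f x))"
  by (rule computable_comp[of enc]) (auto intro: computableI[OF total_rec_id])

lemma computable_rec_nat [computable_intros]:
  assumes "computable a" "computable (\<lambda>z. h (fst z) (fst (snd z)) (snd (snd z)))" "computable n"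
  shows "computable (\<lambda>x. rec_nat (a x) (h x) (n x))"
proof -
  obtain A H N where A: "total_rec A" "\<And>x. A (enc x) = enc (a x)"
    and H: "total_rec H" "\<And>x i y. H (enc (x, i, y)) = enc (h x i y)"
    and N: "total_rec N" "\<And>x. N (enc x) = enc (n x)"
    using assms unfolding computable_def by force
  have "rec_nat (A (enc x)) (\<lambda>i y. H (prod_encode (enc x, prod_encode (i, y)))) m
      = enc (rec_nat (a x) (h x) m)" for x m
    by (induction m) (use A H in \<open>simp_all\<close>)
  with A H N show ?thesis
    by (intro computableI[OF total_rec_rec_nat[OF A(1) H(1) N(1)]]) simp
qed

section \<open>Case distinctions, Boolean connectives and arithmetic\<close>

lemma computable_If [computable_intros]:
  assumes "computable b" "computable f" "computable g"
  shows "computable (\<lambda>x. if b x then f x else g x)"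
proof -
  \<comment> \<open>The code of the condition counts the steps: none for \<open>False\<close>, one
    for \<open>True\<close>. Below the binder of the step function \<open>x\<close> is a component
    of a tuple, so the computability of \<open>f\<close> enters through
    \<open>computable_comp\<close>; later proofs treat parameters below binders in the same
    way.\<close>
  have "computable (\<lambda>x. rec_nat (g x) (\<lambda>_ _. f x) (enc (b x)))"
    by (intro computable_intros assms computable_comp[OF assms(2)])
  moreover have "rec_nat (g x) (\<lambda>_ _. f x) (enc (b x)) = (if b x then f x else g x)" for x
    by (simp add: enc_bool_def)
  ultimately show ?thesis by simp
qed

lemma computable_not [computable_intros]:
  assumes "computable b" shows "computable (\<lambda>x. \<not> b x)"
proof -
  have "computable (\<lambda>x. if b x then False else True)" by (intro computable_intros assms)
  then show ?thesis by (rule back_subst) auto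
qed

lemma computable_conj [computable_intros]:
  assumes "computable a" "computable b" shows "computable (\<lambda>x. a x \<and> b x)"
proof -
  have "computable (\<lambda>x. if a x then b x else False)" by (intro computable_intros assms)
  moreover have "(if p then q else False) = (p \<and> q)" for p q by simp
  ultimately show ?thesis by (simp only:)
qed

lemma computable_disj [computable_intros]:
  assumes "computable a" "computable b" shows "computable (\<lambda>x. a x \<or> b x)"
proof -
  have "computable (\<lambda>x. if a x then True else b x)" by (intro computable_intros assms)
  moreover have "(if p then True else q) = (p \<or> q)" for p q by simp
  ultimately show ?thesis by (simp only:)
qed

lemma computable_case_nat [computable_intros]:
  assumes "computable a" "computable (\<lambda>z. h (fst z) (snd z))" "computable n"
  shows "computable (\<lambda>x. case n x of 0 \<Rightarrow> a x | Suc i \<Rightarrow> h x i)"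
proof -
  have "computable (\<lambda>x. rec_nat (a x) (\<lambda>i _. h x i) (n x))"
    by (intro computable_intros assms computable_comp2[where f = h])
  moreover have "rec_nat (a x) (\<lambda>i _. h x i) (n x) = (case n x of 0 \<Rightarrow> a x | Suc i \<Rightarrow> h x i)" for x
    by (cases "n x") auto
  ultimately show ?thesis by simp
qed

lemma computable_add [computable_intros]:
  assumes "computable a" "computable (b :: _ \<Rightarrow> nat)" shows "computable (\<lambda>x. a x + b x)"
proof -
  have "computable (\<lambda>x. rec_nat (b x) (\<lambda>_. Suc) (a x))" by (intro computable_intros assms)
  moreover have "rec_nat n (\<lambda>_. Suc) m = m + n" for m n by (induction m) auto
  ultimately show ?thesis by simp
qed

lemma computable_mult [computable_intros]:
  assumes "computable a" "computable (b :: _ \<Rightarrow> nat)" shows "computable (\<lambda>x. a x * b x)"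
proof -
  have "computable (\<lambda>x. rec_nat 0 (\<lambda>_ y. b x + y) (a x))"
    by (intro computable_intros assms computable_comp[OF assms(2)])
  moreover have "rec_nat 0 (\<lambda>_ y. n + y) m = m * n" for m n :: nat by (induction m) auto
  ultimately show ?thesis by simp
qed

lemma computable_diff [computable_intros]:
  assumes "computable a" "computable (b :: _ \<Rightarrow> nat)" shows "computable (\<lambda>x. a x - b x)"
proof -
  have "computable (\<lambda>x. rec_nat (a x) (\<lambda>_ y. case y of 0 \<Rightarrow> 0 | Suc z \<Rightarrow> z) (b x))"
    by (intro computable_intros assms)
  moreover have "rec_nat m (\<lambda>_ y. case y of 0 \<Rightarrow> 0 | Suc z \<Rightarrow> z) n = m - n" for m n :: nat
    by (induction n) (auto split: nat.splits)
  ultimately show ?thesis by simp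
qed

lemma computable_eq [computable_intros]:
  assumes "computable a" "computable b" shows "computable (\<lambda>x. a x = b x)"
proof -
  have "computable (\<lambda>x. case (enc (a x) - enc (b x)) + (enc (b x) - enc (a x)) of 0 \<Rightarrow> True | Suc _ \<Rightarrow> False)"
    by (intro computable_intros assms)
  moreover have "(case (enc (a x) - enc (b x)) + (enc (b x) - enc (a x)) of 0 \<Rightarrow> True | Suc _ \<Rightarrow> False)
      \<longleftrightarrow> a x = b x" for x
  proof -
    have "(case (m - n) + (n - m) of 0 \<Rightarrow> True | Suc _ \<Rightarrow> False) \<longleftrightarrow> m = n" for m n :: nat
      by (auto split: nat.splits)
    then show ?thesis by simp
  qed
  ultimately show ?thesis by simp
qed

lemma computable_power [computable_intros]:
  assumes "computable a" "computable b" shows "computable (\<lambda>x. (a x :: nat) ^ b x)"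
proof -
  have "computable (\<lambda>x. rec_nat 1 (\<lambda>_ y. a x * y) (b x))"
    by (intro computable_intros assms computable_comp[OF assms(1)])
  moreover have "rec_nat 1 (\<lambda>_ y. m * y) n = m ^ n" for m n :: nat by (induction n) auto
  ultimately show ?thesis by simp
qed

lemma computable_fact [computable_intros]:
  assumes "computable a" shows "computable (\<lambda>x. fact (a x) :: nat)"
proof -
  have "computable (\<lambda>x. rec_nat 1 (\<lambda>n y. Suc n * y) (a x))"
    by (intro computable_intros assms)
  moreover have "rec_nat 1 (\<lambda>n y. Suc n * y) n = fact n" for n :: nat by (induction n) auto
  ultimately show ?thesis by simp
qed

text \<open>The parameter is a number rather than a value of an arbitrary encodable type, because
  the search has to succeed at every number, including those that would encode nothing.\<close>

lemma computable_Least: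
  fixes p :: "nat \<Rightarrow> nat \<Rightarrow> bool"
  assumes "computable (\<lambda>z. p (fst z) (snd z))" "\<And>x. \<exists>n. p x n"
  shows "computable (\<lambda>x. LEAST n. p x n)"
proof -
  have "computable (\<lambda>z. \<not> p (snd z) (fst z))"
    by (intro computable_intros computable_comp2[OF assms(1)])
  then obtain F where F: "total_rec F" "\<And>x n. F (prod_encode (n, x)) = enc (\<not> p x n)"
    unfolding computable_def by force
  have *: "F (prod_encode (n, x)) = 0 \<longleftrightarrow> p x n" for n x by (simp add: F(2) enc_bool_def)
  from total_rec_Least[OF F(1)] assms(2) show ?thesis
    unfolding computable_nat_iff by (simp add: *)
qed

subsection \<open>Lists\<close>

lemma computable_Cons [computable_intros]:
  assumes "computable f" "computable g" shows "computable (\<lambda>x. f x # g x)"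
proof -
  have "computable (\<lambda>z :: 'b \<times> 'b list. fst z # snd z)"
    by (rule computableI[OF total_rec_Suc[OF total_rec_id]]) auto
  then show ?thesis by (rule computable_comp2[OF _ assms])
qed

text \<open>The code of a non-empty list is the successor of the code of head and tail. The counter
  of the last recursion step is therefore exactly that pair, and the intermediate values are
  ignored.\<close>

lemma computable_case_list [computable_intros]:
  assumes "computable a" "computable (\<lambda>z. h (fst z) (fst (snd z)) (snd (snd z)))" "computable l"
  shows "computable (\<lambda>x. case l x of [] \<Rightarrow> a x | y # ys \<Rightarrow> h x y ys)"
proof -
  obtain A H L where A: "total_rec A" "\<And>x. A (enc x) = enc (a x)"
    and H: "total_rec H" "\<And>x y ys. H (enc (x, y, ys)) = enc (h x y ys)"
    and L: "total_rec L" "\<And>x. L (enc x) = enc (l x)"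
    using assms unfolding computable_def by force
  have "total_rec (\<lambda>n. rec_nat (A n)
      (\<lambda>i y. H (prod_encode (pfst (prod_encode (n, prod_encode (i, y))),
                 pfst (psnd (prod_encode (n, prod_encode (i, y))))))) (L n))"
    using total_rec_rec_nat[OF A(1) total_rec_comp[OF H(1) total_rec_prod_encode[OF
        total_rec_pfst[OF total_rec_id] total_rec_pfst[OF total_rec_psnd[OF total_rec_id]]]] L(1)] .
  then have "total_rec (\<lambda>n. rec_nat (A n) (\<lambda>i y. H (prod_encode (n, i))) (L n))" by simp
  then show ?thesis
  proof (rule computableI)
    show "rec_nat (A (enc x)) (\<lambda>i y. H (prod_encode (enc x, i))) (L (enc x))
        = enc (case l x of [] \<Rightarrow> a x | y # ys \<Rightarrow> h x y ys)" for x
      using A H L by (cases "l x") auto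
  qed
qed

lemma computable_fold:
  assumes "computable (\<lambda>z. g (fst z) (fst (snd z)) (snd (snd z)))" "computable l" "computable a"
  shows "computable (\<lambda>x. fold (g x) (l x) (a x))"
proof -
  let ?step = "\<lambda>x s. case fst s of [] \<Rightarrow> s | y # ys \<Rightarrow> (ys, g x y (snd s))"
  \<comment> \<open>An exhausted list leaves the state alone, so running more steps than the list
    has entries does no harm.\<close>
  have "computable (\<lambda>x. snd (rec_nat (l x, a x) (\<lambda>_ s. ?step x s) (enc (l x))))"
    by (intro computable_intros computable_comp3[OF assms(1)] assms)
  moreover have "snd (rec_nat (l, a) (\<lambda>_ s. ?step x s) n) = fold (g x) l a" if "length l \<le> n" for x l a n
    using that
  proof (induction l arbitrary: a n)
    case Nil
    have "rec_nat ([], a) (\<lambda>_ s. ?step x s) n = ([], a)" by (induction n) auto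
    then show ?case by simp
  next
    case (Cons y ys)
    then obtain m where n: "n = Suc m" and m: "length ys \<le> m" by (cases n) auto
    have "rec_nat (y # ys, a) (\<lambda>_ s. ?step x s) (Suc m) = rec_nat (ys, g x y a) (\<lambda>_ s. ?step x s) m"
      by (induction m) auto
    then show ?case using Cons.IH[OF m] n by simp
  qed
  ultimately show ?thesis by (simp add: length_le_enc)
qed

lemma computable_rev [computable_intros]:
  assumes "computable l" shows "computable (\<lambda>x. rev (l x))"
proof -
  have "computable (\<lambda>x. fold (\<lambda>y ys. y # ys) (l x) [])"
    by (intro computable_fold computable_intros assms)
  then show ?thesis by (simp add: rev_conv_fold)
qed

lemma computable_foldr [computable_intros]:
  assumes "computable (\<lambda>z. g (fst z) (fst (snd z)) (snd (snd z)))" "computable l" "computable a"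
  shows "computable (\<lambda>x. foldr (g x) (l x) (a x))"
  unfolding foldr_conv_fold by (intro computable_fold computable_intros assms)

lemma computable_append [computable_intros]:
  assumes "computable k" "computable l" shows "computable (\<lambda>x. k x @ l x)"
proof -
  have "computable (\<lambda>x. foldr (\<lambda>y ys. y # ys) (k x) (l x))" by (intro computable_intros assms)
  moreover have "foldr (\<lambda>y ys. y # ys) k l = k @ l" for k l :: "'b list" by (induction k) auto
  ultimately show ?thesis by simp
qed

lemma computable_map [computable_intros]:
  assumes "computable (\<lambda>z. g (fst z) (snd z))" "computable l"
  shows "computable (\<lambda>x. map (g x) (l x))"
proof -
  have "computable (\<lambda>x. foldr (\<lambda>y ys. g x y # ys) (l x) [])"
    by (intro computable_intros computable_comp2[OF assms(1)] assms)
  moreover have "foldr (\<lambda>y ys. h y # ys) l [] = map h l" for h :: "'b \<Rightarrow> 'c" and l by (induction l) auto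
  ultimately show ?thesis by simp
qed

lemma computable_concat [computable_intros]:
  assumes "computable l" shows "computable (\<lambda>x. concat (l x))"
proof -
  have "computable (\<lambda>x. foldr (\<lambda>y ys. y @ ys) (l x) [])" by (intro computable_intros assms)
  moreover have "foldr (\<lambda>y ys. y @ ys) l [] = concat l" for l :: "'b list list" by (induction l) auto
  ultimately show ?thesis by simp
qed

lemma computable_filter [computable_intros]:
  assumes "computable (\<lambda>z. g (fst z) (snd z))" "computable l"
  shows "computable (\<lambda>x. filter (g x) (l x))"
proof -
  have "computable (\<lambda>x. foldr (\<lambda>y ys. if g x y then y # ys else ys) (l x) [])"
    by (intro computable_intros computable_comp2[OF assms(1)] assms)
  moreover have "foldr (\<lambda>y ys. if h y then y # ys else ys) l [] = filter h l" for h and l :: "'b list"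
    by (induction l) auto
  ultimately show ?thesis by simp
qed

lemma computable_bex_set [computable_intros]:
  assumes "computable (\<lambda>z. g (fst z) (snd z))" "computable l"
  shows "computable (\<lambda>x. \<exists>y\<in>set (l x). g x y)"
proof -
  have "computable (\<lambda>x. foldr (\<lambda>y b. g x y \<or> b) (l x) False)"
    by (intro computable_intros computable_comp2[OF assms(1)] assms)
  moreover have "foldr (\<lambda>y b. h y \<or> b) l False \<longleftrightarrow> (\<exists>y\<in>set l. h y)" for h and l :: "'b list"
    by (induction l) auto
  ultimately show ?thesis by simp
qed

lemma computable_length [computable_intros]:
  assumes "computable l" shows "computable (\<lambda>x. length (l x))"
proof -
  have "computable (\<lambda>x. foldr (\<lambda>_. Suc) (l x) 0)" by (intro computable_intros assms)
  moreover have "foldr (\<lambda>_. Suc) l 0 = length l" for l :: "'b list" by (induction l) auto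
  ultimately show ?thesis by simp
qed

lemma computable_tl [computable_intros]:
  assumes "computable l" shows "computable (\<lambda>x. tl (l x))"
  unfolding tl_def by (intro computable_intros assms)

lemma computable_drop [computable_intros]:
  assumes "computable n" "computable l" shows "computable (\<lambda>x. drop (n x) (l x))"
proof -
  have "computable (\<lambda>x. rec_nat (l x) (\<lambda>_ k. tl k) (n x))" by (intro computable_intros assms)
  moreover have "rec_nat l (\<lambda>_ k. tl k) n = drop n l" for n and l :: "'b list"
    by (induction n) (auto simp: drop_Suc tl_drop)
  ultimately show ?thesis by simp
qed

lemma computable_take [computable_intros]:
  assumes "computable n" "computable l" shows "computable (\<lambda>x. take (n x) (l x))"
proof -
  have "computable (\<lambda>x. rev (drop (length (l x) - n x) (rev (l x))))"
    by (intro computable_intros assms)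
  moreover have "rev (drop (length l - n) (rev l)) = take n l" for n and l :: "'b list"
    by (cases "n \<le> length l") (simp_all add: rev_drop)
  ultimately show ?thesis by simp
qed

lemma computable_replicate [computable_intros]:
  assumes "computable n" "computable a" shows "computable (\<lambda>x. replicate (n x) (a x))"
proof -
  have "computable (\<lambda>x. rec_nat [] (\<lambda>_ l. a x # l) (n x))"
    by (intro computable_intros assms computable_comp[OF assms(2)])
  moreover have "rec_nat [] (\<lambda>_ l. a # l) n = replicate n a" for n and a :: 'b
    by (induction n) auto
  ultimately show ?thesis by simp
qed

lemma computable_upt [computable_intros]:
  assumes "computable n" shows "computable (\<lambda>x. [0..<n x])"
proof -
  have "computable (\<lambda>x. rec_nat [] (\<lambda>i l. l @ [i]) (n x))" by (intro computable_intros assms)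
  moreover have "rec_nat [] (\<lambda>i l. l @ [i]) n = [0..<n]" for n by (induction n) auto
  ultimately show ?thesis by simp
qed

lemma computable_zip [computable_intros]:
  assumes "computable k" "computable l" shows "computable (\<lambda>x. zip (k x) (l x))"
proof -
  let ?f = "\<lambda>a (s :: ('b \<times> 'c) list \<times> 'c list). case snd s of [] \<Rightarrow> s | b # bs \<Rightarrow> (fst s @ [(a, b)], bs)"
  have "computable (\<lambda>x. fst (fold ?f (k x) ([], l x)))"
    by (intro computable_intros computable_fold assms)
  moreover have "fst (fold ?f k (zs, l)) = zs @ zip k l" for k zs l
  proof (induction k arbitrary: zs l)
    case (Cons a k)
    have "fold ?f k (zs, []) = (zs, [])" by (induction k) auto
    then show ?case using Cons by (cases l) auto
  qed simp
  ultimately show ?thesis by simp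
qed

subsection \<open>Recursion over a well-founded call tree\<close>

context
  fixes calls :: "'a::encodable \<Rightarrow> 'a list" and G :: "'a \<Rightarrow> 'b::encodable list \<Rightarrow> 'b"
begin

text \<open>
  The call tree is expanded level by level; the values are then computed from the deepest level
  upwards, each node consuming as many values from the level below as it has calls.
\<close>

definition call_levels :: "'a \<Rightarrow> nat \<Rightarrow> 'a list \<times> 'a list list" where
  "call_levels x = rec_nat ([x], []) (\<lambda>_ s. (concat (map calls (fst s)), fst s # snd s))"

definition level_values :: "'a list \<Rightarrow> 'b list \<Rightarrow> 'b list" where
  "level_values l vs = snd (fold (\<lambda>x s. (drop (length (calls x)) (fst s),
     snd s @ [G x (take (length (calls x)) (fst s))])) l (vs, []))"

lemma level_values_map:
  assumes "\<And>x. f x = G x (map f (calls x))"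
  shows "level_values l (map f (concat (map calls l))) = map f l"
proof -
  have "snd (fold (\<lambda>x s. (drop (length (calls x)) (fst s),
     snd s @ [G x (take (length (calls x)) (fst s))])) l (map f (concat (map calls l)), us)) = us @ map f l"
    for us
    by (induction l arbitrary: us) (simp_all flip: assms)
  then show ?thesis by (simp add: level_values_def)
qed

lemma fold_call_levels:
  assumes "\<And>x. f x = G x (map f (calls x))"
  shows "fold level_values (snd (call_levels x n)) (map f (fst (call_levels x n))) = [f x]"
  by (induction n) (simp_all add: call_levels_def level_values_map[OF assms])

lemma call_levels_measure:
  assumes "\<And>x y. y \<in> set (calls x) \<Longrightarrow> m y < (m x :: nat)"
  shows "y \<in> set (fst (call_levels x n)) \<Longrightarrow> m y + n \<le> m x"
proof (induction n arbitrary: y)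
  case (Suc n)
  then obtain z where "z \<in> set (fst (call_levels x n))" "y \<in> set (calls z)"
    by (auto simp: call_levels_def)
  with Suc.IH[of z] assms[of y z] show ?case by simp
qed (simp add: call_levels_def)

text \<open>The measure drops with every call, so the level at depth \<open>m x + 1\<close> is empty
  and its list of values is \<open>[]\<close>. Folding from there over the stored levels, deepest
  first, reaches the value at the root. The arguments may change freely between calls, which plain
  primitive recursion does not allow.\<close>

lemma computable_rec:
  assumes calls: "computable calls" and G: "computable (\<lambda>z. G (fst z) (snd z))"
    and m: "computable m"
    and f: "\<And>x. f x = G x (map f (calls x))"
    and less: "\<And>x y. y \<in> set (calls x) \<Longrightarrow> m y < (m x :: nat)"
  shows "computable f"
proof -
  have levels: "computable (\<lambda>x. call_levels x (Suc (m x)))"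
    unfolding call_levels_def by (intro computable_intros computable_comp[OF calls] m)
  have vals: "computable (\<lambda>z. level_values (fst z) (snd z))"
    unfolding level_values_def
    by (intro computable_intros computable_comp[OF calls] computable_comp2[OF G] computable_fold)
  \<comment> \<open>The fold returns a one-element list; \<open>G x []\<close> is only a default for
    the impossible empty case.\<close>
  have "computable (\<lambda>x. case fold level_values (snd (call_levels x (Suc (m x)))) [] of
      [] \<Rightarrow> G x [] | v # _ \<Rightarrow> v)"
    by (intro computable_intros computable_comp2[OF G] computable_fold computable_comp2[OF vals]
        computable_snd[OF levels])
  moreover have "(case fold level_values (snd (call_levels x (Suc (m x)))) [] of
      [] \<Rightarrow> G x [] | v # _ \<Rightarrow> v) = f x" for x
  proof -
    have "set (fst (call_levels x (Suc (m x)))) = {}"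
      using call_levels_measure[of m, OF less, of _ x "Suc (m x)"] by fastforce
    with fold_call_levels[of f, OF f, of x "Suc (m x)"] show ?thesis by simp
  qed
  ultimately show ?thesis by simp
qed

end

subsection \<open>Formulas\<close>

lemma computable_mso_constructors [computable_intros]:
  fixes a b :: "'a::encodable \<Rightarrow> nat" and f g :: "'a \<Rightarrow> mso"
  shows "computable a \<Longrightarrow> computable b \<Longrightarrow> computable (\<lambda>x. Eq (a x) (b x))"
    and "computable a \<Longrightarrow> computable b \<Longrightarrow> computable (\<lambda>x. Le (a x) (b x))"
    and "computable a \<Longrightarrow> computable (\<lambda>x. InP (a x))"
    and "computable a \<Longrightarrow> computable b \<Longrightarrow> computable (\<lambda>x. Mem (a x) (b x))"
    and "computable f \<Longrightarrow> computable (\<lambda>x. Neg (f x))"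
    and "computable f \<Longrightarrow> computable g \<Longrightarrow> computable (\<lambda>x. Conj (f x) (g x))"
    and "computable a \<Longrightarrow> computable f \<Longrightarrow> computable (\<lambda>x. ExElem (a x) (f x))"
    and "computable a \<Longrightarrow> computable f \<Longrightarrow> computable (\<lambda>x. ExSet (a x) (f x))"
proof -
  have tag: "computable (\<lambda>x. F (p x))"
    if "computable p" "\<And>y. enc (F y) = prod_encode (c, enc y)"
    for p :: "'a \<Rightarrow> 'b::encodable" and F :: "'b \<Rightarrow> mso" and c
  proof (rule computable_comp[OF _ that(1)])
    show "computable F"
      by (rule computableI[OF total_rec_prod_encode[OF total_rec_const total_rec_id]])
        (simp add: that(2))
  qed
  show "computable a \<Longrightarrow> computable b \<Longrightarrow> computable (\<lambda>x. Eq (a x) (b x))"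
    by (drule (1) computable_Pair, drule tag[of _ "\<lambda>p. Eq (fst p) (snd p)" 0]) (simp_all add: enc_mso_def enc_prod_def)
  show "computable a \<Longrightarrow> computable b \<Longrightarrow> computable (\<lambda>x. Le (a x) (b x))"
    by (drule (1) computable_Pair, drule tag[of _ "\<lambda>p. Le (fst p) (snd p)" 1]) (simp_all add: enc_mso_def enc_prod_def)
  show "computable a \<Longrightarrow> computable (\<lambda>x. InP (a x))"
    using tag[of a InP 2] by (simp add: enc_mso_def)
  show "computable a \<Longrightarrow> computable b \<Longrightarrow> computable (\<lambda>x. Mem (a x) (b x))"
    by (drule (1) computable_Pair, drule tag[of _ "\<lambda>p. Mem (fst p) (snd p)" 3]) (simp_all add: enc_mso_def enc_prod_def)
  show "computable f \<Longrightarrow> computable (\<lambda>x. Neg (f x))"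
    using tag[of f Neg 4] by (simp add: enc_mso_def)
  show "computable f \<Longrightarrow> computable g \<Longrightarrow> computable (\<lambda>x. Conj (f x) (g x))"
    by (drule (1) computable_Pair, drule tag[of _ "\<lambda>p. Conj (fst p) (snd p)" 5]) (simp_all add: enc_mso_def enc_prod_def)
  show "computable a \<Longrightarrow> computable f \<Longrightarrow> computable (\<lambda>x. ExElem (a x) (f x))"
    by (drule (1) computable_Pair, drule tag[of _ "\<lambda>p. ExElem (fst p) (snd p)" 6]) (simp_all add: enc_mso_def enc_prod_def)
  show "computable a \<Longrightarrow> computable f \<Longrightarrow> computable (\<lambda>x. ExSet (a x) (f x))"
    by (drule (1) computable_Pair, drule tag[of _ "\<lambda>p. ExSet (fst p) (snd p)" 7]) (simp_all add: enc_mso_def enc_prod_def)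
qed

lemma computable_pfst [computable_intros]: "computable f \<Longrightarrow> computable (\<lambda>x. pfst (f x))"
  by (rule computable_comp[of pfst]) (auto intro: computableI[OF total_rec_pfst[OF total_rec_id]])

lemma computable_psnd [computable_intros]: "computable f \<Longrightarrow> computable (\<lambda>x. psnd (f x))"
  by (rule computable_comp[of psnd]) (auto intro: computableI[OF total_rec_psnd[OF total_rec_id]])

lemma computable_prod_encode [computable_intros]:
  "computable f \<Longrightarrow> computable g \<Longrightarrow> computable (\<lambda>x. prod_encode (f x, g x))"
  using computable_enc[of "\<lambda>x. (f x, g x)"] computable_Pair[of f g] by simp

lemma total_rec_iff_computable: "total_rec F \<longleftrightarrow> computable F"
  by (simp add: computable_nat_iff)

lemma computable_case_mso [computable_intros]:
  assumes "computable (\<lambda>z. h0 (fst z) (fst (snd z)) (snd (snd z)))"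
    "computable (\<lambda>z. h1 (fst z) (fst (snd z)) (snd (snd z)))"
    "computable (\<lambda>z. h2 (fst z) (snd z))"
    "computable (\<lambda>z. h3 (fst z) (fst (snd z)) (snd (snd z)))"
    "computable (\<lambda>z. h4 (fst z) (snd z))"
    "computable (\<lambda>z. h5 (fst z) (fst (snd z)) (snd (snd z)))"
    "computable (\<lambda>z. h6 (fst z) (fst (snd z)) (snd (snd z)))"
    "computable (\<lambda>z. h7 (fst z) (fst (snd z)) (snd (snd z)))"
    "computable f"
  shows "computable (\<lambda>x. case f x of Eq a b \<Rightarrow> h0 x a b | Le a b \<Rightarrow> h1 x a b | InP a \<Rightarrow> h2 x a
    | Mem a b \<Rightarrow> h3 x a b | Neg g \<Rightarrow> h4 x g | Conj g g' \<Rightarrow> h5 x g g' | ExElem a g \<Rightarrow> h6 x a g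
    | ExSet a g \<Rightarrow> h7 x a g)"
proof -
  have E2: "\<exists>H. computable H \<and> (\<forall>x y. H (prod_encode (enc x, enc y)) = enc (h x y))"
    if "computable (\<lambda>z. h (fst z) (snd z))" for h :: "'a \<Rightarrow> 'c::encodable \<Rightarrow> 'b"
  proof -
    obtain H where "total_rec H" "\<And>z. H (enc z) = enc (h (fst z) (snd z))"
      using \<open>computable (\<lambda>z. h (fst z) (snd z))\<close> unfolding computable_def by blast
    from this(1) this(2)[of "(_, _)"] show ?thesis
      by (intro exI[of _ H]) (simp add: total_rec_iff_computable)
  qed
  have E3: "\<exists>H. computable H \<and> (\<forall>x y z. H (prod_encode (enc x, prod_encode (enc y, enc z))) = enc (h x y z))"
    if "computable (\<lambda>z. h (fst z) (fst (snd z)) (snd (snd z)))" for h :: "'a \<Rightarrow> 'c::encodable \<Rightarrow> 'd::encodable \<Rightarrow> 'b"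
    using E2[of "\<lambda>x p. h x (fst p) (snd p)"] that by force
  obtain C where C: "computable C" "\<And>x. C (enc x) = enc (f x)"
    using assms(9) unfolding computable_def[of f] total_rec_iff_computable by blast
  note H = E3[OF assms(1)] E3[OF assms(2)] E2[OF assms(3)] E3[OF assms(4)] E2[OF assms(5)]
    E3[OF assms(6)] E3[OF assms(7)] E3[OF assms(8)]
  from H(1) obtain H0 where H0: "computable H0"
    "\<And>x a b. H0 (prod_encode (enc x, prod_encode (enc a, enc b))) = enc (h0 x a b)" by blast
  from H(2) obtain H1 where H1: "computable H1"
    "\<And>x a b. H1 (prod_encode (enc x, prod_encode (enc a, enc b))) = enc (h1 x a b)" by blast
  from H(3) obtain H2 where H2: "computable H2"
    "\<And>x a. H2 (prod_encode (enc x, enc a)) = enc (h2 x a)" by blast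
  from H(4) obtain H3 where H3: "computable H3"
    "\<And>x a b. H3 (prod_encode (enc x, prod_encode (enc a, enc b))) = enc (h3 x a b)" by blast
  from H(5) obtain H4 where H4: "computable H4"
    "\<And>x g. H4 (prod_encode (enc x, enc g)) = enc (h4 x g)" by blast
  from H(6) obtain H5 where H5: "computable H5"
    "\<And>x g g'. H5 (prod_encode (enc x, prod_encode (enc g, enc g'))) = enc (h5 x g g')" by blast
  from H(7) obtain H6 where H6: "computable H6"
    "\<And>x a g. H6 (prod_encode (enc x, prod_encode (enc a, enc g))) = enc (h6 x a g)" by blast
  from H(8) obtain H7 where H7: "computable H7"
    "\<And>x a g. H7 (prod_encode (enc x, prod_encode (enc a, enc g))) = enc (h7 x a g)" by blast
  note hs = H0(1) H1(1) H2(1) H3(1) H4(1) H5(1) H6(1) H7(1)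
  \<comment> \<open>Totality on all numbers: a tag beyond 7 is treated like that of
    \<open>ExSet\<close>.\<close>
  let ?F = "\<lambda>n. let t = pfst (C n); p = prod_encode (n, psnd (C n)) in
    if t = 0 then H0 p else if t = 1 then H1 p else if t = 2 then H2 p else if t = 3 then H3 p else
    if t = 4 then H4 p else if t = 5 then H5 p else if t = 6 then H6 p else H7 p"
  have "total_rec ?F"
    unfolding total_rec_iff_computable Let_def
    by (intro computable_intros hs[THEN computable_comp] C(1))
  then show ?thesis
  proof (rule computableI)
    show "?F (enc x) = enc (case f x of Eq a b \<Rightarrow> h0 x a b | Le a b \<Rightarrow> h1 x a b | InP a \<Rightarrow> h2 x a
      | Mem a b \<Rightarrow> h3 x a b | Neg g \<Rightarrow> h4 x g | Conj g g' \<Rightarrow> h5 x g g' | ExElem a g \<Rightarrow> h6 x a g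
      | ExSet a g \<Rightarrow> h7 x a g)" for x
      using C(2)[of x] H0(2) H1(2) H2(2) H3(2) H4(2) H5(2) H6(2) H7(2)
      by (cases "f x") (simp_all add: enc_mso_def enc_prod_def)
  qed
qed

section \<open>Decoding formulas\<close>

lemma less_prod_encode_2: "0 < a \<Longrightarrow> b < prod_encode (a, b)"
  using le_prod_encode_2[of b 0] triangle_mono[of b "a + b"]
  by (simp add: prod_encode_def)

lemma psnd_less: "0 < pfst n \<Longrightarrow> psnd n < n"
  using less_prod_encode_2[of "pfst n" "psnd n"] by (simp add: pfst_def psnd_def)

lemma pfst_le: "pfst n \<le> n" and psnd_le: "psnd n \<le> n"
  using le_prod_encode_1[of "pfst n" "psnd n"] le_prod_encode_2[of "psnd n" "pfst n"]
  by (simp_all add: pfst_def psnd_def)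

definition subcodes :: "nat \<Rightarrow> nat list" where
  "subcodes n = (let t = pfst n; p = psnd n in
     if t = 4 then [p] else if t = 5 then [pfst p, psnd p]
     else if t = 6 \<or> t = 7 then [psnd p] else [])"

lemma subcodes_less: "m \<in> set (subcodes n) \<Longrightarrow> m < n"
  using psnd_less[of n] pfst_le[of "psnd n"] psnd_le[of "psnd n"]
  by (auto simp: subcodes_def Let_def split: if_splits)

text \<open>The default \<open>Eq 0 0\<close> makes decoding total. Numbers that encode no formula
  are recognised afterwards, since encoding the result cannot give them back.\<close>

function mso_decode :: "nat \<Rightarrow> mso" where
  "mso_decode n = (let t = pfst n; p = psnd n; gs = map mso_decode (subcodes n) in
     if t = 0 then Eq (pfst p) (psnd p) else if t = 1 then Le (pfst p) (psnd p)
     else if t = 2 then InP p else if t = 3 then Mem (pfst p) (psnd p)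
     else if t = 4 then Neg (hd gs) else if t = 5 then Conj (hd gs) (hd (tl gs))
     else if t = 6 then ExElem (pfst p) (hd gs) else if t = 7 then ExSet (pfst p) (hd gs)
     else Eq 0 0)"
  by auto
termination by (relation "measure id") (auto dest: subcodes_less)

declare mso_decode.simps [simp del]

lemma mso_decode_encode: "mso_decode (mso_encode f) = f"
  by (induction f; subst mso_decode.simps) (simp_all add: subcodes_def)

lemma computable_mso_decode: "computable mso_decode"
proof (rule computable_rec)
  \<comment> \<open>A case distinction with an explicit default stands in for \<open>hd\<close>,
    whose value at \<open>[]\<close> is unspecified.\<close>
  let ?hd = "\<lambda>gs. case gs of [] \<Rightarrow> Eq 0 0 | g # _ \<Rightarrow> g"
  let ?G = "\<lambda>n gs. let t = pfst n; p = psnd n in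
     if t = 0 then Eq (pfst p) (psnd p) else if t = 1 then Le (pfst p) (psnd p)
     else if t = 2 then InP p else if t = 3 then Mem (pfst p) (psnd p)
     else if t = 4 then Neg (?hd gs) else if t = 5 then Conj (?hd gs) (?hd (tl gs))
     else if t = 6 then ExElem (pfst p) (?hd gs) else if t = 7 then ExSet (pfst p) (?hd gs)
     else Eq 0 0"
  show "computable subcodes"
    unfolding subcodes_def Let_def by (intro computable_intros)
  show "computable (\<lambda>z. ?G (fst z) (snd z))"
    unfolding Let_def by (intro computable_intros)
  show "mso_decode n = ?G n (map mso_decode (subcodes n))" for n
    by (subst mso_decode.simps) (simp add: subcodes_def Let_def)
  show "computable (\<lambda>n :: nat. n)" by (rule computable_id)
qed (rule subcodes_less)

section \<open>Types of labelled linear orders\<close>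

text \<open>
  A labelled order is a set \<open>D\<close> with a map \<open>x\<close> sending a position to the list of its \<open>n\<close> labels,
  that is, to the membership bits of \<open>n\<close> subsets of \<open>D\<close>. There are only set quantifiers: an element
  is a set \<open>i\<close> with \<open>meets D x i i\<close> but not \<open>precedes D x i i\<close>.
\<close>

definition meets :: "'a::linorder set \<Rightarrow> ('a \<Rightarrow> bool list) \<Rightarrow> nat \<Rightarrow> nat \<Rightarrow> bool" where
  "meets D x i j \<longleftrightarrow> (\<exists>p\<in>D. x p ! i \<and> x p ! j)"

definition precedes :: "'a::linorder set \<Rightarrow> ('a \<Rightarrow> bool list) \<Rightarrow> nat \<Rightarrow> nat \<Rightarrow> bool" where
  "precedes D x i j \<longleftrightarrow> (\<exists>p\<in>D. \<exists>q\<in>D. p < q \<and> x p ! i \<and> x q ! j)"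

primrec ty :: "nat \<Rightarrow> nat \<Rightarrow> 'a::linorder set \<Rightarrow> ('a \<Rightarrow> bool list) \<Rightarrow> nat" where
  "ty 0 n D x = set_encode {c. \<exists>i<n. \<exists>j<n. c = prod_encode (i, prod_encode (j, 0)) \<and> meets D x i j
     \<or> c = prod_encode (i, prod_encode (j, 1)) \<and> precedes D x i j}"
| "ty (Suc k) n D x = set_encode (range (\<lambda>X. ty k (Suc n) D (\<lambda>p. X p # x p)))"

text \<open>A tower of \<open>k + 1\<close> powers of two, since each level codes sets of numbers
  below the previous bound. The base exceeds the codes of all atoms on the \<open>n + k\<close>
  labels that are present once depth 0 is reached. Being explicit, the bound is computable.\<close>

definition ty_bound :: "nat \<Rightarrow> nat \<Rightarrow> nat" where
  "ty_bound k n = rec_nat (prod_encode (n + k, prod_encode (n + k, 2))) (\<lambda>_. (^) 2) (Suc k)"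

lemma ty_bound_Suc: "ty_bound (Suc k) n = 2 ^ ty_bound k (Suc n)"
  by (simp add: ty_bound_def)

lemma prod_encode_mono: "a \<le> a' \<Longrightarrow> b \<le> b' \<Longrightarrow> prod_encode (a, b) \<le> prod_encode (a', b')"
  by (simp add: prod_encode_def add_mono triangle_mono)

lemma prod_encode_strict_mono: "a < a' \<Longrightarrow> b \<le> b' \<Longrightarrow> prod_encode (a, b) < prod_encode (a', b')"
  using triangle_mono[of "a + b" "a' + b'"] by (simp add: prod_encode_def)

lemma set_encode_less: "A \<subseteq> {..<b} \<Longrightarrow> set_encode A < 2 ^ b"
proof -
  assume "A \<subseteq> {..<b}"
  then have "set_encode A \<le> (\<Sum>i<b. 2 ^ i)"
    unfolding set_encode_def by (intro sum_mono2) auto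
  also have "\<dots> < 2 ^ b" by (induction b) auto
  finally show ?thesis .
qed

lemma ty_0_subset:
  "{c. \<exists>i<n. \<exists>j<n. c = prod_encode (i, prod_encode (j, 0)) \<and> meets D x i j
     \<or> c = prod_encode (i, prod_encode (j, 1)) \<and> precedes D x i j}
   \<subseteq> {..<prod_encode (n, prod_encode (n, 2))}"
  by (auto intro!: prod_encode_strict_mono prod_encode_mono)

lemma ty_less: "ty k n D x < ty_bound k n"
proof (induction k arbitrary: n x)
  case 0
  show ?case using set_encode_less[OF ty_0_subset] by (simp add: ty_bound_def)
next
  case (Suc k)
  then show ?case by (auto simp: ty_bound_Suc intro!: set_encode_less)
qed

section \<open>Equality of types as a back-and-forth condition, and its invariance\<close>

lemma ty_0_eq_iff:
  "ty 0 n D x = ty 0 n D' x' \<longleftrightarrow>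
    (\<forall>i<n. \<forall>j<n. (meets D x i j \<longleftrightarrow> meets D' x' i j) \<and> (precedes D x i j \<longleftrightarrow> precedes D' x' i j))"
  (is "?L \<longleftrightarrow> ?R")
proof
  assume ?L
  then have eq: "{c. \<exists>i<n. \<exists>j<n. c = prod_encode (i, prod_encode (j, 0)) \<and> meets D x i j
     \<or> c = prod_encode (i, prod_encode (j, 1)) \<and> precedes D x i j} =
    {c. \<exists>i<n. \<exists>j<n. c = prod_encode (i, prod_encode (j, 0)) \<and> meets D' x' i j
     \<or> c = prod_encode (i, prod_encode (j, 1)) \<and> precedes D' x' i j}" (is "?A = ?B")
    using finite_subset[OF ty_0_subset] by (simp add: set_encode_eq)
  have "prod_encode (i, prod_encode (j, b)) \<in> ?A \<longleftrightarrow> prod_encode (i, prod_encode (j, b)) \<in> ?B" for i j b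
    by (simp only: eq)
  from this[of _ _ 0] this[of _ _ 1] show ?R by auto
next
  assume ?R
  then show ?L by (simp cong: conj_cong)
qed

text \<open>Needed because \<open>set_encode\<close> is injective on finite sets only.\<close>

lemma finite_range_ty: "finite (range (\<lambda>X. ty k n D (f X)))"
  by (rule finite_subset[of _ "{..<ty_bound k n}"]) (auto simp: ty_less)

text \<open>The back-and-forth condition of Ehrenfeucht-Fraisse games. Later arguments use types
  through it and not through their numerical values.\<close>

lemma ty_Suc_eq_iff:
  fixes D :: "'a::linorder set" and D' :: "'b::linorder set"
  shows "ty (Suc k) n D x = ty (Suc k) n D' x' \<longleftrightarrow>
    (\<forall>X. \<exists>X'. ty k (Suc n) D (\<lambda>p. X p # x p) = ty k (Suc n) D' (\<lambda>p. X' p # x' p)) \<and>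
    (\<forall>X'. \<exists>X. ty k (Suc n) D (\<lambda>p. X p # x p) = ty k (Suc n) D' (\<lambda>p. X' p # x' p))"
proof -
  have "ty (Suc k) n D x = ty (Suc k) n D' x' \<longleftrightarrow>
      range (\<lambda>X. ty k (Suc n) D (\<lambda>p. X p # x p)) = range (\<lambda>X'. ty k (Suc n) D' (\<lambda>p. X' p # x' p))"
    by (simp add: set_encode_eq finite_range_ty)
  also have "\<dots> \<longleftrightarrow> (\<forall>X. \<exists>X'. ty k (Suc n) D (\<lambda>p. X p # x p) = ty k (Suc n) D' (\<lambda>p. X' p # x' p)) \<and>
    (\<forall>X'. \<exists>X. ty k (Suc n) D (\<lambda>p. X p # x p) = ty k (Suc n) D' (\<lambda>p. X' p # x' p))"
  proof -
    have "range f = range g \<longleftrightarrow> (\<forall>X. \<exists>X'. f X = g X') \<and> (\<forall>X'. \<exists>X. f X = g X')"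
      for f :: "('a \<Rightarrow> bool) \<Rightarrow> nat" and g :: "('b \<Rightarrow> bool) \<Rightarrow> nat"
      by (auto simp: set_eq_iff image_iff) (metis rangeI)+
    then show ?thesis .
  qed
  finally show ?thesis .
qed

lemma ty_cong:
  assumes "\<And>p. p \<in> D \<Longrightarrow> x p = x' p"
  shows "ty k n D x = ty k n D x'"
  using assms
proof (induction k arbitrary: n x x')
  case 0
  then show ?case by (auto simp: ty_0_eq_iff meets_def precedes_def simp del: ty.simps)
next
  case (Suc k)
  have "ty k (Suc n) D (\<lambda>p. X p # x p) = ty k (Suc n) D (\<lambda>p. X p # x' p)" for X
    by (rule Suc.IH) (simp add: Suc.prems)
  then show ?case by simp
qed

text \<open>A new label in front only shifts the indices of the old ones, so the atoms on the old
  labels survive every level. Any set could be chosen for the new label; the proof takes the empty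
  one.\<close>

lemma ty_eq_atoms:
  assumes "ty k n D x = ty k n D' x'"
  shows "ty 0 n D x = ty 0 n D' x'"
  using assms
proof (induction k arbitrary: n x x')
  case (Suc k)
  then obtain X' where "ty k (Suc n) D (\<lambda>p. False # x p) = ty k (Suc n) D' (\<lambda>p. X' p # x' p)"
    unfolding ty_Suc_eq_iff by meson
  from Suc.IH[OF this] have "\<forall>i<n. \<forall>j<n.
      (meets D (\<lambda>p. False # x p) (Suc i) (Suc j) \<longleftrightarrow> meets D' (\<lambda>p. X' p # x' p) (Suc i) (Suc j)) \<and>
      (precedes D (\<lambda>p. False # x p) (Suc i) (Suc j) \<longleftrightarrow> precedes D' (\<lambda>p. X' p # x' p) (Suc i) (Suc j))"
    unfolding ty_0_eq_iff by auto
  then show ?case unfolding ty_0_eq_iff by (simp add: meets_def precedes_def)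
qed

text \<open>The composition theorem. Two labels are in order across different summands exactly if
  each occurs in its summand, which is the atom \<open>meets\<close> with equal indices; so the
  atoms of the summands determine those of the sum. For a set quantifier, answers are chosen summand
  by summand and glued, which is possible since ordered summands are disjoint.\<close>

lemma ty_ordered_sum:
  fixes B :: "'i::linorder \<Rightarrow> 'a::linorder set" and B' :: "'i \<Rightarrow> 'b::linorder set"
  assumes B: "\<And>c d p q. c < d \<Longrightarrow> p \<in> B c \<Longrightarrow> q \<in> B d \<Longrightarrow> p < q"
    and B': "\<And>c d p q. c < d \<Longrightarrow> p \<in> B' c \<Longrightarrow> q \<in> B' d \<Longrightarrow> p < q"
    and "\<And>c. ty k n (B c) x = ty k n (B' c) x'"
  shows "ty k n (\<Union>c. B c) x = ty k n (\<Union>c. B' c) x'"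
  using assms(3)
proof (induction k arbitrary: n x x')
  case 0
  have meets: "meets (\<Union>c. C c) y i j \<longleftrightarrow> (\<exists>c. meets (C c) y i j)"
    for C :: "'i \<Rightarrow> 'c::linorder set" and y i j
    by (auto simp: meets_def)
  have precedes: "precedes (\<Union>c. C c) y i j \<longleftrightarrow>
      (\<exists>c. precedes (C c) y i j) \<or> (\<exists>c d. c < d \<and> meets (C c) y i i \<and> meets (C d) y j j)"
    if C: "\<And>c d p q. c < d \<Longrightarrow> p \<in> C c \<Longrightarrow> q \<in> C d \<Longrightarrow> p < q"
    for C :: "'i \<Rightarrow> 'c::linorder set" and y i j
  proof
    assume "precedes (\<Union>c. C c) y i j"
    then obtain p q c d where *: "p \<in> C c" "q \<in> C d" "p < q" "y p ! i" "y q ! j"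
      by (auto simp: precedes_def)
    have "c \<le> d"
    proof (rule ccontr)
      assume "\<not> c \<le> d"
      then have "q < p" using C[of d c q p] * by simp
      with * show False by simp
    qed
    then consider "c = d" | "c < d" by force
    then show "(\<exists>c. precedes (C c) y i j) \<or> (\<exists>c d. c < d \<and> meets (C c) y i i \<and> meets (C d) y j j)"
    proof cases
      case 1
      with * have "precedes (C c) y i j" by (auto simp: precedes_def)
      then show ?thesis by blast
    next
      case 2
      with * have "meets (C c) y i i" "meets (C d) y j j" by (auto simp: meets_def)
      with 2 show ?thesis by blast
    qed
  next
    assume "(\<exists>c. precedes (C c) y i j) \<or> (\<exists>c d. c < d \<and> meets (C c) y i i \<and> meets (C d) y j j)"
    then consider (1) c where "precedes (C c) y i j"
      | (2) c d p q where "c < d" "p \<in> C c" "y p ! i" "q \<in> C d" "y q ! j"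
      by (auto simp: meets_def)
    then show "precedes (\<Union>c. C c) y i j"
    proof cases
      case 1
      then show ?thesis by (auto simp: precedes_def)
    next
      case 2
      with C[of c d p q] show ?thesis by (auto simp: precedes_def)
    qed
  qed
  have "precedes (\<Union>c. B c) x i j \<longleftrightarrow>
      (\<exists>c. precedes (B c) x i j) \<or> (\<exists>c d. c < d \<and> meets (B c) x i i \<and> meets (B d) x j j)" for i j
    by (rule precedes) (rule B)
  moreover have "precedes (\<Union>c. B' c) x' i j \<longleftrightarrow>
      (\<exists>c. precedes (B' c) x' i j) \<or> (\<exists>c d. c < d \<and> meets (B' c) x' i i \<and> meets (B' d) x' j j)" for i j
    by (rule precedes) (rule B')
  moreover have "meets (B c) x i j = meets (B' c) x' i j" "precedes (B c) x i j = precedes (B' c) x' i j"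
    if "i < n" "j < n" for i j c
    using 0[of c] that unfolding ty_0_eq_iff by blast+
  ultimately show ?case
    unfolding ty_0_eq_iff meets by simp
next
  case (Suc k)
  have disj: "c = d" if "p \<in> B c" "p \<in> B d" for p c d
    using B[of c d p p] B[of d c p p] that by (cases c d rule: linorder_cases) auto
  have disj': "c = d" if "p \<in> B' c" "p \<in> B' d" for p c d
    using B'[of c d p p] B'[of d c p p] that by (cases c d rule: linorder_cases) auto
  show ?case unfolding ty_Suc_eq_iff
  proof (intro conjI allI)
    fix X
    have "\<forall>c. \<exists>X'. ty k (Suc n) (B c) (\<lambda>p. X p # x p) = ty k (Suc n) (B' c) (\<lambda>p. X' p # x' p)"
      using Suc.prems unfolding ty_Suc_eq_iff by blast
    then obtain Y where Y: "\<And>c. ty k (Suc n) (B c) (\<lambda>p. X p # x p) = ty k (Suc n) (B' c) (\<lambda>p. Y c p # x' p)"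
      using choice[of "\<lambda>c X'. ty k (Suc n) (B c) (\<lambda>p. X p # x p) = ty k (Suc n) (B' c) (\<lambda>p. X' p # x' p)"] by blast
    define X' where "X' p \<longleftrightarrow> (\<exists>c. p \<in> B' c \<and> Y c p)" for p
    have "ty k (Suc n) (B c) (\<lambda>p. X p # x p) = ty k (Suc n) (B' c) (\<lambda>p. X' p # x' p)" for c
      unfolding Y by (rule ty_cong) (use disj' in \<open>auto simp: X'_def\<close>)
    from Suc.IH[OF this]
    show "\<exists>X'. ty k (Suc n) (\<Union> (range B)) (\<lambda>p. X p # x p) = ty k (Suc n) (\<Union> (range B')) (\<lambda>p. X' p # x' p)"
      by (rule exI[of _ X'])
  next
    fix X'
    have "\<forall>c. \<exists>X. ty k (Suc n) (B c) (\<lambda>p. X p # x p) = ty k (Suc n) (B' c) (\<lambda>p. X' p # x' p)"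
      using Suc.prems unfolding ty_Suc_eq_iff by blast
    then obtain Y where Y: "\<And>c. ty k (Suc n) (B c) (\<lambda>p. Y c p # x p) = ty k (Suc n) (B' c) (\<lambda>p. X' p # x' p)"
      using choice[of "\<lambda>c X. ty k (Suc n) (B c) (\<lambda>p. X p # x p) = ty k (Suc n) (B' c) (\<lambda>p. X' p # x' p)"] by blast
    define X where "X p \<longleftrightarrow> (\<exists>c. p \<in> B c \<and> Y c p)" for p
    have "ty k (Suc n) (B c) (\<lambda>p. X p # x p) = ty k (Suc n) (B' c) (\<lambda>p. X' p # x' p)" for c
      unfolding Y[symmetric] by (rule ty_cong) (use disj in \<open>auto simp: X_def\<close>)
    from Suc.IH[OF this]
    show "\<exists>X. ty k (Suc n) (\<Union> (range B)) (\<lambda>p. X p # x p) = ty k (Suc n) (\<Union> (range B')) (\<lambda>p. X' p # x' p)"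
      by (rule exI[of _ X])
  qed
qed

lemma ty_image:
  fixes g :: "'a::linorder \<Rightarrow> 'b::linorder"
  assumes "strict_mono_on D g" "\<And>p. p \<in> D \<Longrightarrow> x' (g p) = x p"
  shows "ty k n (g ` D) x' = ty k n D x"
  using assms(2)
proof (induction k arbitrary: n x x')
  case 0
  have "g p < g q \<longleftrightarrow> p < q" if "p \<in> D" "q \<in> D" for p q
    using assms(1) that by (metis strict_mono_on_less)
  with 0 show ?case by (auto simp: ty_0_eq_iff meets_def precedes_def simp del: ty.simps)
next
  case (Suc k)
  have inj: "inj_on g D" by (rule strict_mono_on_imp_inj_on[OF assms(1)])
  show ?case unfolding ty_Suc_eq_iff
  proof (intro conjI allI)
    fix X' show "\<exists>X. ty k (Suc n) (g ` D) (\<lambda>p. X' p # x' p) = ty k (Suc n) D (\<lambda>p. X p # x p)"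
      by (intro exI[of _ "\<lambda>p. X' (g p)"] Suc.IH) (simp add: Suc.prems)
  next
    fix X show "\<exists>X'. ty k (Suc n) (g ` D) (\<lambda>p. X' p # x' p) = ty k (Suc n) D (\<lambda>p. X p # x p)"
      by (intro exI[of _ "\<lambda>q. X (inv_into D g q)"] Suc.IH) (simp add: Suc.prems inv_into_f_f[OF inj])
  qed
qed

subsection \<open>Types of finite words\<close>

definition wty :: "nat \<Rightarrow> nat \<Rightarrow> bool list list \<Rightarrow> nat" where
  "wty k n w = ty k n {..<length w} ((!) w)"

lemma ty_interval:
  fixes x :: "int \<Rightarrow> bool list"
  shows "ty k n {a..<b} x = wty k n (map x [a..b - 1])"
proof -
  let ?w = "map x [a..b - 1]"
  have "strict_mono_on {..<length ?w} (\<lambda>i. a + int i)" by (auto simp: strict_mono_on_def)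
  moreover have "x (a + int i) = ?w ! i" if "i \<in> {..<length ?w}" for i
    using that by simp
  ultimately have "ty k n ((\<lambda>i. a + int i) ` {..<length ?w}) x = wty k n ?w"
    unfolding wty_def by (rule ty_image)
  moreover have "(\<lambda>i. a + int i) ` {..<length ?w} = {a..<b}"
  proof (intro equalityI subsetI)
    fix p assume "p \<in> {a..<b}"
    then show "p \<in> (\<lambda>i. a + int i) ` {..<length ?w}" by (intro image_eqI[of _ _ "nat (p - a)"]) auto
  qed auto
  ultimately show ?thesis by simp
qed

lemma wty_append:
  assumes "wty k n v = wty k n v'" "wty k n w = wty k n w'"
  shows "wty k n (v @ w) = wty k n (v' @ w')"
proof -
  \<comment> \<open>Concatenation is the ordered sum over the index order \<open>bool\<close>, in
    which \<open>False < True\<close>.\<close>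
  define B where "B v w c = (if c then {length v..<length v + length w} else {..<length v})"
    for v w :: "bool list list" and c
  have UN: "(\<Union>c. B v w c) = {..<length (v @ w)}" for v w
    by (auto simp: B_def UNIV_bool)
  have B: "p < q" if "c < d" "p \<in> B v w c" "q \<in> B v w d" for v w c d p q
    using that by (auto simp: B_def)
  have "ty k n (B v w c) ((!) (v @ w)) = (if c then wty k n w else wty k n v)" for v w c
  proof (cases c)
    case True
    have "ty k n ((\<lambda>i. length v + i) ` {..<length w}) ((!) (v @ w)) = wty k n w"
      unfolding wty_def by (rule ty_image) (auto simp: strict_mono_on_def nth_append)
    moreover have "(\<lambda>i. length v + i) ` {..<length w} = {length v..<length v + length w}"
      by (simp add: lessThan_atLeast0 add.commute)
    ultimately show ?thesis using True by (simp add: B_def)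
  next
    case False
    have "ty k n {..<length v} ((!) (v @ w)) = wty k n v"
      unfolding wty_def by (rule ty_cong) (simp add: nth_append)
    with False show ?thesis by (simp add: B_def)
  qed
  with ty_ordered_sum[of "B v w" "B v' w'" k n "(!) (v @ w)" "(!) (v' @ w')"] B assms
  show ?thesis unfolding UN wty_def[of k n "_ @ _"] by simp
qed

definition power_word :: "nat \<Rightarrow> 'a list \<Rightarrow> 'a list" where
  "power_word m w = concat (replicate m w)"

lemma power_word_simps [simp]: "power_word 0 w = []" "power_word (Suc m) w = w @ power_word m w"
  by (simp_all add: power_word_def)

lemma power_word_add: "power_word (l + m) w = power_word l w @ power_word m w"
  by (induction l) simp_all

lemma length_power_word [simp]: "length (power_word m w) = m * length w"
  by (induction m) simp_all

text \<open>By pigeonhole, the types of the powers of \<open>w\<close> are eventually periodic with a period dividing \<open>m\<close>.\<close>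

lemma wty_power_word_idem:
  assumes m: "fact (ty_bound k n) dvd m" "0 < m" and l: "0 < l"
  shows "wty k n (power_word (l * m) w) = wty k n (power_word m w)"
proof -
  let ?t = "\<lambda>i. wty k n (power_word i w)" and ?N = "ty_bound k n"
  have "card (?t ` {..?N}) < card {..?N}"
  proof -
    have "?t ` {..?N} \<subseteq> {..<?N}" by (auto simp: wty_def ty_less)
    then have "card (?t ` {..?N}) \<le> ?N" using card_mono[of "{..<?N}"] by fastforce
    then show ?thesis by simp
  qed
  then obtain a b where ab: "a < b" "b \<le> ?N" "?t a = ?t b"
    using pigeonhole[of ?t "{..?N}"] linorder_inj_onI'[of "{..?N}" ?t] by auto
  \<comment> \<open>Since concatenation respects types, a single coincidence of two powers persists
    under further factors.\<close>
  have step: "?t (a + i) = ?t (b + i)" for i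
    unfolding power_word_add by (rule wty_append) (simp_all add: ab)
  have step': "?t (i + c * (b - a)) = ?t i" if "a \<le> i" for i c
  proof (induction c)
    case (Suc c)
    have "?t (i + Suc c * (b - a)) = ?t (b + (i - a + c * (b - a)))"
      using that ab(1) by (simp add: add.assoc[symmetric] add.commute[of i b])
    also have "\<dots> = ?t (a + (i - a + c * (b - a)))" by (rule step[symmetric])
    finally show ?case using Suc that by simp
  qed simp
  have "b - a dvd fact ?N" using ab by (intro dvd_fact) auto
  then have "b - a dvd m" using m(1) by (rule dvd_trans)
  then have "b - a dvd (l - 1) * m" by simp
  then obtain c where c: "(l - 1) * m = c * (b - a)" by (metis dvd_def mult.commute)
  \<comment> \<open>The periodic behaviour starts at \<open>a \<le> ?N\<close>, and \<open>m\<close>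
    lies beyond that because a factorial is at least its argument.\<close>
  have "?N \<le> m" using m fact_ge_self[of ?N] by (meson dvd_imp_le le_trans)
  with ab have "a \<le> m" by simp
  moreover have "l * m = m + (l - 1) * m" using l by (cases l) auto
  ultimately show ?thesis using step'[of m c] c by simp
qed

text \<open>The back-and-forth condition read on finite words: the first labels of \<open>v'\<close>
  are transferred to \<open>w\<close> at the price of one level of depth. Excluding empty letters
  ensures that \<open>tl\<close> forgets a label that was really there.\<close>

lemma word_relabel:
  assumes "wty (Suc k) n (map tl v') = wty (Suc k) n w" "[] \<notin> set v'"
  obtains w' where "map tl w' = w" "[] \<notin> set w'" "wty k (Suc n) v' = wty k (Suc n) w'"
proof -
  have "\<forall>X'. \<exists>X. ty k (Suc n) {..<length v'} (\<lambda>p. X' p # map tl v' ! p) =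
      ty k (Suc n) {..<length w} (\<lambda>p. X p # w ! p)"
    using assms(1) unfolding wty_def length_map ty_Suc_eq_iff by (rule conjunct1)
  from this[THEN spec, of "\<lambda>p. hd (v' ! p)"]
  obtain X where X: "ty k (Suc n) {..<length v'} (\<lambda>p. hd (v' ! p) # map tl v' ! p) =
      ty k (Suc n) {..<length w} (\<lambda>p. X p # w ! p)" ..
  define w' where "w' = map (\<lambda>p. X p # w ! p) [0..<length w]"
  have "map tl w' = w" "[] \<notin> set w'" by (auto simp: w'_def comp_def map_nth)
  moreover have "wty k (Suc n) v' = ty k (Suc n) {..<length v'} (\<lambda>p. hd (v' ! p) # map tl v' ! p)"
    unfolding wty_def by (rule ty_cong) (use assms(2) in \<open>auto simp: in_set_conv_nth\<close>)
  moreover have "wty k (Suc n) w' = ty k (Suc n) {..<length w} (\<lambda>p. X p # w ! p)"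
    unfolding wty_def by (simp add: w'_def) (rule ty_cong, simp)
  ultimately show ?thesis using that X by simp
qed

section \<open>Satisfaction in labelled orders\<close>

text \<open>
  The list \<open>\<rho>\<close> names the labels: \<open>0\<close> stands for \<open>P\<close>, \<open>2 * x + 1\<close> for the element variable \<open>x\<close>
  and \<open>2 * X + 2\<close> for the set variable \<open>X\<close>. The first occurrence of a name counts.
\<close>

definition label :: "nat list \<Rightarrow> bool list \<Rightarrow> nat \<Rightarrow> bool" where
  "label \<rho> l s = foldr (\<lambda>z b. if fst z = s then snd z else b) (zip \<rho> l) False"

lemma label_simps [simp]:
  "label [] l s = False"
  "label (r # \<rho>) (b # l) s = (if r = s then b else label \<rho> l s)"
  by (simp_all add: label_def)

text \<open>Which index a name refers to depends only on \<open>\<rho>\<close>, not on the letter.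
  Statements about names thus reduce to the indexed atoms that a type records.\<close>

lemma label_cases:
  obtains "\<And>l. length l = length \<rho> \<Longrightarrow> \<not> label \<rho> l s"
  | i where "i < length \<rho>" "\<And>l. length l = length \<rho> \<Longrightarrow> label \<rho> l s = l ! i"
proof -
  have "(\<forall>l. length l = length \<rho> \<longrightarrow> \<not> label \<rho> l s) \<or>
    (\<exists>i<length \<rho>. \<forall>l. length l = length \<rho> \<longrightarrow> label \<rho> l s = l ! i)"
  proof (induction \<rho>)
    case (Cons r \<rho>)
    show ?case
    proof (cases "r = s")
      case True
      then show ?thesis by (intro disjI2 exI[of _ 0]) (auto simp: length_Suc_conv)
    next
      case False
      from Cons show ?thesis
      proof (elim disjE exE conjE)
        assume "\<forall>l. length l = length \<rho> \<longrightarrow> \<not> label \<rho> l s"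
        with False show ?thesis by (intro disjI1) (auto simp: length_Suc_conv)
      next
        fix i assume "i < length \<rho>" "\<forall>l. length l = length \<rho> \<longrightarrow> label \<rho> l s = l ! i"
        with False show ?thesis by (intro disjI2 exI[of _ "Suc i"]) (auto simp: length_Suc_conv)
      qed
    qed
  qed simp
  then show ?thesis using that by blast
qed

text \<open>With the indices as their own names, the computable tests \<open>word_meets\<close> and
  \<open>word_precedes\<close> yield the atoms of a type.\<close>

lemma label_map_upt: "i < n \<Longrightarrow> length l = n \<Longrightarrow> label [0..<n] l i = l ! i"
proof -
  have "label [m..<m + length l] l (m + i) = l ! i" if "i < length l" for m i
    using that
  proof (induction l arbitrary: m i)
    case (Cons b l)
    have "[m..<m + length (b # l)] = m # [Suc m..<Suc m + length l]"
      by (subst upt_conv_Cons) simp_all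
    then show ?case using Cons.IH[of "i - 1" "Suc m"] Cons.prems by (cases i) auto
  qed simp
  from this[of i 0] show "i < n \<Longrightarrow> length l = n \<Longrightarrow> ?thesis" by simp
qed

definition label_meets :: "nat list \<Rightarrow> 'a::linorder set \<Rightarrow> ('a \<Rightarrow> bool list) \<Rightarrow> nat \<Rightarrow> nat \<Rightarrow> bool" where
  "label_meets \<rho> D x s t \<longleftrightarrow> (\<exists>p\<in>D. label \<rho> (x p) s \<and> label \<rho> (x p) t)"

definition label_precedes :: "nat list \<Rightarrow> 'a::linorder set \<Rightarrow> ('a \<Rightarrow> bool list) \<Rightarrow> nat \<Rightarrow> nat \<Rightarrow> bool" where
  "label_precedes \<rho> D x s t \<longleftrightarrow> (\<exists>p\<in>D. \<exists>q\<in>D. p < q \<and> label \<rho> (x p) s \<and> label \<rho> (x q) t)"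

lemma label_atoms_cong:
  assumes "ty k (length \<rho>) D x = ty k (length \<rho>) D' x'"
    and "\<And>p. p \<in> D \<Longrightarrow> length (x p) = length \<rho>" "\<And>p. p \<in> D' \<Longrightarrow> length (x' p) = length \<rho>"
  shows "label_meets \<rho> D x s t \<longleftrightarrow> label_meets \<rho> D' x' s t"
    and "label_precedes \<rho> D x s t \<longleftrightarrow> label_precedes \<rho> D' x' s t"
proof -
  note atoms = ty_eq_atoms[OF assms(1), unfolded ty_0_eq_iff, rule_format]
  have "(label_meets \<rho> D x s t \<longleftrightarrow> label_meets \<rho> D' x' s t) \<and>
    (label_precedes \<rho> D x s t \<longleftrightarrow> label_precedes \<rho> D' x' s t)"
  proof (cases \<rho> s rule: label_cases)
    case 1
    then show ?thesis using assms by (auto simp: label_meets_def label_precedes_def)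
  next
    case i: (2 i)
    show ?thesis
    proof (cases \<rho> t rule: label_cases)
      case 1
      then show ?thesis using assms by (auto simp: label_meets_def label_precedes_def)
    next
      case j: (2 j)
      show ?thesis
        using atoms[OF i(1) j(1)] assms(2,3) i(2) j(2)
        unfolding label_meets_def label_precedes_def meets_def precedes_def
        by (simp cong: bex_cong conj_cong)
    qed
  qed
  then show "label_meets \<rho> D x s t \<longleftrightarrow> label_meets \<rho> D' x' s t"
    "label_precedes \<rho> D x s t \<longleftrightarrow> label_precedes \<rho> D' x' s t" by blast+
qed

lemma ty_Suc_ex_cong:
  assumes "ty (Suc k) n D x = ty (Suc k) n D' x'"
    and "\<And>X X'. ty k (Suc n) D (\<lambda>p. X p # x p) = ty k (Suc n) D' (\<lambda>p. X' p # x' p) \<Longrightarrow> Q X \<longleftrightarrow> Q' X'"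
  shows "(\<exists>X. Q X) \<longleftrightarrow> (\<exists>X'. Q' X')"
proof
  assume "\<exists>X. Q X"
  then obtain X where "Q X" ..
  moreover from assms(1)[unfolded ty_Suc_eq_iff, THEN conjunct1, THEN spec, of X] obtain X' where
    "ty k (Suc n) D (\<lambda>p. X p # x p) = ty k (Suc n) D' (\<lambda>p. X' p # x' p)" ..
  ultimately have "Q' X'" using assms(2) by simp
  then show "\<exists>X'. Q' X'" by blast
next
  assume "\<exists>X'. Q' X'"
  then obtain X' where "Q' X'" ..
  moreover from assms(1)[unfolded ty_Suc_eq_iff, THEN conjunct2, THEN spec, of X'] obtain X where
    "ty k (Suc n) D (\<lambda>p. X p # x p) = ty k (Suc n) D' (\<lambda>p. X' p # x' p)" ..
  ultimately have "Q X" using assms(2) by simp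
  then show "\<exists>X. Q X" by blast
qed

text \<open>An element is a label carried by exactly one position, so equality of elements is a
  common position of two labels. A quantifier of either kind adds one label, which matches
  quantifier rank with the depth of types.\<close>

primrec lsat :: "mso \<Rightarrow> nat list \<Rightarrow> 'a::linorder set \<Rightarrow> ('a \<Rightarrow> bool list) \<Rightarrow> bool" where
  "lsat (Eq a b) \<rho> D x \<longleftrightarrow> label_meets \<rho> D x (2 * a + 1) (2 * b + 1)"
| "lsat (Le a b) \<rho> D x \<longleftrightarrow> label_meets \<rho> D x (2 * a + 1) (2 * b + 1) \<or>
    label_precedes \<rho> D x (2 * a + 1) (2 * b + 1)"
| "lsat (InP a) \<rho> D x \<longleftrightarrow> label_meets \<rho> D x (2 * a + 1) 0"
| "lsat (Mem a b) \<rho> D x \<longleftrightarrow> label_meets \<rho> D x (2 * a + 1) (2 * b + 2)"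
| "lsat (Neg f) \<rho> D x \<longleftrightarrow> \<not> lsat f \<rho> D x"
| "lsat (Conj f g) \<rho> D x \<longleftrightarrow> lsat f \<rho> D x \<and> lsat g \<rho> D x"
| "lsat (ExElem a f) \<rho> D x \<longleftrightarrow> (\<exists>X. let \<rho>' = (2 * a + 1) # \<rho>; x' = (\<lambda>p. X p # x p) in
    label_meets \<rho>' D x' (2 * a + 1) (2 * a + 1) \<and> \<not> label_precedes \<rho>' D x' (2 * a + 1) (2 * a + 1) \<and>
    lsat f \<rho>' D x')"
| "lsat (ExSet a f) \<rho> D x \<longleftrightarrow> (\<exists>X. lsat f ((2 * a + 2) # \<rho>) D (\<lambda>p. X p # x p))"

lemma lsat_cong_ty:
  assumes "ty k (length \<rho>) D x = ty k (length \<rho>) D' x'" "qrank f \<le> k"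
    and "\<And>p. p \<in> D \<Longrightarrow> length (x p) = length \<rho>" "\<And>p. p \<in> D' \<Longrightarrow> length (x' p) = length \<rho>"
  shows "lsat f \<rho> D x \<longleftrightarrow> lsat f \<rho> D' x'"
  using assms
proof (induction f arbitrary: k \<rho> x x')
  case (ExElem a f)
  then obtain m where k: "k = Suc m" and m: "qrank f \<le> m" by (cases k) auto
  let ?s = "2 * a + 1"
  have *: "(label_meets (?s # \<rho>) D (\<lambda>p. X p # x p) ?s ?s \<longleftrightarrow> label_meets (?s # \<rho>) D' (\<lambda>p. X' p # x' p) ?s ?s) \<and>
      (label_precedes (?s # \<rho>) D (\<lambda>p. X p # x p) ?s ?s \<longleftrightarrow> label_precedes (?s # \<rho>) D' (\<lambda>p. X' p # x' p) ?s ?s) \<and>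
      (lsat f (?s # \<rho>) D (\<lambda>p. X p # x p) \<longleftrightarrow> lsat f (?s # \<rho>) D' (\<lambda>p. X' p # x' p))"
    if "ty m (Suc (length \<rho>)) D (\<lambda>p. X p # x p) = ty m (Suc (length \<rho>)) D' (\<lambda>p. X' p # x' p)" for X X'
  proof (intro conjI)
    have eq: "ty m (length (?s # \<rho>)) D (\<lambda>p. X p # x p) = ty m (length (?s # \<rho>)) D' (\<lambda>p. X' p # x' p)"
      using that by simp
    show "label_meets (?s # \<rho>) D (\<lambda>p. X p # x p) ?s ?s \<longleftrightarrow> label_meets (?s # \<rho>) D' (\<lambda>p. X' p # x' p) ?s ?s"
      by (rule label_atoms_cong(1)[OF eq]) (simp_all add: ExElem.prems)
    show "label_precedes (?s # \<rho>) D (\<lambda>p. X p # x p) ?s ?s \<longleftrightarrow> label_precedes (?s # \<rho>) D' (\<lambda>p. X' p # x' p) ?s ?s"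
      by (rule label_atoms_cong(2)[OF eq]) (simp_all add: ExElem.prems)
    show "lsat f (?s # \<rho>) D (\<lambda>p. X p # x p) \<longleftrightarrow> lsat f (?s # \<rho>) D' (\<lambda>p. X' p # x' p)"
      by (rule ExElem.IH[OF eq m]) (simp_all add: ExElem.prems)
  qed
  show ?case
    unfolding lsat.simps Let_def
    by (rule ty_Suc_ex_cong[OF ExElem.prems(1)[unfolded k]]) (simp only: *)
next
  case (ExSet a f)
  then obtain m where k: "k = Suc m" and m: "qrank f \<le> m" by (cases k) auto
  have *: "lsat f ((2 * a + 2) # \<rho>) D (\<lambda>p. X p # x p) \<longleftrightarrow> lsat f ((2 * a + 2) # \<rho>) D' (\<lambda>p. X' p # x' p)"
    if "ty m (Suc (length \<rho>)) D (\<lambda>p. X p # x p) = ty m (Suc (length \<rho>)) D' (\<lambda>p. X' p # x' p)" for X X'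
    by (rule ExSet.IH[OF _ m]) (use that in \<open>simp_all add: ExSet.prems\<close>)
  show ?case
    unfolding lsat.simps by (rule ty_Suc_ex_cong[OF ExSet.prems(1)[unfolded k]]) (rule *)
next
  case (Conj f g)
  have "lsat f \<rho> D x \<longleftrightarrow> lsat f \<rho> D' x'"
    by (rule Conj.IH(1)[OF Conj.prems(1)]) (use Conj.prems in auto)
  moreover have "lsat g \<rho> D x \<longleftrightarrow> lsat g \<rho> D' x'"
    by (rule Conj.IH(2)[OF Conj.prems(1)]) (use Conj.prems in auto)
  ultimately show ?case by simp
next
  case (Neg f)
  have "lsat f \<rho> D x \<longleftrightarrow> lsat f \<rho> D' x'"
    by (rule Neg.IH[OF Neg.prems(1)]) (use Neg.prems in auto)
  then show ?case by simp
next
  case (Eq a b)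
  show ?case using label_atoms_cong[OF Eq.prems(1,3,4)] by simp
next
  case (Le a b)
  show ?case using label_atoms_cong[OF Le.prems(1,3,4)] by simp
next
  case (InP a)
  show ?case using label_atoms_cong[OF InP.prems(1,3,4)] by simp
next
  case (Mem a b)
  show ?case using label_atoms_cong[OF Mem.prems(1,3,4)] by simp
qed

lemma singleton_iff_no_distinct:
  fixes D :: "'a::linorder set"
  shows "(\<exists>p\<in>D. X p) \<and> \<not> (\<exists>p\<in>D. \<exists>q\<in>D. p < q \<and> X p \<and> X q) \<longleftrightarrow> (\<exists>a\<in>D. \<forall>p\<in>D. X p \<longleftrightarrow> p = a)"
    (is "?L \<longleftrightarrow> ?R")
proof
  assume ?L
  then obtain a where a: "a \<in> D" "X a" by blast
  have "p = a" if "p \<in> D" "X p" for p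
  proof -
    have "\<not> p < a" "\<not> a < p" using \<open>?L\<close> a that by blast+
    then show ?thesis by simp
  qed
  with a show ?R by blast
qed auto

lemma lsat_iff_sat:
  assumes "\<And>p. p \<in> D \<Longrightarrow> label \<rho> (x p) 0 \<longleftrightarrow> p \<in> P"
    and "\<And>a. a \<in> free1 f \<Longrightarrow> e a \<in> D \<and> (\<forall>p\<in>D. label \<rho> (x p) (2 * a + 1) \<longleftrightarrow> p = e a)"
    and "\<And>a p. a \<in> free2 f \<Longrightarrow> p \<in> D \<Longrightarrow> label \<rho> (x p) (2 * a + 2) \<longleftrightarrow> p \<in> E a"
  shows "lsat f \<rho> D x \<longleftrightarrow> sat D P e E f"
  using assms
proof (induction f arbitrary: \<rho> x e E)
  case (Eq a b)
  then show ?case by (auto simp: label_meets_def)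
next
  case (Le a b)
  then show ?case by (auto simp: label_meets_def label_precedes_def le_less)
next
  case (InP a)
  then show ?case by (auto simp: label_meets_def)
next
  case (Mem a b)
  then show ?case by (auto simp: label_meets_def)
next
  case (Neg f)
  then have "lsat f \<rho> D x \<longleftrightarrow> sat D P e E f" by (intro Neg.IH) auto
  then show ?case by simp
next
  case (Conj f g)
  have "lsat f \<rho> D x \<longleftrightarrow> sat D P e E f"
    by (rule Conj.IH(1)) (use Conj.prems in auto)
  moreover have "lsat g \<rho> D x \<longleftrightarrow> sat D P e E g"
    by (rule Conj.IH(2)) (use Conj.prems in auto)
  ultimately show ?case by simp
next
  case (ExElem a f)
  let ?\<rho> = "(2 * a + 1) # \<rho>"
  have *: "lsat f ?\<rho> D (\<lambda>p. X p # x p) \<longleftrightarrow> sat D P (e(a := c)) E f"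
    if "c \<in> D" "\<forall>p\<in>D. X p \<longleftrightarrow> p = c" for X c
  proof (rule ExElem.IH[of ?\<rho> "\<lambda>p. X p # x p" "e(a := c)" E])
    show "(e(a := c)) b \<in> D \<and> (\<forall>p\<in>D. label ?\<rho> (X p # x p) (2 * b + 1) \<longleftrightarrow> p = (e(a := c)) b)"
      if "b \<in> free1 f" for b
      using ExElem.prems(2)[of b] that \<open>c \<in> D\<close> \<open>\<forall>p\<in>D. X p \<longleftrightarrow> p = c\<close> by (cases "b = a") auto
    show "label ?\<rho> (X p # x p) (2 * b + 2) \<longleftrightarrow> p \<in> E b" if "b \<in> free2 f" "p \<in> D" for b p
    proof -
      \<comment> \<open>Names of element and of set variables differ in parity, so a new element
        label cannot hide a set label.\<close>
      have "2 * a + 1 \<noteq> 2 * b + 2" by presburger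
      then show ?thesis using ExElem.prems(3)[of b p] that by simp
    qed
  qed (use ExElem.prems(1) in simp)
  have "lsat (ExElem a f) \<rho> D x \<longleftrightarrow> (\<exists>X. (\<exists>c\<in>D. \<forall>p\<in>D. X p \<longleftrightarrow> p = c) \<and> lsat f ?\<rho> D (\<lambda>p. X p # x p))"
    unfolding singleton_iff_no_distinct[symmetric]
    by (simp add: label_meets_def label_precedes_def)
  also have "\<dots> \<longleftrightarrow> (\<exists>c\<in>D. sat D P (e(a := c)) E f)"
  proof
    assume "\<exists>c\<in>D. sat D P (e(a := c)) E f"
    then obtain c where c: "c \<in> D" "sat D P (e(a := c)) E f" by blast
    then have "lsat f ?\<rho> D (\<lambda>p. (p = c) # x p)" using *[of c "\<lambda>p. p = c"] by simp
    with c(1) show "\<exists>X. (\<exists>c\<in>D. \<forall>p\<in>D. X p \<longleftrightarrow> p = c) \<and> lsat f ?\<rho> D (\<lambda>p. X p # x p)"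
      by (intro exI[of _ "\<lambda>p. p = c"] conjI bexI[of _ c]) simp_all
  qed (use * in blast)
  finally show ?case by simp
next
  case (ExSet a f)
  let ?\<rho> = "(2 * a + 2) # \<rho>"
  have *: "lsat f ?\<rho> D (\<lambda>p. X p # x p) \<longleftrightarrow> sat D P e (E(a := A)) f"
    if "\<forall>p\<in>D. X p \<longleftrightarrow> p \<in> A" for X A
  proof (rule ExSet.IH[of ?\<rho> "\<lambda>p. X p # x p" e "E(a := A)"])
    show "e b \<in> D \<and> (\<forall>p\<in>D. label ?\<rho> (X p # x p) (2 * b + 1) \<longleftrightarrow> p = e b)" if "b \<in> free1 f" for b
    proof -
      have "2 * a + 2 \<noteq> 2 * b + 1" by presburger
      then have "label ?\<rho> (X p # x p) (2 * b + 1) = label \<rho> (x p) (2 * b + 1)" for p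
        unfolding label_simps by (rule if_not_P)
      then show ?thesis using ExSet.prems(2)[of b] that by auto
    qed
    show "label ?\<rho> (X p # x p) (2 * b + 2) \<longleftrightarrow> p \<in> (E(a := A)) b" if "b \<in> free2 f" "p \<in> D" for b p
      using ExSet.prems(3)[of b p] that \<open>\<forall>p\<in>D. X p \<longleftrightarrow> p \<in> A\<close> by (cases "b = a") auto
  qed (use ExSet.prems(1) in simp)
  show ?case unfolding lsat.simps sat.simps
  proof
    assume "\<exists>X. lsat f ?\<rho> D (\<lambda>p. X p # x p)"
    then obtain X where "lsat f ?\<rho> D (\<lambda>p. X p # x p)" ..
    then have "sat D P e (E(a := {p \<in> D. X p})) f" using *[of X "{p \<in> D. X p}"] by simp
    then show "\<exists>A\<subseteq>D. sat D P e (E(a := A)) f" by (intro exI[of _ "{p \<in> D. X p}"]) auto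
  next
    assume "\<exists>A\<subseteq>D. sat D P e (E(a := A)) f"
    then obtain A where "sat D P e (E(a := A)) f" by blast
    then have "lsat f ?\<rho> D (\<lambda>p. (p \<in> A) # x p)" using *[of "\<lambda>p. p \<in> A" A] by simp
    then show "\<exists>X. lsat f ?\<rho> D (\<lambda>p. X p # x p)" by (rule exI[of _ "\<lambda>p. p \<in> A"])
  qed
qed

lemma sat_sentence_iff_lsat:
  "sentence f \<Longrightarrow> models D P f \<longleftrightarrow> lsat f [0] D (\<lambda>p. [p \<in> P])"
  using lsat_iff_sat[of D "[0]" "\<lambda>p. [p \<in> P]" P f] models_iff_sat[of f D P]
  by (simp add: sentence_def)

definition unary :: "word \<Rightarrow> bool list list" where
  "unary w = map (\<lambda>b. [b]) w"

lemma length_unary [simp]: "length (unary w) = length w"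
  by (simp add: unary_def)

lemma word_models_iff_lsat:
  assumes "sentence f"
  shows "word_models w f \<longleftrightarrow> lsat f [0] {..<length w} ((!) (unary w))"
proof -
  have "ty (qrank f) 1 {..<length w} (\<lambda>p. [p \<in> {i. i < length w \<and> w ! i}]) =
      ty (qrank f) 1 {..<length w} ((!) (unary w))"
    by (rule ty_cong) (simp add: unary_def)
  then show ?thesis
    unfolding word_models_def sat_sentence_iff_lsat[OF assms]
    by (intro lsat_cong_ty[of "qrank f"]) (auto simp: unary_def)
qed

lemma kequiv_if_wty_eq:
  assumes "wty k 1 (unary u) = wty k 1 (unary v)" shows "kequiv k u v"
  unfolding kequiv_def
proof (intro allI impI, elim conjE)
  fix f assume f: "sentence f" "qrank f \<le> k"
  show "word_models u f \<longleftrightarrow> word_models v f"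
    unfolding word_models_iff_lsat[OF f(1)]
    by (rule lsat_cong_ty[of k]) (use assms f in \<open>auto simp: wty_def unary_def\<close>)
qed

section \<open>Characteristic formulas of types\<close>

definition relabelings :: "bool list list \<Rightarrow> bool list list list" where
  "relabelings w = foldr (\<lambda>l ws. map (\<lambda>w'. (False # l) # w') ws @ map (\<lambda>w'. (True # l) # w') ws) w [[]]"

lemma set_relabelings: "set (relabelings w) = {w'. map tl w' = w \<and> [] \<notin> set w'}"
proof (induction w)
  case (Cons l w)
  have "relabelings (l # w) = map (\<lambda>w'. (False # l) # w') (relabelings w) @ map (\<lambda>w'. (True # l) # w') (relabelings w)"
    by (simp add: relabelings_def)
  also have "set \<dots> = {l' # w' | l' w'. (l' = False # l \<or> l' = True # l) \<and> w' \<in> set (relabelings w)}"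
    by auto
  also have "\<dots> = {w'. map tl w' = l # w \<and> [] \<notin> set w'}"
  proof -
    have "l' = False # l \<or> l' = True # l \<longleftrightarrow> tl l' = l \<and> l' \<noteq> []" for l'
      by (cases l') auto
    then have "(\<exists>l' w''. w' = l' # w'' \<and> (l' = False # l \<or> l' = True # l) \<and> map tl w'' = w \<and> [] \<notin> set w'')
        \<longleftrightarrow> map tl w' = l # w \<and> [] \<notin> set w'" for w'
      by (cases w') auto
    then show ?thesis unfolding Cons.IH by simp
  qed
  finally show ?case .
qed (auto simp: relabelings_def)

lemma relabelings_lengths:
  assumes "w' \<in> set (relabelings w)" "\<forall>l\<in>set w. length l = n"
  shows "\<forall>l\<in>set w'. length l = Suc n"
proof
  fix l assume "l \<in> set w'"
  with assms(1) have "l \<noteq> []" "tl l \<in> set w" by (auto simp: set_relabelings)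
  with assms(2) show "length l = Suc n" by (cases l) auto
qed

lemma ex_relabeling:
  "\<exists>w'\<in>set (relabelings w). ty k (Suc n) {..<length w} (\<lambda>p. X p # w ! p) = wty k (Suc n) w'"
proof (rule bexI)
  let ?w' = "map (\<lambda>p. X p # w ! p) [0..<length w]"
  show "ty k (Suc n) {..<length w} (\<lambda>p. X p # w ! p) = wty k (Suc n) ?w'"
    unfolding wty_def length_map length_upt by (simp, rule ty_cong) simp
  show "?w' \<in> set (relabelings w)"
    by (auto simp: set_relabelings comp_def map_nth)
qed

lemma wty_relabeling:
  assumes "w' \<in> set (relabelings w)"
  shows "wty k n w' = ty k n {..<length w} (\<lambda>p. hd (w' ! p) # w ! p)"
proof -
  from assms have w: "w = map tl w'" and "[] \<notin> set w'" by (auto simp: set_relabelings)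
  have "hd (w' ! p) # tl (w' ! p) = w' ! p" if "p < length w'" for p
    using \<open>[] \<notin> set w'\<close> nth_mem[OF that] by (cases "w' ! p") auto
  then show ?thesis unfolding wty_def w by (simp, intro ty_cong) simp
qed

text \<open>On the side of a finite word the choices of a set form a finite list. This makes the
  back-and-forth condition expressible by one formula.\<close>

lemma ty_Suc_eq_wty_iff:
  "ty (Suc k) n D x = wty (Suc k) n w \<longleftrightarrow>
    (\<forall>w'\<in>set (relabelings w). \<exists>X. ty k (Suc n) D (\<lambda>p. X p # x p) = wty k (Suc n) w') \<and>
    (\<forall>X. \<exists>w'\<in>set (relabelings w). ty k (Suc n) D (\<lambda>p. X p # x p) = wty k (Suc n) w')"
  (is "_ \<longleftrightarrow> ?A \<and> ?B")
proof -
  let ?ty = "\<lambda>X. ty k (Suc n) D (\<lambda>p. X p # x p)"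
  let ?ty' = "\<lambda>X. ty k (Suc n) {..<length w} (\<lambda>p. X p # w ! p)"
  have "?A \<longleftrightarrow> (\<forall>X'. \<exists>X. ?ty X = ?ty' X')"
  proof
    assume A: ?A
    show "\<forall>X'. \<exists>X. ?ty X = ?ty' X'"
    proof
      fix X'
      obtain w' where "w' \<in> set (relabelings w)" "?ty' X' = wty k (Suc n) w'"
        using ex_relabeling by blast
      with A show "\<exists>X. ?ty X = ?ty' X'" by simp
    qed
  qed (auto simp: wty_relabeling)
  moreover have "?B \<longleftrightarrow> (\<forall>X. \<exists>X'. ?ty X = ?ty' X')"
  proof
    assume B: ?B
    show "\<forall>X. \<exists>X'. ?ty X = ?ty' X'"
    proof
      fix X
      from B obtain w' where "w' \<in> set (relabelings w)" "?ty X = wty k (Suc n) w'" by blast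
      then show "\<exists>X'. ?ty X = ?ty' X'" by (intro exI[of _ "\<lambda>p. hd (w' ! p)"]) (simp add: wty_relabeling)
    qed
  next
    assume R: "\<forall>X. \<exists>X'. ?ty X = ?ty' X'"
    show ?B
    proof
      fix X
      from R obtain X' where "?ty X = ?ty' X'" by blast
      with ex_relabeling[of w k n X'] show "\<exists>w'\<in>set (relabelings w). ?ty X = wty k (Suc n) w'" by simp
    qed
  qed
  ultimately show ?thesis
    unfolding wty_def[of "Suc k"] ty_Suc_eq_iff by blast
qed

section \<open>Computable atoms of finite words\<close>

definition word_meets :: "nat list \<Rightarrow> bool list list \<Rightarrow> nat \<Rightarrow> nat \<Rightarrow> bool" where
  "word_meets \<rho> w s t \<longleftrightarrow> (\<exists>l\<in>set w. label \<rho> l s \<and> label \<rho> l t)"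

text \<open>One pass from the right: the first component records whether \<open>t\<close> has
  already been met, the second whether an \<open>s\<close> has been found to the left of it.\<close>

definition word_precedes :: "nat list \<Rightarrow> bool list list \<Rightarrow> nat \<Rightarrow> nat \<Rightarrow> bool" where
  "word_precedes \<rho> w s t = snd (foldr (\<lambda>l z. (fst z \<or> label \<rho> l t, snd z \<or> label \<rho> l s \<and> fst z)) w (False, False))"

lemma set_eq_image_nth: "set w = (!) w ` {..<length w}"
  by (auto simp: set_conv_nth)

lemma word_meets_iff: "word_meets \<rho> w s t \<longleftrightarrow> label_meets \<rho> {..<length w} ((!) w) s t"
  unfolding word_meets_def label_meets_def set_eq_image_nth by simp

lemma word_precedes_Cons:
  "word_precedes \<rho> (l # w) s t \<longleftrightarrow> word_precedes \<rho> w s t \<or> label \<rho> l s \<and> (\<exists>l'\<in>set w. label \<rho> l' t)"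
proof -
  have "fst (foldr (\<lambda>l z. (fst z \<or> label \<rho> l t, snd z \<or> label \<rho> l s \<and> fst z)) w (False, False))
      \<longleftrightarrow> (\<exists>l'\<in>set w. label \<rho> l' t)"
    by (induction w) auto
  then show ?thesis by (simp add: word_precedes_def)
qed

lemma word_precedes_iff: "word_precedes \<rho> w s t \<longleftrightarrow> label_precedes \<rho> {..<length w} ((!) w) s t"
proof (induction w)
  case Nil
  then show ?case by (simp add: word_precedes_def label_precedes_def)
next
  case (Cons l w)
  have "label_precedes \<rho> {..<length (l # w)} ((!) (l # w)) s t \<longleftrightarrow>
      label_precedes \<rho> {..<length w} ((!) w) s t \<or> label \<rho> l s \<and> (\<exists>l'\<in>set w. label \<rho> l' t)"
    unfolding label_precedes_def set_eq_image_nth by (auto simp: lessThan_Suc_eq_insert_0)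
  then show ?case using Cons.IH word_precedes_Cons by simp
qed

text \<open>A closed substitute for a truth constant, which the syntax lacks. Its rank 1 is the
  origin of \<open>max 1 k\<close> in \<open>qrank_conjs\<close>.\<close>

definition top_fm :: mso where "top_fm = Neg (ExElem 0 (Neg (Eq 0 0)))"

definition conjs :: "mso list \<Rightarrow> mso" where "conjs fs = foldr Conj fs top_fm"

lemma sat_conjs [simp]: "sat D P e E (conjs fs) \<longleftrightarrow> (\<forall>f\<in>set fs. sat D P e E f)"
  unfolding conjs_def by (induction fs) (simp_all add: top_fm_def)

lemma qrank_conjs: "qrank (conjs fs) \<le> max 1 k" if "\<forall>f\<in>set fs. qrank f \<le> k"
  using that unfolding conjs_def by (induction fs) (auto simp: top_fm_def le_max_iff_disj)

lemma free_conjs [simp]: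
  "free1 (conjs fs) = (\<Union>f\<in>set fs. free1 f)" "free2 (conjs fs) = (\<Union>f\<in>set fs. free2 f)"
  unfolding conjs_def by (induction fs) (simp_all add: top_fm_def)

definition meets_fm :: "nat \<Rightarrow> nat \<Rightarrow> mso" where
  "meets_fm X Y = ExElem 0 (Conj (Mem 0 0) (Conj (Mem 0 X) (Mem 0 Y)))"

definition precedes_fm :: "nat \<Rightarrow> nat \<Rightarrow> mso" where
  "precedes_fm X Y = ExElem 0 (ExElem 1 (Conj (Conj (Mem 0 0) (Mem 1 0))
     (Conj (Conj (Mem 0 X) (Mem 1 Y)) (Conj (Le 0 1) (Neg (Eq 0 1))))))"

definition signed_fm :: "bool \<Rightarrow> mso \<Rightarrow> mso" where
  "signed_fm b f = (if b then f else Neg f)"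

text \<open>
  The domain of the described structure is the value of the set variable \<open>0\<close>, and label \<open>i\<close> out of
  \<open>n\<close> is the set variable \<open>n - i\<close>: a new label in front of the others leaves their variables alone.
\<close>

primrec type_fm :: "nat \<Rightarrow> nat \<Rightarrow> bool list list \<Rightarrow> mso" where
  "type_fm 0 n w = conjs (concat (map (\<lambda>i. concat (map (\<lambda>j.
     [signed_fm (word_meets [0..<n] w i j) (meets_fm (n - i) (n - j)),
      signed_fm (word_precedes [0..<n] w i j) (precedes_fm (n - i) (n - j))]) [0..<n])) [0..<n]))"
| "type_fm (Suc k) n w = (let fs = map (type_fm k (Suc n)) (relabelings w) in
     Conj (conjs (map (ExSet (Suc n)) fs)) (Neg (ExSet (Suc n) (conjs (map Neg fs)))))"

text \<open>Set quantifiers range over all of \<open>D\<close>, but a type over \<open>E 0\<close>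
  sees only the part of a set inside \<open>E 0\<close>. Hence only the element quantifiers in the
  atoms are relativised.\<close>

lemma sat_type_fm:
  assumes "E 0 \<subseteq> D" "\<forall>l\<in>set w. length l = n"
  shows "sat D P e E (type_fm k n w) \<longleftrightarrow>
    ty k n (E 0) (\<lambda>p. map (\<lambda>i. p \<in> E (n - i)) [0..<n]) = wty k n w"
  using assms
proof (induction k arbitrary: n w E)
  case 0
  let ?x = "\<lambda>p. map (\<lambda>i. p \<in> E (n - i)) [0..<n]"
  have sg: "sat D P e E (signed_fm b f) \<longleftrightarrow> (sat D P e E f \<longleftrightarrow> b)" for b f
    by (simp add: signed_fm_def)
  have "sat D P e E (meets_fm (n - i) (n - j)) \<longleftrightarrow> meets (E 0) ?x i j"
    "sat D P e E (precedes_fm (n - i) (n - j)) \<longleftrightarrow> precedes (E 0) ?x i j"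
    if "i < n" "j < n" for i j
    using that 0(1) by (auto simp: meets_fm_def precedes_fm_def meets_def precedes_def less_le)
  moreover have "word_meets [0..<n] w i j \<longleftrightarrow> meets {..<length w} ((!) w) i j"
    "word_precedes [0..<n] w i j \<longleftrightarrow> precedes {..<length w} ((!) w) i j"
    if "i < n" "j < n" for i j
    using that 0(2)
    by (auto simp: word_meets_iff word_precedes_iff label_meets_def label_precedes_def meets_def
        precedes_def label_map_upt)
  ultimately show ?case
    unfolding wty_def ty_0_eq_iff type_fm.simps sat_conjs by (auto simp: sg)
next
  case (Suc k)
  let ?x = "\<lambda>p. map (\<lambda>i. p \<in> E (n - i)) [0..<n]"
  have *: "sat D P e (E(Suc n := A)) (type_fm k (Suc n) w') \<longleftrightarrow>
      ty k (Suc n) (E 0) (\<lambda>p. (p \<in> A) # ?x p) = wty k (Suc n) w'"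
    if "w' \<in> set (relabelings w)" for w' A
  proof -
    have "map (\<lambda>i. p \<in> (E(Suc n := A)) (Suc n - i)) [0..<Suc n] = (p \<in> A) # ?x p" for p
    proof -
      have "[0..<Suc n] = 0 # map Suc [0..<n]" by (simp only: upt_conv_Cons map_Suc_upt zero_less_Suc)
      then show ?thesis by (auto simp del: upt_Suc)
    qed
    moreover have "(E(Suc n := A)) 0 = E 0" by simp
    ultimately show ?thesis
      using Suc.IH[of "E(Suc n := A)" w' "Suc n"] Suc.prems relabelings_lengths[OF that]
      by (simp del: upt_Suc fun_upd_apply)
  qed
  have ex: "(\<exists>A\<subseteq>D. ty k (Suc n) (E 0) (\<lambda>p. (p \<in> A) # ?x p) = t) \<longleftrightarrow>
      (\<exists>X. ty k (Suc n) (E 0) (\<lambda>p. X p # ?x p) = t)" for t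
  proof
    assume "\<exists>X. ty k (Suc n) (E 0) (\<lambda>p. X p # ?x p) = t"
    then obtain X where "ty k (Suc n) (E 0) (\<lambda>p. X p # ?x p) = t" ..
    moreover have "ty k (Suc n) (E 0) (\<lambda>p. X p # ?x p) =
        ty k (Suc n) (E 0) (\<lambda>p. (p \<in> {p \<in> D. X p}) # ?x p)"
      by (rule ty_cong) (use Suc.prems(1) in auto)
    ultimately show "\<exists>A\<subseteq>D. ty k (Suc n) (E 0) (\<lambda>p. (p \<in> A) # ?x p) = t"
      by (intro exI[of _ "{p \<in> D. X p}"]) auto
  next
    assume "\<exists>A\<subseteq>D. ty k (Suc n) (E 0) (\<lambda>p. (p \<in> A) # ?x p) = t"
    then obtain A where "ty k (Suc n) (E 0) (\<lambda>p. (p \<in> A) # ?x p) = t" by auto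
    then show "\<exists>X. ty k (Suc n) (E 0) (\<lambda>p. X p # ?x p) = t" by (rule exI[of _ "\<lambda>p. p \<in> A"])
  qed
  have all: "(\<forall>A\<subseteq>D. ty k (Suc n) (E 0) (\<lambda>p. (p \<in> A) # ?x p) \<in> T) \<longleftrightarrow>
      (\<forall>X. ty k (Suc n) (E 0) (\<lambda>p. X p # ?x p) \<in> T)" for T
  proof -
    have "(\<forall>A\<subseteq>D. ty k (Suc n) (E 0) (\<lambda>p. (p \<in> A) # ?x p) \<in> T) \<longleftrightarrow>
        (\<forall>t. (\<exists>A\<subseteq>D. ty k (Suc n) (E 0) (\<lambda>p. (p \<in> A) # ?x p) = t) \<longrightarrow> t \<in> T)"
      by auto
    also have "\<dots> \<longleftrightarrow> (\<forall>X. ty k (Suc n) (E 0) (\<lambda>p. X p # ?x p) \<in> T)"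
      unfolding ex by auto
    finally show ?thesis .
  qed
  have "sat D P e E (type_fm (Suc k) n w) \<longleftrightarrow>
     (\<forall>w'\<in>set (relabelings w). \<exists>A\<subseteq>D. ty k (Suc n) (E 0) (\<lambda>p. (p \<in> A) # ?x p) = wty k (Suc n) w') \<and>
     (\<forall>A\<subseteq>D. ty k (Suc n) (E 0) (\<lambda>p. (p \<in> A) # ?x p) \<in> wty k (Suc n) ` set (relabelings w))"
    by (simp add: * Let_def image_iff)
  also have "\<dots> \<longleftrightarrow> ty (Suc k) n (E 0) ?x = wty (Suc k) n w"
    unfolding ex all ty_Suc_eq_wty_iff by (simp only: image_iff)
  finally show ?case .
qed

text \<open>Each level contributes one set quantifier; the constant 2 stems from the two element
  quantifiers of \<open>precedes_fm\<close>.\<close>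

lemma qrank_type_fm: "qrank (type_fm k n w) \<le> k + 2"
proof (induction k arbitrary: n w)
  case 0
  have *: "qrank (conjs fs) \<le> 0 + 2" if "\<forall>f\<in>set fs. qrank f \<le> 2" for fs
    using qrank_conjs[OF that] by simp
  show ?case
    unfolding type_fm.simps
    by (rule *) (auto simp: signed_fm_def meets_fm_def precedes_fm_def)
next
  case (Suc k)
  have *: "\<forall>f\<in>set fs. qrank f \<le> m + 2 \<Longrightarrow> qrank (conjs fs) \<le> m + 2" for fs m
    using qrank_conjs[of fs "m + 2"] by simp
  show ?case
    using *[of "map (ExSet (Suc n)) (map (type_fm k (Suc n)) (relabelings w))" "Suc k"]
      *[of "map Neg (map (type_fm k (Suc n)) (relabelings w))" k] Suc.IH
    by (simp add: Let_def)
qed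

lemma free_type_fm: "free1 (type_fm k n w) = {} \<and> free2 (type_fm k n w) \<subseteq> {..n}"
proof (induction k arbitrary: n w)
  case 0
  show ?case by (auto simp: signed_fm_def meets_fm_def precedes_fm_def split: if_splits)
next
  case (Suc k)
  show ?case using Suc.IH[of "Suc n"] by (fastforce simp: Let_def)
qed

section \<open>A sentence that defines the type of a word\<close>

definition all_elem :: "nat \<Rightarrow> mso \<Rightarrow> mso" where "all_elem a f = Neg (ExElem a (Neg f))"
definition all_set :: "nat \<Rightarrow> mso \<Rightarrow> mso" where "all_set a f = Neg (ExSet a (Neg f))"
definition iff_fm :: "mso \<Rightarrow> mso \<Rightarrow> mso" where
  "iff_fm f g = Conj (Neg (Conj f (Neg g))) (Neg (Conj g (Neg f)))"

lemma sat_defined [simp]: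
  "sat D P e E (all_elem a f) \<longleftrightarrow> (\<forall>c\<in>D. sat D P (e(a := c)) E f)"
  "sat D P e E (all_set a f) \<longleftrightarrow> (\<forall>A\<subseteq>D. sat D P e (E(a := A)) f)"
  "sat D P e E (iff_fm f g) \<longleftrightarrow> (sat D P e E f \<longleftrightarrow> sat D P e E g)"
  by (auto simp: all_elem_def all_set_def iff_fm_def)

lemma free_defined [simp]:
  "free1 (all_elem a f) = free1 f - {a}" "free2 (all_elem a f) = free2 f"
  "free1 (all_set a f) = free1 f" "free2 (all_set a f) = free2 f - {a}"
  "free1 (iff_fm f g) = free1 f \<union> free1 g" "free2 (iff_fm f g) = free2 f \<union> free2 g"
  by (auto simp: all_elem_def all_set_def iff_fm_def)

text \<open>Quantifying over a set that is determined by its definition merely names it. The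
  sentences below use this to put the universe or \<open>P\<close> into the set variables that
  \<open>type_fm\<close> expects.\<close>

lemma ex_defined_subset:
  assumes "P \<subseteq> D"
  shows "(\<exists>A\<subseteq>D. (\<forall>c\<in>D. c \<in> A \<longleftrightarrow> c \<in> P) \<and> Q A) \<longleftrightarrow> Q P"
proof -
  have "A \<subseteq> D \<and> (\<forall>c\<in>D. c \<in> A \<longleftrightarrow> c \<in> P) \<longleftrightarrow> A = P" for A using assms by auto
  then show ?thesis by (simp flip: conj_assoc)
qed

definition word_type_sentence :: "nat \<Rightarrow> word \<Rightarrow> mso" where
  "word_type_sentence k w = ExSet 0 (Conj (all_elem 0 (Mem 0 0))
     (ExSet 1 (Conj (all_elem 0 (iff_fm (Mem 0 1) (InP 0))) (type_fm k 1 (unary w)))))"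

text \<open>The 4 is made of 2 from \<open>qrank_type_fm\<close> and of the two set quantifiers that
  name the universe and \<open>P\<close>.\<close>

lemma wty_eq_if_kequiv:
  assumes "kequiv (k + 4) u v" shows "wty k 1 (unary u) = wty k 1 (unary v)"
proof -
  let ?f = "word_type_sentence k v"
  have free: "sentence ?f"
    using free_type_fm[of k 1 "unary v"] by (auto simp: sentence_def word_type_sentence_def)
  have rank: "qrank ?f \<le> k + 4"
    using qrank_type_fm[of k 1 "unary v"]
    by (simp add: word_type_sentence_def all_elem_def iff_fm_def)
  have iff: "word_models w ?f \<longleftrightarrow> wty k 1 (unary w) = wty k 1 (unary v)" for w
  proof -
    let ?D = "{..<length w}" and ?P = "{i. i < length w \<and> w ! i}"
    have "sat ?D ?P e E ?f \<longleftrightarrow> wty k 1 (unary w) = wty k 1 (unary v)" for e E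
    proof -
      have "sat ?D ?P e E ?f \<longleftrightarrow> (\<exists>A\<subseteq>?D. (\<forall>c\<in>?D. c \<in> A \<longleftrightarrow> c \<in> ?D) \<and>
          (\<exists>B\<subseteq>?D. (\<forall>c\<in>?D. c \<in> B \<longleftrightarrow> c \<in> ?P) \<and>
            sat ?D ?P e (E(0 := A, 1 := B)) (type_fm k 1 (unary v))))"
        by (simp add: word_type_sentence_def)
      also have "\<dots> \<longleftrightarrow> sat ?D ?P e (E(0 := ?D, 1 := ?P)) (type_fm k 1 (unary v))"
        by (subst ex_defined_subset, blast)+ (rule refl)
      also have "\<dots> \<longleftrightarrow> ty k 1 ?D (\<lambda>p. [p \<in> ?P]) = wty k 1 (unary v)"
        by (subst sat_type_fm) (simp_all add: unary_def)
      also have "ty k 1 ?D (\<lambda>p. [p \<in> ?P]) = wty k 1 (unary w)"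
        unfolding wty_def length_unary by (rule ty_cong) (simp add: unary_def)
      finally show ?thesis .
    qed
    then show ?thesis unfolding word_models_def models_def by simp
  qed
  from assms free rank have "word_models u ?f \<longleftrightarrow> word_models v ?f"
    unfolding kequiv_def by blast
  then show ?thesis by (simp add: iff)
qed

section \<open>Bi-infinite words\<close>

text \<open>Segments are half-open, so that adjacent ones share a cut point and concatenate.\<close>

definition seg :: "(int \<Rightarrow> 'a) \<Rightarrow> int \<Rightarrow> int \<Rightarrow> 'a list" where
  "seg x a b = map x [a..b - 1]"

lemma seg_append: "a \<le> b \<Longrightarrow> b \<le> c \<Longrightarrow> seg x a c = seg x a b @ seg x b c"
proof (induction "nat (b - a)" arbitrary: a)
  case 0
  then show ?case by (simp add: seg_def)
next
  case (Suc m)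
  then have "seg x (a + 1) c = seg x (a + 1) b @ seg x b c" by (intro Suc.hyps) auto
  moreover have "[a..d - 1] = a # [a + 1..d - 1]" if "a < d" for d using that by (simp add: upto_rec1)
  moreover have "a < b" "a < c" using Suc by auto
  ultimately show ?case by (simp add: seg_def)
qed

lemma map_seg: "map f (seg x a b) = seg (\<lambda>p. f (x p)) a b"
  by (simp add: seg_def)

lemma strict_mono_int_ge:
  fixes s :: "int \<Rightarrow> int"
  assumes "strict_mono s"
  shows "s c + int n \<le> s (c + int n)"
proof (induction n)
  case (Suc n)
  have "s (c + int n) < s (c + int (Suc n))" using assms by (simp add: strict_mono_less)
  with Suc show ?case by simp
qed simp

text \<open>A strictly increasing integer sequence moves by at least one per step, hence is
  unbounded in both directions and its blocks exhaust the integers.\<close>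

lemma strict_mono_int_blocks:
  fixes s :: "int \<Rightarrow> int"
  assumes "strict_mono s"
  shows "\<exists>c. s c \<le> p \<and> p < s (c + 1)"
proof -
  \<comment> \<open>If \<open>s 0\<close> exceeds \<open>p\<close>, going back
    \<open>s 0 - p\<close> steps lowers the value by at least that much.\<close>
  define a where "a = (if s 0 \<le> p then 0 else p - s 0)"
  have a: "s a \<le> p"
    using strict_mono_int_ge[OF assms, of a "nat (- a)"] by (auto simp: a_def)
  have "\<exists>n. p < s (a + int n)"
    using strict_mono_int_ge[OF assms, of a "nat (p - s a + 1)"] a
    by (intro exI[of _ "nat (p - s a + 1)"]) simp
  then obtain n where n: "p < s (a + int n)" "\<And>m. m < n \<Longrightarrow> \<not> p < s (a + int m)"
    by (meson exists_least_iff)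
  have "n \<noteq> 0" using n(1) a by (intro notI) simp
  then have "\<not> p < s (a + int (n - 1))" by (intro n(2)) simp
  moreover have "a + int (n - 1) + 1 = a + int n" using \<open>n \<noteq> 0\<close> by simp
  ultimately show ?thesis using n(1) by (intro exI[of _ "a + int (n - 1)"]) auto
qed

lemma strict_mono_intI:
  fixes s :: "int \<Rightarrow> int"
  assumes "\<And>c. s c < s (c + 1)"
  shows "strict_mono s"
proof (rule strict_monoI)
  fix c d :: int assume "c < d"
  then show "s c < s d"
  proof (induction d rule: int_gr_induct)
    case (step d)
    with assms[of d] show ?case by simp
  qed (rule assms)
qed

text \<open>Composition over the index order of the integers. Corresponding blocks may differ in
  length and position.\<close>

lemma ty_biword_blocks:
  fixes s s' :: "int \<Rightarrow> int"
  assumes s: "strict_mono s" and s': "strict_mono s'"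
    and eq: "\<And>c. wty k n (seg x (s c) (s (c + 1))) = wty k n (seg x' (s' c) (s' (c + 1)))"
  shows "ty k n UNIV x = ty k n UNIV x'"
proof -
  have UN: "(\<Union>c. {t c..<t (c + 1)}) = UNIV" if "strict_mono t" for t :: "int \<Rightarrow> int"
    using strict_mono_int_blocks[OF that] by fastforce
  have ord: "p < q" if "c < d" "p \<in> {t c..<t (c + 1)}" "q \<in> {t d..<t (d + 1)}" "strict_mono t"
    for t :: "int \<Rightarrow> int" and c d p q
  proof -
    have "t (c + 1) \<le> t d" using that(1,4) by (simp add: strict_mono_less_eq)
    with that show ?thesis by auto
  qed
  have "ty k n (\<Union>c. {s c..<s (c + 1)}) x = ty k n (\<Union>c. {s' c..<s' (c + 1)}) x'"
  proof (rule ty_ordered_sum)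
    show "ty k n {s c..<s (c + 1)} x = ty k n {s' c..<s' (c + 1)} x'" for c
      using eq[of c] by (simp add: ty_interval seg_def)
    show "p < q" if "c < d" "p \<in> {s c..<s (c + 1)}" "q \<in> {s d..<s (d + 1)}" for c d p q
      using that s by (rule ord)
    show "p < q" if "c < d" "p \<in> {s' c..<s' (c + 1)}" "q \<in> {s' d..<s' (d + 1)}" for c d p q
      using that s' by (rule ord)
  qed
  then show ?thesis unfolding UN[OF s] UN[OF s'] .
qed

subsection \<open>Ultimately periodic words\<close>

definition per :: "'a list \<Rightarrow> 'a list \<Rightarrow> 'a list \<Rightarrow> int \<Rightarrow> 'a" where
  "per u v w p = (if p < 0 then u ! nat (p mod int (length u)) else if p < int (length v) then v ! nat p
     else w ! nat ((p - int (length v)) mod int (length w)))"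

text \<open>The boundaries of the blocks of \<open>per u v w\<close>, numbered so that block 0, the
  copy of \<open>v\<close>, runs from \<open>cut 0\<close> to \<open>cut 1\<close>; the copies of
  \<open>u\<close> carry negative and those of \<open>w\<close> positive numbers.\<close>

definition cut :: "'a list \<Rightarrow> 'a list \<Rightarrow> 'a list \<Rightarrow> int \<Rightarrow> int" where
  "cut u v w i = (if i \<le> 0 then i * int (length u) else int (length v) + (i - 1) * int (length w))"

lemma strict_mono_cut:
  assumes "u \<noteq> []" "v \<noteq> []" "w \<noteq> []" shows "strict_mono (cut u v w)"
proof (rule strict_mono_intI)
  fix c :: int
  consider "c < 0" | "c = 0" | "c > 0" by linarith
  then show "cut u v w c < cut u v w (c + 1)"
    by cases (use assms in \<open>auto simp: cut_def algebra_simps\<close>)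
qed

lemma seg_eq_iff: "seg x a (a + int (length w)) = w \<longleftrightarrow> (\<forall>i<length w. x (a + int i) = w ! i)"
  unfolding seg_def by (subst list_eq_iff_nth_eq) (simp cong: conj_cong)

lemma seg_per_cut:
  "seg (per u v w) (cut u v w c) (cut u v w (c + 1)) = (if c < 0 then u else if c = 0 then v else w)"
proof -
  consider "c < 0" | "c = 0" | "c > 0" by linarith
  then show ?thesis
  proof cases
    case 1
    have "seg (per u v w) (c * int (length u)) (c * int (length u) + int (length u)) = u"
      unfolding seg_eq_iff
    proof (intro allI impI)
      fix i assume i: "i < length u"
      have "c * int (length u) + int i < 0"
      proof -
        have "c * int (length u) \<le> (- 1) * int (length u)" using 1 by (intro mult_right_mono) auto
        with i show ?thesis by simp
      qed
      moreover have "(c * int (length u) + int i) mod int (length u) = int i" using i by simp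
      ultimately show "per u v w (c * int (length u) + int i) = u ! i" by (simp add: per_def)
    qed
    with 1 show ?thesis by (simp add: cut_def algebra_simps)
  next
    case 2
    have "seg (per u v w) 0 (0 + int (length v)) = v"
      unfolding seg_eq_iff by (simp add: per_def)
    with 2 show ?thesis by (simp add: cut_def)
  next
    case 3
    let ?a = "int (length v) + (c - 1) * int (length w)"
    have "seg (per u v w) ?a (?a + int (length w)) = w"
      unfolding seg_eq_iff
    proof (intro allI impI)
      fix i assume i: "i < length w"
      have "0 \<le> (c - 1) * int (length w)" using 3 by simp
      moreover have "((c - 1) * int (length w) + int i) mod int (length w) = int i" using i by simp
      ultimately show "per u v w (?a + int i) = w ! i" by (simp add: per_def)
    qed
    with 3 show ?thesis by (simp add: cut_def algebra_simps)
  qed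
qed

lemma ty_biword_per:
  fixes s :: "int \<Rightarrow> int"
  assumes "strict_mono s" "u \<noteq> []" "v \<noteq> []" "w \<noteq> []"
    and "\<And>c. c < 0 \<Longrightarrow> wty k n (seg x (s c) (s (c + 1))) = wty k n u"
    and "wty k n (seg x (s 0) (s 1)) = wty k n v"
    and "\<And>c. c > 0 \<Longrightarrow> wty k n (seg x (s c) (s (c + 1))) = wty k n w"
  shows "ty k n UNIV x = ty k n UNIV (per u v w)"
proof (rule ty_biword_blocks[OF assms(1) strict_mono_cut[OF assms(2-4)]])
  fix c :: int
  consider "c < 0" | "c = 0" | "c > 0" by linarith
  then show "wty k n (seg x (s c) (s (c + 1))) =
      wty k n (seg (per u v w) (cut u v w c) (cut u v w (c + 1)))"
    unfolding seg_per_cut by cases (use assms in auto)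
qed

lemma cut_mono: "c \<le> d \<Longrightarrow> cut u v w c \<le> cut u v w d"
proof -
  assume "c \<le> d"
  then consider "c \<le> d" "d \<le> 0" | "c \<le> 0" "0 < d" | "0 < c" "c \<le> d" by linarith
  then show ?thesis
  proof cases
    case 2
    then have "c * int (length u) \<le> 0" "0 \<le> (d - 1) * int (length w)"
      by (auto intro: mult_nonpos_nonneg mult_nonneg_nonneg)
    then have "c * int (length u) \<le> int (length v) + (d - 1) * int (length w)" by linarith
    with 2 show ?thesis by (simp add: cut_def)
  qed (simp_all add: cut_def mult_right_mono)
qed

lemma seg_per_left:
  "i \<le> 0 \<Longrightarrow> seg (per u v w) (cut u v w (i - int m)) (cut u v w i) = power_word m u"
proof (induction m)
  case (Suc m)
  have "seg (per u v w) (cut u v w (i - int (Suc m))) (cut u v w i) =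
      seg (per u v w) (cut u v w (i - int (Suc m))) (cut u v w (i - int (Suc m) + 1)) @
      seg (per u v w) (cut u v w (i - int (Suc m) + 1)) (cut u v w i)"
    by (intro seg_append cut_mono) auto
  then show ?case using Suc seg_per_cut[of u v w "i - int (Suc m)"] by simp
qed (simp add: seg_def)

lemma seg_per_right:
  "i > 0 \<Longrightarrow> seg (per u v w) (cut u v w i) (cut u v w (i + int m)) = power_word m w"
proof (induction m arbitrary: i)
  case (Suc m)
  have "seg (per u v w) (cut u v w i) (cut u v w (i + int (Suc m))) =
      seg (per u v w) (cut u v w i) (cut u v w (i + 1)) @
      seg (per u v w) (cut u v w (i + 1)) (cut u v w (i + 1 + int m))"
    using seg_append[OF cut_mono cut_mono, of i "i + 1" "i + 1 + int m" "per u v w" u v w]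
    by (simp add: algebra_simps)
  then show ?case using Suc by (simp add: seg_per_cut)
qed (simp add: seg_def)

lemma seg_per_middle:
  "seg (per u v w) (cut u v w (- int l)) (cut u v w (1 + int m)) = power_word l u @ v @ power_word m w"
proof -
  have "seg (per u v w) (cut u v w (- int l)) (cut u v w (1 + int m)) =
      seg (per u v w) (cut u v w (- int l)) (cut u v w 0) @ seg (per u v w) (cut u v w 0) (cut u v w (1 + int m))"
    by (intro seg_append cut_mono) auto
  also have "seg (per u v w) (cut u v w 0) (cut u v w (1 + int m)) =
      seg (per u v w) (cut u v w 0) (cut u v w 1) @ seg (per u v w) (cut u v w 1) (cut u v w (1 + int m))"
    by (intro seg_append cut_mono) auto
  finally show ?thesis
    using seg_per_left[of 0 u v w l] seg_per_right[of 1 u v w m] seg_per_cut[of u v w 0] by simp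
qed

lemma map_per:
  assumes "u \<noteq> []" "w \<noteq> []" shows "per (map f u) (map f v) (map f w) p = f (per u v w p)"
  using assms by (simp add: per_def nat_less_iff)

lemma per_less_zero: "u \<noteq> [] \<Longrightarrow> p < 0 \<Longrightarrow> per u v w p \<in> set u"
  by (simp add: per_def nat_less_iff)

lemma per_ge_length: "w \<noteq> [] \<Longrightarrow> int (length v) \<le> p \<Longrightarrow> per u v w p \<in> set w"
  by (auto simp: per_def nat_less_iff)

lemma range_per: "u \<noteq> [] \<Longrightarrow> w \<noteq> [] \<Longrightarrow> per u v w p \<in> set u \<union> set v \<union> set w"
  by (auto simp: per_def nat_less_iff)

lemma per_arbitrarily_left:
  assumes "l \<in> set u" obtains p where "p < b" "per u v w p = l"
proof -
  obtain i where i: "i < length u" "u ! i = l" using assms by (auto simp: in_set_conv_nth)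
  \<comment> \<open>Periods are non-empty, so the copy that starts \<open>\<bar>b\<bar> + 1\<close>
    periods to the left of 0 lies entirely below \<open>- \<bar>b\<bar>\<close>.\<close>
  define c where "c = - \<bar>b\<bar> - 1"
  have "c * int (length u) + int i < - \<bar>b\<bar>"
  proof -
    have "\<bar>b\<bar> \<le> \<bar>b\<bar> * int (length u)" using i(1) by (cases "length u") (auto simp: algebra_simps)
    with i(1) show ?thesis by (simp add: c_def algebra_simps)
  qed
  then have "c * int (length u) + int i < 0" "c * int (length u) + int i < b" by linarith+
  moreover have "(c * int (length u) + int i) mod int (length u) = int i" using i by simp
  ultimately show ?thesis using that[of "c * int (length u) + int i"] i by (simp add: per_def)
qed

lemma per_arbitrarily_right:
  assumes "l \<in> set w" obtains p where "b < p" "per u v w p = l"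
proof -
  obtain i where i: "i < length w" "w ! i = l" using assms by (auto simp: in_set_conv_nth)
  define c where "c = \<bar>b\<bar> + 1"
  have "c * 1 \<le> c * int (length w)" using i(1) by (intro mult_left_mono) (auto simp: c_def)
  moreover have "(c * int (length w) + int i) mod int (length w) = int i" using i by simp
  moreover have "0 < c" "b < c" by (auto simp: c_def)
  ultimately have "0 \<le> c * int (length w) + int i" "b < int (length v) + (c * int (length w) + int i)"
    "(c * int (length w) + int i) mod int (length w) = int i" by linarith+
  then show ?thesis
    using that[of "int (length v) + (c * int (length w) + int i)"] i by (simp add: per_def)
qed

lemma per_middle: "i < length v \<Longrightarrow> per u v w (int i) = v ! i"
  by (simp add: per_def)

lemma per_attains:
  assumes "l \<in> set (u @ v @ w)" obtains p where "per u v w p = l"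
proof -
  consider "l \<in> set u" | "l \<in> set v" | "l \<in> set w" using assms by auto
  then show ?thesis
  proof cases
    case 1
    then show ?thesis by (rule per_arbitrarily_left[of l u 0 v w]) (rule that)
  next
    case 2
    then obtain i where "i < length v" "v ! i = l" by (auto simp: in_set_conv_nth)
    then show ?thesis using that[of "int i"] per_middle[of i v u w] by simp
  next
    case 3
    then show ?thesis by (rule per_arbitrarily_right[of l w 0 u v]) (rule that)
  qed
qed

lemma label_meets_per:
  assumes "u \<noteq> []" "w \<noteq> []"
  shows "label_meets \<rho> UNIV (per u v w) s t \<longleftrightarrow> word_meets \<rho> (u @ v @ w) s t"
proof
  assume "label_meets \<rho> UNIV (per u v w) s t"
  then obtain p where "label \<rho> (per u v w p) s" "label \<rho> (per u v w p) t" by (auto simp: label_meets_def)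
  with range_per[OF assms, of v p] show "word_meets \<rho> (u @ v @ w) s t" unfolding word_meets_def by auto
next
  assume "word_meets \<rho> (u @ v @ w) s t"
  then obtain l where l: "l \<in> set (u @ v @ w)" "label \<rho> l s" "label \<rho> l t" unfolding word_meets_def by blast
  obtain p where "per u v w p = l" using per_attains[OF l(1)] .
  with l show "label_meets \<rho> UNIV (per u v w) s t" by (auto simp: label_meets_def)
qed

text \<open>Letters of \<open>u\<close> recur arbitrarily far to the left, so a label occurring in
  \<open>u\<close> precedes every label that occurs at all; dually for \<open>w\<close>. Otherwise
  both positions lie in \<open>v\<close>. The order atoms of the infinite word thus become a test on
  three finite words.\<close>

definition per_precedes :: "nat list \<Rightarrow> bool list list \<Rightarrow> bool list list \<Rightarrow> bool list list \<Rightarrow> nat \<Rightarrow> nat \<Rightarrow> bool" where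
  "per_precedes \<rho> u v w s t \<longleftrightarrow> word_meets \<rho> u s s \<and> word_meets \<rho> (u @ v @ w) t t
     \<or> word_meets \<rho> (u @ v @ w) s s \<and> word_meets \<rho> w t t \<or> word_precedes \<rho> v s t"

lemma label_precedes_per:
  assumes "u \<noteq> []" "w \<noteq> []"
  shows "label_precedes \<rho> UNIV (per u v w) s t \<longleftrightarrow> per_precedes \<rho> u v w s t"
proof
  assume "label_precedes \<rho> UNIV (per u v w) s t"
  then obtain p q where pq: "p < q" "label \<rho> (per u v w p) s" "label \<rho> (per u v w q) t"
    by (auto simp: label_precedes_def)
  consider "p < 0" | "int (length v) \<le> q" | "0 \<le> p" "q < int (length v)" by linarith
  then show "per_precedes \<rho> u v w s t"
  proof cases
    case 1
    have "word_meets \<rho> u s s" "word_meets \<rho> (u @ v @ w) t t"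
      using per_less_zero[OF assms(1) 1, of v w] range_per[OF assms, of v q] pq
      unfolding word_meets_def by auto
    then show ?thesis by (simp add: per_precedes_def)
  next
    case 2
    have "word_meets \<rho> (u @ v @ w) s s" "word_meets \<rho> w t t"
      using per_ge_length[OF assms(2) 2, of u] range_per[OF assms, of v p] pq
      unfolding word_meets_def by auto
    then show ?thesis by (simp add: per_precedes_def)
  next
    case 3
    then have "label_precedes \<rho> {..<length v} ((!) v) s t"
      unfolding label_precedes_def using pq
      by (intro bexI[of _ "nat p"] bexI[of _ "nat q"]) (auto simp: per_def)
    then show ?thesis by (simp add: per_precedes_def word_precedes_iff)
  qed
next
  assume "per_precedes \<rho> u v w s t"
  then consider (1) "word_meets \<rho> u s s" "word_meets \<rho> (u @ v @ w) t t"
    | (2) "word_meets \<rho> (u @ v @ w) s s" "word_meets \<rho> w t t" | (3) "word_precedes \<rho> v s t"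
    unfolding per_precedes_def by blast
  then show "label_precedes \<rho> UNIV (per u v w) s t"
  proof cases
    case 1
    then obtain l l' where l: "l \<in> set u" "label \<rho> l s" "l' \<in> set (u @ v @ w)" "label \<rho> l' t"
      unfolding word_meets_def by blast
    obtain q where q: "per u v w q = l'" using per_attains[OF l(3)] .
    obtain p where "p < q" "per u v w p = l" using per_arbitrarily_left[OF l(1)] .
    with q l show ?thesis unfolding label_precedes_def by (intro bexI[of _ p] bexI[of _ q]) auto
  next
    case 2
    then obtain l l' where l: "l \<in> set (u @ v @ w)" "label \<rho> l s" "l' \<in> set w" "label \<rho> l' t"
      unfolding word_meets_def by blast
    obtain p where p: "per u v w p = l" using per_attains[OF l(1)] .
    obtain q where "p < q" "per u v w q = l'" using per_arbitrarily_right[OF l(3)] .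
    with p l show ?thesis unfolding label_precedes_def by (intro bexI[of _ p] bexI[of _ q]) auto
  next
    case 3
    then obtain i j where "i < j" "j < length v" "label \<rho> (v ! i) s" "label \<rho> (v ! j) t"
      unfolding word_precedes_iff label_precedes_def by auto
    then show ?thesis unfolding label_precedes_def
      by (intro bexI[of _ "int i"] bexI[of _ "int j"]) (auto simp: per_middle)
  qed
qed

subsection \<open>Labels on ultimately periodic words\<close>

text \<open>Ramsey's theorem for pairs, with the homogeneous set given as a sequence. It avoids 0
  because \<open>h 0\<close> will count copies of a period next to the middle word, and
  \<open>wty_power_word_idem\<close> needs at least one.\<close>

lemma Ramsey_strict_mono:
  fixes f :: "nat \<Rightarrow> nat \<Rightarrow> nat"
  assumes "\<And>i j. f i j < b"
  shows "\<exists>h :: nat \<Rightarrow> nat. \<exists>t. strict_mono h \<and> 0 < h 0 \<and> (\<forall>i j. i < j \<longrightarrow> f (h i) (h j) = t)"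
proof -
  have "infinite {1::nat..}" by (simp add: infinite_Ici)
  then have "\<exists>Y t. Y \<subseteq> {1..} \<and> infinite Y \<and> t < b \<and>
      (\<forall>i\<in>Y. \<forall>j\<in>Y. i \<noteq> j \<longrightarrow> f (Min {i, j}) (Max {i, j}) = t)"
    by (rule Ramsey2) (simp add: assms)
  then obtain Y t where Y: "Y \<subseteq> {1..}" "infinite Y"
    and "\<forall>i\<in>Y. \<forall>j\<in>Y. i \<noteq> j \<longrightarrow> f (Min {i, j}) (Max {i, j}) = t" by (elim exE conjE)
  then have t: "f (Min {i, j}) (Max {i, j}) = t" if "i \<in> Y" "j \<in> Y" "i \<noteq> j" for i j
    using that by simp
  have mono: "strict_mono (enumerate Y)" using Y(2) by (rule strict_mono_enumerate)
  have "enumerate Y i \<in> Y" for i using Y(2) by (rule enumerate_in_set)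
  then have "f (enumerate Y i) (enumerate Y j) = t" if "i < j" for i j
    using t[of "enumerate Y i" "enumerate Y j"] strict_monoD[OF mono that] by simp
  moreover have "0 < enumerate Y 0" using enumerate_in_set[OF Y(2), of 0] Y(1) by auto
  ultimately show ?thesis using mono by (intro exI[of _ "enumerate Y"] exI[of _ t]) simp
qed

lemma wty_less: "wty k n w < ty_bound k n"
  by (simp add: wty_def ty_less)

lemma ex_relabeling_wty:
  assumes "wty (Suc k) n (map tl v') = wty (Suc k) n w" "[] \<notin> set v'"
  shows "\<exists>w'\<in>set (relabelings w). wty k (Suc n) v' = wty k (Suc n) w'"
  using word_relabel[OF assms] unfolding set_relabelings by blast

text \<open>A set of positions becomes homogeneous only at some distance from the middle word. The
  periods within that distance have to join the middle, and up to type \<open>m\<close> copies on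
  either side represent them.\<close>

definition expanded :: "nat \<Rightarrow> bool list list \<Rightarrow> bool list list \<Rightarrow> bool list list \<Rightarrow> bool list list" where
  "expanded m u v w = power_word m u @ v @ power_word m w"

lemma ty_per_expanded:
  assumes "u \<noteq> []" "v \<noteq> []" "w \<noteq> []" "0 < m"
  shows "ty k n UNIV (per u v w) =
    ty k n UNIV (per (power_word m u) (expanded m u v w) (power_word m w))"
proof (rule ty_biword_per)
  \<comment> \<open>The same infinite word, regrouped: \<open>m\<close> periods form a block, and
    the middle block absorbs \<open>m\<close> periods from each side.\<close>
  define s where "s c = cut u v w (if c \<le> 0 then (c - 1) * int m else 1 + c * int m)" for c :: int
  note cut_less = strict_mono_cut[OF assms(1-3), THEN strict_monoD]
  show "strict_mono s"
  proof (rule strict_mono_intI)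
    fix c :: int
    consider "c < 0" | "c = 0" | "c > 0" by linarith
    then show "s c < s (c + 1)"
      unfolding s_def by cases (use \<open>0 < m\<close> in \<open>auto intro!: cut_less simp: algebra_simps\<close>)
  qed
  show "wty k n (seg (per u v w) (s c) (s (c + 1))) = wty k n (power_word m u)" if "c < 0" for c
  proof -
    have "c * int m \<le> 0" using that by (simp add: mult_nonpos_nonneg)
    with that seg_per_left[of "c * int m" u v w m] show ?thesis by (simp add: s_def algebra_simps)
  qed
  show "wty k n (seg (per u v w) (s 0) (s 1)) = wty k n (expanded m u v w)"
    using seg_per_middle[of u v w m m] by (simp add: s_def expanded_def)
  show "wty k n (seg (per u v w) (s c) (s (c + 1))) = wty k n (power_word m w)" if "c > 0" for c
  proof -
    have "0 < 1 + c * int m" using that by (simp add: add_pos_nonneg)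
    with that seg_per_right[of "1 + c * int m" u v w m] show ?thesis by (simp add: s_def algebra_simps)
  qed
qed (use assms in \<open>auto simp: expanded_def power_word_def\<close>)

text \<open>A labelling of the regrouped word by periodic labels is one choice of a set there;
  back-and-forth carries it to \<open>per u v w\<close>, which has the same type at every
  depth.\<close>

lemma ex_label_per:
  assumes "u \<noteq> []" "v \<noteq> []" "w \<noteq> []" "0 < m"
    and u': "u' \<in> set (relabelings (power_word m u))"
    and v': "v' \<in> set (relabelings (expanded m u v w))"
    and w': "w' \<in> set (relabelings (power_word m w))"
  shows "\<exists>X. ty k (Suc n) UNIV (\<lambda>p. X p # per u v w p) = ty k (Suc n) UNIV (per u' v' w')"
proof -
  let ?x = "per (power_word m u) (expanded m u v w) (power_word m w)"
  have "ty (Suc k) n UNIV (per u v w) = ty (Suc k) n UNIV ?x"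
    by (rule ty_per_expanded[OF assms(1-4)])
  from this[unfolded ty_Suc_eq_iff, THEN conjunct2, THEN spec, of "\<lambda>p. hd (per u' v' w' p)"]
  obtain X where "ty k (Suc n) UNIV (\<lambda>p. X p # per u v w p) = ty k (Suc n) UNIV (\<lambda>p. hd (per u' v' w' p) # ?x p)" ..
  moreover have "hd (per u' v' w' p) # ?x p = per u' v' w' p" for p
  proof -
    have maps: "map tl u' = power_word m u" "map tl v' = expanded m u v w" "map tl w' = power_word m w"
      and ne: "[] \<notin> set u' \<union> set v' \<union> set w'"
      using u' v' w' by (auto simp: set_relabelings)
    have "power_word m u \<noteq> []" "power_word m w \<noteq> []"
      using assms(1,3,4) by (auto simp: power_word_def)
    then have "u' \<noteq> []" "w' \<noteq> []" using maps by auto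
    then have "?x p = tl (per u' v' w' p)" "per u' v' w' p \<noteq> []"
      using map_per[of u' w' tl v' p] range_per[of u' w' v' p] maps ne by auto
    then show ?thesis by simp
  qed
  ultimately show ?thesis by (intro exI[of _ X]) simp
qed

text \<open>Ramsey's theorem on each half makes the given set homogeneous between cut points whose
  distances are multiples of \<open>m\<close> periods. Without the new label, each such block is a
  positive power of an \<open>m\<close>-th power of a period, hence equivalent to the
  \<open>m\<close>-th power itself. This equivalence is needed at depth \<open>Suc k\<close>, since
  transferring the label uses up one level.\<close>

lemma ex_relabeling_per:
  assumes ne: "u \<noteq> []" "v \<noteq> []" "w \<noteq> []" and m: "fact (ty_bound (Suc k) n) dvd m" "0 < m"
  shows "\<exists>u'\<in>set (relabelings (power_word m u)). \<exists>v'\<in>set (relabelings (expanded m u v w)).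
    \<exists>w'\<in>set (relabelings (power_word m w)).
    ty k (Suc n) UNIV (\<lambda>p. X p # per u v w p) = ty k (Suc n) UNIV (per u' v' w')"
proof -
  define y where "y p = X p # per u v w p" for p
  have tl_seg: "map tl (seg y a b) = seg (per u v w) a b" "[] \<notin> set (seg y a b)" for a b
    by (auto simp: map_seg y_def seg_def)
  note cut_less = strict_mono_cut[OF ne, THEN strict_monoD]
  obtain h :: "nat \<Rightarrow> nat" and tr where h: "strict_mono h" "0 < h 0" and h': "\<forall>i j. i < j \<longrightarrow> wty k (Suc n) (seg y (cut u v w (1 + int (h i * m))) (cut u v w (1 + int (h j * m)))) = tr"
    using Ramsey_strict_mono[of "\<lambda>i j. wty k (Suc n) (seg y (cut u v w (1 + int (i * m))) (cut u v w (1 + int (j * m))))",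
        OF wty_less] by (elim exE conjE) (rule that)
  obtain g :: "nat \<Rightarrow> nat" and tl' where g: "strict_mono g" "0 < g 0" and g': "\<forall>i j. i < j \<longrightarrow> wty k (Suc n) (seg y (cut u v w (- int (g j * m))) (cut u v w (- int (g i * m)))) = tl'"
    using Ramsey_strict_mono[of "\<lambda>i j. wty k (Suc n) (seg y (cut u v w (- int (j * m))) (cut u v w (- int (i * m))))",
        OF wty_less] by (elim exE conjE) (rule that)
  have pos: "0 < h i" "0 < g i" for i
    using strict_mono_less_eq[OF h(1), of 0 i] strict_mono_less_eq[OF g(1), of 0 i] h(2) g(2) by simp_all
  \<comment> \<open>The left half is enumerated backwards. Blocks other than block 0 lie between
    chosen cut points; block 0 is the stretch between the two homogeneous parts.\<close>
  define s where "s c = cut u v w (if c \<le> 0 then - int (g (nat (- c)) * m) else 1 + int (h (nat (c - 1)) * m))" for c :: int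
  have "strict_mono s"
  proof (rule strict_mono_intI)
    fix c :: int
    consider "c < 0" | "c = 0" | "c > 0" by linarith
    then show "s c < s (c + 1)"
    proof cases
      case 1
      then have "g (nat (- (c + 1))) < g (nat (- c))" by (intro strict_monoD[OF g(1)]) auto
      with 1 m(2) show ?thesis unfolding s_def by (intro cut_less) simp
    next
      case 2
      then show ?thesis unfolding s_def by (intro cut_less) (simp del: of_nat_mult)
    next
      case 3
      then have "h (nat (c - 1)) < h (nat c)" by (intro strict_monoD[OF h(1)]) auto
      with 3 m(2) show ?thesis unfolding s_def by (intro cut_less) simp
    qed
  qed
  \<comment> \<open>By homogeneity one block on each side represents all the others, so only three
    relabellings have to be found.\<close>
  have "seg (per u v w) (s (-1)) (s 0) = power_word ((g 1 - g 0) * m) u"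
  proof -
    obtain d where d: "g 1 = g 0 + d" 
      using strict_monoD[OF g(1), of 0 1] le_Suc_ex[of "g 0" "g 1"] by auto
    have "s (-1) = cut u v w (- int (g 1 * m))" "s 0 = cut u v w (- int (g 0 * m))" by (simp_all add: s_def)
    moreover have "- int (g 1 * m) = - int (g 0 * m) - int (d * m)" unfolding d by (simp add: algebra_simps)
    ultimately show ?thesis
      using seg_per_left[of "- int (g 0 * m)" u v w "d * m"] d by simp
  qed
  then have "wty (Suc k) n (map tl (seg y (s (-1)) (s 0))) = wty (Suc k) n (power_word m u)"
    using wty_power_word_idem[OF m, of "g 1 - g 0" u] strict_monoD[OF g(1), of 0 1] by (simp add: tl_seg)
  from ex_relabeling_wty[OF this tl_seg(2)] obtain u' where
    u': "u' \<in> set (relabelings (power_word m u))" "wty k (Suc n) (seg y (s (-1)) (s 0)) = wty k (Suc n) u'" by blast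
  have "seg (per u v w) (s 1) (s 2) = power_word ((h 1 - h 0) * m) w"
  proof -
    obtain d where d: "h 1 = h 0 + d" 
      using strict_monoD[OF h(1), of 0 1] le_Suc_ex[of "h 0" "h 1"] by auto
    have "s 1 = cut u v w (1 + int (h 0 * m))" "s 2 = cut u v w (1 + int (h 1 * m))" by (simp_all add: s_def)
    moreover have "1 + int (h 1 * m) = 1 + int (h 0 * m) + int (d * m)" unfolding d by (simp add: algebra_simps)
    moreover have "0 < 1 + int (h 0 * m)" by (simp del: of_nat_mult)
    ultimately show ?thesis
      using seg_per_right[of "1 + int (h 0 * m)" u v w "d * m"] d by (simp add: add.assoc)
  qed
  then have "wty (Suc k) n (map tl (seg y (s 1) (s 2))) = wty (Suc k) n (power_word m w)"
    using wty_power_word_idem[OF m, of "h 1 - h 0" w] strict_monoD[OF h(1), of 0 1] by (simp add: tl_seg)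
  from ex_relabeling_wty[OF this tl_seg(2)] obtain w' where
    w': "w' \<in> set (relabelings (power_word m w))" "wty k (Suc n) (seg y (s 1) (s 2)) = wty k (Suc n) w'" by blast
  have "seg (per u v w) (s 0) (s 1) = power_word (g 0 * m) u @ v @ power_word (h 0 * m) w"
    using seg_per_middle[of u v w "g 0 * m" "h 0 * m"] by (simp add: s_def)
  then have "wty (Suc k) n (map tl (seg y (s 0) (s 1))) = wty (Suc k) n (expanded m u v w)"
    unfolding tl_seg expanded_def using pos m by (auto intro!: wty_append wty_power_word_idem)
  from ex_relabeling_wty[OF this tl_seg(2)] obtain v' where
    v': "v' \<in> set (relabelings (expanded m u v w))" "wty k (Suc n) (seg y (s 0) (s 1)) = wty k (Suc n) v'" by blast
  have "ty k (Suc n) UNIV y = ty k (Suc n) UNIV (per u' v' w')"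
  proof (rule ty_biword_per[OF \<open>strict_mono s\<close>])
    show "u' \<noteq> []" "v' \<noteq> []" "w' \<noteq> []"
      using u' v' w' ne m(2) by (auto simp: set_relabelings expanded_def power_word_def)
    show "wty k (Suc n) (seg y (s c) (s (c + 1))) = wty k (Suc n) u'" if "c < 0" for c
      using g'[rule_format, of "nat (- (c + 1))" "nat (- c)"] g'[rule_format, of 0 1] u'(2) that by (simp add: s_def)
    show "wty k (Suc n) (seg y (s c) (s (c + 1))) = wty k (Suc n) w'" if "c > 0" for c
      using h'[rule_format, of "nat (c - 1)" "nat c"] h'[rule_format, of 0 1] w'(2) that by (simp add: s_def)
    show "wty k (Suc n) (seg y (s 0) (s 1)) = wty k (Suc n) v'" by (rule v'(2))
  qed
  with u'(1) v'(1) w'(1) show ?thesis unfolding y_def by blast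
qed

subsection \<open>Deciding satisfaction in ultimately periodic words\<close>

type_synonym period = "bool list list \<times> bool list list \<times> bool list list"

definition period_meets :: "nat list \<Rightarrow> period \<Rightarrow> nat \<Rightarrow> nat \<Rightarrow> bool" where
  "period_meets \<rho> t i j \<longleftrightarrow> word_meets \<rho> (fst t @ fst (snd t) @ snd (snd t)) i j"

definition period_precedes :: "nat list \<Rightarrow> period \<Rightarrow> nat \<Rightarrow> nat \<Rightarrow> bool" where
  "period_precedes \<rho> t i j \<longleftrightarrow> per_precedes \<rho> (fst t) (fst (snd t)) (snd (snd t)) i j"

definition period_relabelings :: "nat \<Rightarrow> period \<Rightarrow> period list" where
  "period_relabelings m t =
     concat (map (\<lambda>u'. concat (map (\<lambda>v'. map (\<lambda>w'. (u', v', w'))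
       (relabelings (power_word m (snd (snd t)))))
       (relabelings (expanded m (fst t) (fst (snd t)) (snd (snd t))))))
       (relabelings (power_word m (fst t))))"

primrec psat :: "mso \<Rightarrow> nat \<Rightarrow> nat list \<Rightarrow> period \<Rightarrow> bool" where
  "psat (Eq a b) m \<rho> t \<longleftrightarrow> period_meets \<rho> t (2 * a + 1) (2 * b + 1)"
| "psat (Le a b) m \<rho> t \<longleftrightarrow> period_meets \<rho> t (2 * a + 1) (2 * b + 1) \<or>
    period_precedes \<rho> t (2 * a + 1) (2 * b + 1)"
| "psat (InP a) m \<rho> t \<longleftrightarrow> period_meets \<rho> t (2 * a + 1) 0"
| "psat (Mem a b) m \<rho> t \<longleftrightarrow> period_meets \<rho> t (2 * a + 1) (2 * b + 2)"
| "psat (Neg f) m \<rho> t \<longleftrightarrow> \<not> psat f m \<rho> t"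
| "psat (Conj f g) m \<rho> t \<longleftrightarrow> psat f m \<rho> t \<and> psat g m \<rho> t"
| "psat (ExElem a f) m \<rho> t \<longleftrightarrow> (\<exists>t'\<in>set (period_relabelings m t). let \<rho>' = (2 * a + 1) # \<rho> in
    period_meets \<rho>' t' (2 * a + 1) (2 * a + 1) \<and> \<not> period_precedes \<rho>' t' (2 * a + 1) (2 * a + 1) \<and>
    psat f m \<rho>' t')"
| "psat (ExSet a f) m \<rho> t \<longleftrightarrow> (\<exists>t'\<in>set (period_relabelings m t). psat f m ((2 * a + 2) # \<rho>) t')"

definition letters_ok :: "nat \<Rightarrow> period \<Rightarrow> bool" where
  "letters_ok n t \<longleftrightarrow> fst t \<noteq> [] \<and> fst (snd t) \<noteq> [] \<and> snd (snd t) \<noteq> [] \<and>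
     (\<forall>l\<in>set (fst t) \<union> set (fst (snd t)) \<union> set (snd (snd t)). length l = n)"

definition tper :: "period \<Rightarrow> int \<Rightarrow> bool list" where
  "tper t = per (fst t) (fst (snd t)) (snd (snd t))"

lemma length_tper: "letters_ok n t \<Longrightarrow> length (tper t p) = n"
  using range_per[of "fst t" "snd (snd t)" "fst (snd t)" p] by (auto simp: letters_ok_def tper_def)

lemma letters_ok_relabelings:
  assumes "letters_ok n t" "t' \<in> set (period_relabelings m t)" "0 < m"
  shows "letters_ok (Suc n) t'"
proof -
  obtain u v w where t: "t = (u, v, w)" by (cases t) auto
  obtain u' v' w' where t': "t' = (u', v', w')" by (cases t') auto
  have mem: "u' \<in> set (relabelings (power_word m u))" "v' \<in> set (relabelings (expanded m u v w))"
    "w' \<in> set (relabelings (power_word m w))"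
    using assms(2) by (auto simp: period_relabelings_def t t')
  have "\<forall>l\<in>set (power_word m z). length l = n" if "\<forall>l\<in>set z. length l = n" for z
    using that by (auto simp: power_word_def)
  then have "\<forall>l\<in>set (power_word m u). length l = n" "\<forall>l\<in>set (expanded m u v w). length l = n"
    "\<forall>l\<in>set (power_word m w). length l = n"
    using assms(1) by (auto simp: letters_ok_def t expanded_def)
  with mem have "\<forall>l\<in>set u'. length l = Suc n" "\<forall>l\<in>set v'. length l = Suc n" "\<forall>l\<in>set w'. length l = Suc n"
    using relabelings_lengths by blast+
  moreover have "u' \<noteq> []" "v' \<noteq> []" "w' \<noteq> []"
    using mem assms(1,3) by (auto simp: set_relabelings letters_ok_def t expanded_def power_word_def)
  ultimately show ?thesis by (auto simp: letters_ok_def t')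
qed

text \<open>The step that replaces a set quantifier over the integers by a search through a finite
  list.\<close>

lemma ex_label_iff_ex_relabeling:
  assumes "letters_ok n t" "fact (ty_bound (Suc k) n) dvd m" "0 < m"
    and "\<And>X t'. t' \<in> set (period_relabelings m t) \<Longrightarrow>
      ty k (Suc n) UNIV (\<lambda>p. X p # tper t p) = ty k (Suc n) UNIV (tper t') \<Longrightarrow> Q X \<longleftrightarrow> Q' t'"
  shows "(\<exists>X. Q X) \<longleftrightarrow> (\<exists>t'\<in>set (period_relabelings m t). Q' t')"
proof -
  obtain u v w where t: "t = (u, v, w)" by (cases t) auto
  have ne: "u \<noteq> []" "v \<noteq> []" "w \<noteq> []" using assms(1) by (auto simp: letters_ok_def t)
  have mem: "(u', v', w') \<in> set (period_relabelings m t) \<longleftrightarrow> u' \<in> set (relabelings (power_word m u)) \<and>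
      v' \<in> set (relabelings (expanded m u v w)) \<and> w' \<in> set (relabelings (power_word m w))" for u' v' w'
    by (auto simp: period_relabelings_def t)
  show ?thesis
  proof
    assume "\<exists>X. Q X"
    then obtain X where X: "Q X" ..
    from ex_relabeling_per[OF ne assms(2,3), of X] obtain u' v' w' where
      "u' \<in> set (relabelings (power_word m u))" "v' \<in> set (relabelings (expanded m u v w))"
      "w' \<in> set (relabelings (power_word m w))"
      "ty k (Suc n) UNIV (\<lambda>p. X p # per u v w p) = ty k (Suc n) UNIV (per u' v' w')"
      by (elim bexE) (rule that)
    then have "(u', v', w') \<in> set (period_relabelings m t)"
      "ty k (Suc n) UNIV (\<lambda>p. X p # tper t p) = ty k (Suc n) UNIV (tper (u', v', w'))"
      by (simp_all only: mem) (simp add: tper_def t)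
    with assms(4)[OF this] X show "\<exists>t'\<in>set (period_relabelings m t). Q' t'" by blast
  next
    assume "\<exists>t'\<in>set (period_relabelings m t). Q' t'"
    then obtain u' v' w' where t': "(u', v', w') \<in> set (period_relabelings m t)" "Q' (u', v', w')" by auto
    from t'(1)[unfolded mem] ex_label_per[OF ne assms(3), of u' v' w' k n] obtain X where
      "ty k (Suc n) UNIV (\<lambda>p. X p # tper t p) = ty k (Suc n) UNIV (tper (u', v', w'))"
      unfolding tper_def t by auto
    from assms(4)[OF t'(1) this] t'(2) show "\<exists>X. Q X" by blast
  qed
qed

lemma period_atoms:
  assumes "letters_ok n t"
  shows "label_meets \<rho> UNIV (tper t) i j \<longleftrightarrow> period_meets \<rho> t i j"
    and "label_precedes \<rho> UNIV (tper t) i j \<longleftrightarrow> period_precedes \<rho> t i j"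
  using assms label_meets_per label_precedes_per
  by (simp_all add: letters_ok_def tper_def period_meets_def period_precedes_def)

text \<open>One \<open>m\<close> serves all nested quantifiers: exchanging a level of depth for a
  label lowers \<open>ty_bound\<close>, and the factorial of the smaller bound divides that of the
  larger one.\<close>

lemma psat_iff_lsat:
  assumes "letters_ok (length \<rho>) t" "qrank f \<le> k" "fact (ty_bound k (length \<rho>)) dvd m" "0 < m"
  shows "psat f m \<rho> t \<longleftrightarrow> lsat f \<rho> UNIV (tper t)"
  using assms
proof (induction f arbitrary: k \<rho> t)
  case (ExElem a f)
  then obtain l where k: "k = Suc l" and l: "qrank f \<le> l" by (cases k) auto
  have dvd: "fact (ty_bound l (Suc (length \<rho>))) dvd m"
  proof -
    have "ty_bound l (Suc (length \<rho>)) \<le> ty_bound k (length \<rho>)" by (simp add: k ty_bound_Suc less_imp_le)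
    then have "fact (ty_bound l (Suc (length \<rho>))) dvd (fact (ty_bound k (length \<rho>)) :: nat)" by (rule fact_dvd)
    then show ?thesis using ExElem.prems(3) by (rule dvd_trans)
  qed
  let ?s = "2 * a + 1"
  let ?\<rho> = "?s # \<rho>"
  show ?case unfolding psat.simps lsat.simps Let_def
  proof (rule ex_label_iff_ex_relabeling[OF ExElem.prems(1) ExElem.prems(3)[unfolded k] ExElem.prems(4), symmetric])
    fix X t'
    assume t': "t' \<in> set (period_relabelings m t)"
      and ty: "ty l (Suc (length \<rho>)) UNIV (\<lambda>p. X p # tper t p) = ty l (Suc (length \<rho>)) UNIV (tper t')"
    from ty have ty': "ty l (length ?\<rho>) UNIV (\<lambda>p. X p # tper t p) = ty l (length ?\<rho>) UNIV (tper t')" by simp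
    have ok: "letters_ok (length ?\<rho>) t'" using letters_ok_relabelings[OF ExElem.prems(1) t' ExElem.prems(4)] by simp
    have len: "length (X p # tper t p) = length ?\<rho>" "length (tper t' p) = length ?\<rho>" for p
      using length_tper[OF ExElem.prems(1)] length_tper[OF ok] by simp_all
    have "psat f m ?\<rho> t' \<longleftrightarrow> lsat f ?\<rho> UNIV (tper t')"
      by (rule ExElem.IH[OF ok l _ ExElem.prems(4)]) (simp add: dvd)
    then show "(label_meets ?\<rho> UNIV (\<lambda>p. X p # tper t p) ?s ?s \<and>
        \<not> label_precedes ?\<rho> UNIV (\<lambda>p. X p # tper t p) ?s ?s \<and> lsat f ?\<rho> UNIV (\<lambda>p. X p # tper t p)) \<longleftrightarrow>
      (period_meets ?\<rho> t' ?s ?s \<and> \<not> period_precedes ?\<rho> t' ?s ?s \<and> psat f m ?\<rho> t')"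
      using label_atoms_cong[OF ty' len] lsat_cong_ty[OF ty' l len] period_atoms[OF ok] by simp
  qed
next
  case (ExSet a f)
  then obtain l where k: "k = Suc l" and l: "qrank f \<le> l" by (cases k) auto
  have dvd: "fact (ty_bound l (Suc (length \<rho>))) dvd m"
  proof -
    have "ty_bound l (Suc (length \<rho>)) \<le> ty_bound k (length \<rho>)" by (simp add: k ty_bound_Suc less_imp_le)
    then have "fact (ty_bound l (Suc (length \<rho>))) dvd (fact (ty_bound k (length \<rho>)) :: nat)" by (rule fact_dvd)
    then show ?thesis using ExSet.prems(3) by (rule dvd_trans)
  qed
  let ?\<rho> = "(2 * a + 2) # \<rho>"
  show ?case unfolding psat.simps lsat.simps
  proof (rule ex_label_iff_ex_relabeling[OF ExSet.prems(1) ExSet.prems(3)[unfolded k] ExSet.prems(4), symmetric])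
    fix X t'
    assume t': "t' \<in> set (period_relabelings m t)"
      and ty: "ty l (Suc (length \<rho>)) UNIV (\<lambda>p. X p # tper t p) = ty l (Suc (length \<rho>)) UNIV (tper t')"
    from ty have ty': "ty l (length ?\<rho>) UNIV (\<lambda>p. X p # tper t p) = ty l (length ?\<rho>) UNIV (tper t')" by simp
    have ok: "letters_ok (length ?\<rho>) t'" using letters_ok_relabelings[OF ExSet.prems(1) t' ExSet.prems(4)] by simp
    have len: "length (X p # tper t p) = length ?\<rho>" "length (tper t' p) = length ?\<rho>" for p
      using length_tper[OF ExSet.prems(1)] length_tper[OF ok] by simp_all
    have "psat f m ?\<rho> t' \<longleftrightarrow> lsat f ?\<rho> UNIV (tper t')"
      by (rule ExSet.IH[OF ok l _ ExSet.prems(4)]) (simp add: dvd)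
    then show "lsat f ?\<rho> UNIV (\<lambda>p. X p # tper t p) \<longleftrightarrow> psat f m ?\<rho> t'"
      using lsat_cong_ty[OF ty' l len] by simp
  qed
next
  case (Conj f g)
  have "psat f m \<rho> t \<longleftrightarrow> lsat f \<rho> UNIV (tper t)" "psat g m \<rho> t \<longleftrightarrow> lsat g \<rho> UNIV (tper t)"
    using Conj.IH(1)[of \<rho> t k] Conj.IH(2)[of \<rho> t k] Conj.prems by simp_all
  then show ?case by simp
next
  case (Neg f)
  then show ?case using Neg.IH[of \<rho> t k] by simp
qed (simp_all add: period_atoms)

section \<open>Homogeneous factorisations\<close>

lemma ex_sequence:
  assumes "x0 \<in> H" "\<And>x. x \<in> H \<Longrightarrow> \<exists>y\<in>H. R x y"
  shows "\<exists>q :: nat \<Rightarrow> 'a. q 0 = x0 \<and> (\<forall>n. q n \<in> H \<and> R (q n) (q (Suc n)))"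
proof -
  obtain f where f: "\<And>x. x \<in> H \<Longrightarrow> f x \<in> H \<and> R x (f x)" using assms(2) by metis
  have "(f ^^ n) x0 \<in> H" for n by (induction n) (simp_all add: assms(1) f)
  then show ?thesis using f by (intro exI[of _ "\<lambda>n. (f ^^ n) x0"]) simp
qed

lemma unary_factor: "unary (factor \<xi> i (j - 1)) = seg (\<lambda>p. [\<xi> p]) i j"
  by (simp add: unary_def factor_def seg_def)

text \<open>A descending sequence in \<open>Hl\<close> and an ascending one in \<open>Hr\<close>,
  started at some \<open>i0 < j0\<close>, cut \<open>\<xi>\<close> into blocks with the types of
  \<open>u\<close>, \<open>v\<close> and \<open>w\<close>; composition does the rest.\<close>

lemma ty_eq_per_if_homogeneous_factorisation:
  assumes "homogeneous_factorisation (k + 4) \<xi> Hl Hr (u, v, w)" "u \<noteq> []" "v \<noteq> []" "w \<noteq> []"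
  shows "ty k 1 UNIV (\<lambda>p. [\<xi> p]) = ty k 1 UNIV (per (unary u) (unary v) (unary w))"
proof -
  from assms(1) have unb: "\<not> bdd_below Hl" "\<not> bdd_above Hr"
    and hom: "\<And>i j. i \<in> Hl \<Longrightarrow> j \<in> Hl \<Longrightarrow> i < j \<Longrightarrow> wty k 1 (seg (\<lambda>p. [\<xi> p]) i j) = wty k 1 (unary u)"
      "\<And>i j. i \<in> Hl \<Longrightarrow> j \<in> Hr \<Longrightarrow> i < j \<Longrightarrow> wty k 1 (seg (\<lambda>p. [\<xi> p]) i j) = wty k 1 (unary v)"
      "\<And>i j. i \<in> Hr \<Longrightarrow> j \<in> Hr \<Longrightarrow> i < j \<Longrightarrow> wty k 1 (seg (\<lambda>p. [\<xi> p]) i j) = wty k 1 (unary w)"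
    unfolding homogeneous_factorisation_def unary_factor[symmetric]
    by (auto simp del: One_nat_def intro!: wty_eq_if_kequiv)
  have left: "\<exists>j\<in>Hl. j < i" for i using unb(1) unfolding bdd_below_def by (meson not_le)
  have right: "\<exists>j\<in>Hr. i < j" for i using unb(2) unfolding bdd_above_def by (meson not_le)
  obtain i0 where i0: "i0 \<in> Hl" using left by blast
  obtain j0 where j0: "j0 \<in> Hr" "i0 < j0" using right by blast
  obtain r where r: "r 0 = i0" "\<forall>n. r n \<in> Hl \<and> r (Suc n) < r n"
    using ex_sequence[of i0 Hl "\<lambda>x y. y < x", OF i0 left] by blast
  obtain q where q: "q 0 = j0" "\<forall>n. q n \<in> Hr \<and> q n < q (Suc n)"
    using ex_sequence[of j0 Hr "\<lambda>x y. x < y", OF j0(1) right] by blast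
  define s where "s c = (if c \<le> 0 then r (nat (- c)) else q (nat (c - 1)))" for c :: int
  have step: "s c < s (c + 1) \<and> wty k 1 (seg (\<lambda>p. [\<xi> p]) (s c) (s (c + 1))) =
      wty k 1 (unary (if c < 0 then u else if c = 0 then v else w))" for c
  proof -
    consider "c < 0" | "c = 0" | "c > 0" by linarith
    then show ?thesis
    proof cases
      case 1
      then have "nat (- c) = Suc (nat (- (c + 1)))" by simp
      then have "s c = r (Suc (nat (- (c + 1))))" "s (c + 1) = r (nat (- (c + 1)))"
        using 1 by (simp_all add: s_def)
      with 1 r(2) hom(1) show ?thesis by simp
    next
      case 2
      then have "s c = i0" "s (c + 1) = j0" by (simp_all add: s_def r(1) q(1))
      with 2 i0 j0 hom(2) show ?thesis by simp
    next
      case 3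
      then have "nat c = Suc (nat (c - 1))" by simp
      then have "s c = q (nat (c - 1))" "s (c + 1) = q (Suc (nat (c - 1)))"
        using 3 by (simp_all add: s_def)
      with 3 q(2) hom(3) show ?thesis by simp
    qed
  qed
  show ?thesis
  proof (rule ty_biword_per)
    show "strict_mono s" by (rule strict_mono_intI) (simp add: step)
    show "unary u \<noteq> []" "unary v \<noteq> []" "unary w \<noteq> []" using assms(2-4) by (simp_all add: unary_def)
  qed (use step step[of 0] in simp_all)
qed

section \<open>Factorisations homogeneous with respect to types\<close>

definition homogeneous :: "nat \<Rightarrow> biword \<Rightarrow> int set \<Rightarrow> int set \<Rightarrow> word \<Rightarrow> bool" where
  "homogeneous k \<xi> H H' u \<longleftrightarrow>
     (\<forall>i\<in>H. \<forall>j\<in>H'. i < j \<longrightarrow> wty k 1 (unary (factor \<xi> i (j - 1))) = wty k 1 (unary u))"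

text \<open>Equality of types takes the place of \<open>kequiv\<close>. It implies
  \<open>kequiv\<close> at the same depth and, unlike \<open>kequiv\<close>, is expressed by
  \<open>type_fm\<close> directly.\<close>

definition type_factorisation :: "nat \<Rightarrow> biword \<Rightarrow> int set \<Rightarrow> int set \<Rightarrow> word \<times> word \<times> word \<Rightarrow> bool" where
  "type_factorisation k \<xi> Hl Hr t \<longleftrightarrow> \<not> bdd_below Hl \<and> \<not> bdd_above Hr \<and>
     homogeneous k \<xi> Hl Hl (fst t) \<and> homogeneous k \<xi> Hl Hr (fst (snd t)) \<and> homogeneous k \<xi> Hr Hr (snd (snd t))"

lemma homogeneous_factorisation_if_type_factorisation:
  "type_factorisation k \<xi> Hl Hr t \<Longrightarrow> homogeneous_factorisation k \<xi> Hl Hr t"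
  unfolding homogeneous_factorisation_def type_factorisation_def homogeneous_def
  by (auto simp del: One_nat_def intro!: kequiv_if_wty_eq split: prod.splits)

text \<open>Ramsey's theorem gives homogeneity only inside each half. For segments from one half to
  the other it follows by composition.\<close>

lemma ex_type_factorisation:
  "\<exists>u v w Hl Hr. u \<noteq> [] \<and> v \<noteq> [] \<and> w \<noteq> [] \<and> type_factorisation k \<xi> Hl Hr (u, v, w)"
proof -
  let ?x = "\<lambda>p. [\<xi> p]"
  let ?T = "\<lambda>i j. wty k 1 (seg ?x i j)"
  obtain h :: "nat \<Rightarrow> nat" and tr where h: "strict_mono h" and h': "\<forall>i j. i < j \<longrightarrow> ?T (int (h i)) (int (h j)) = tr"
    using Ramsey_strict_mono[of "\<lambda>i j. ?T (int i) (int j)", OF wty_less] by (elim exE conjE) (rule that)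
  obtain g :: "nat \<Rightarrow> nat" and tl where g: "strict_mono g" and g': "\<forall>i j. i < j \<longrightarrow> ?T (- int (g j)) (- int (g i)) = tl"
    using Ramsey_strict_mono[of "\<lambda>i j. ?T (- int j) (- int i)", OF wty_less] by (elim exE conjE) (rule that)
  have T_append: "?T a d = ?T a' d'" if "?T a b = ?T a' b'" "?T b c = ?T b' c'" "?T c d = ?T c' d'"
    "a \<le> b" "b \<le> c" "c \<le> d" "a' \<le> b'" "b' \<le> c'" "c' \<le> d'" for a b c d a' b' c' d'
    using that seg_append[of a b d ?x] seg_append[of b c d ?x] seg_append[of a' b' d' ?x] seg_append[of b' c' d' ?x]
    by (auto intro!: wty_append)
  \<comment> \<open>Index 0 is left out of both sets: \<open>- int (g 0)\<close> and
    \<open>int (h 0)\<close> are intermediate cut points that split every segment from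
    \<open>Hl\<close> to \<open>Hr\<close> into a left piece of constant type, a fixed middle and a
    right piece of constant type.\<close>
  define Hl Hr where "Hl = range (\<lambda>i. - int (g (Suc i)))" and "Hr = range (\<lambda>i. int (h (Suc i)))"
  define u v w where "u = factor \<xi> (- int (g 1)) (- int (g 0) - 1)"
    and "v = factor \<xi> (- int (g 1)) (int (h 1) - 1)" and "w = factor \<xi> (int (h 0)) (int (h 1) - 1)"
  have uT: "wty k 1 (unary u) = tl" "wty k 1 (unary w) = tr"
    using g' h' by (simp_all add: u_def w_def unary_factor)
  have "\<not> bdd_below Hl"
  proof
    assume "bdd_below Hl"
    then obtain b where "\<And>x. x \<in> Hl \<Longrightarrow> b \<le> x" by (auto simp: bdd_below_def)
    then have "b \<le> - int (g (Suc (nat (- b))))" by (auto simp: Hl_def)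
    moreover have "Suc (nat (- b)) \<le> g (Suc (nat (- b)))" by (rule strict_mono_imp_increasing[OF g])
    ultimately show False by linarith
  qed
  moreover have "\<not> bdd_above Hr"
  proof
    assume "bdd_above Hr"
    then obtain b where "\<And>x. x \<in> Hr \<Longrightarrow> x \<le> b" by (auto simp: bdd_above_def)
    then have "int (h (Suc (nat b))) \<le> b" by (auto simp: Hr_def)
    moreover have "Suc (nat b) \<le> h (Suc (nat b))" by (rule strict_mono_imp_increasing[OF h])
    ultimately show False by linarith
  qed
  moreover have "homogeneous k \<xi> Hl Hl u"
    using g' by (auto simp: homogeneous_def Hl_def unary_factor uT[unfolded One_nat_def] strict_mono_less[OF g])
  moreover have "homogeneous k \<xi> Hr Hr w"
    using h' by (auto simp: homogeneous_def Hr_def unary_factor uT[unfolded One_nat_def] strict_mono_less[OF h])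
  moreover have "homogeneous k \<xi> Hl Hr v"
  proof -
    have "?T (- int (g (Suc i))) (int (h (Suc j))) = ?T (- int (g 1)) (int (h 1))" for i j
    proof (rule T_append)
      show "?T (- int (g (Suc i))) (- int (g 0)) = ?T (- int (g 1)) (- int (g 0))" using g' by simp
      show "?T (int (h 0)) (int (h (Suc j))) = ?T (int (h 0)) (int (h 1))" using h' by simp
    qed (simp_all add: strict_mono_less_eq[OF g] strict_mono_less_eq[OF h])
    then show ?thesis by (auto simp: homogeneous_def Hl_def Hr_def v_def unary_factor)
  qed
  ultimately have "type_factorisation k \<xi> Hl Hr (u, v, w)" by (simp add: type_factorisation_def)
  moreover have "u \<noteq> []" "w \<noteq> []" "v \<noteq> []"
    using strict_monoD[OF g, of 0 1] strict_monoD[OF h, of 0 1] by (simp_all add: u_def v_def w_def factor_def)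
  ultimately show ?thesis by blast
qed

section \<open>A sentence asserting that a factorisation exists\<close>

definition less_fm :: "nat \<Rightarrow> nat \<Rightarrow> mso" where
  "less_fm a b = Conj (Le a b) (Neg (Eq a b))"

lemma sat_less_fm [simp]: "sat D P e E (less_fm a b) \<longleftrightarrow> e a < e b"
  unfolding less_fm_def sat.simps by (rule less_le[symmetric])

text \<open>Set variable 0, the domain of \<open>type_fm\<close>, is forced to be the interval from
  element 0 up to but excluding element 1. Since it is bound here, \<open>X\<close> and
  \<open>Y\<close> have to be other variables.\<close>

definition homogeneous_fm :: "nat \<Rightarrow> nat \<Rightarrow> mso \<Rightarrow> mso" where
  "homogeneous_fm X Y f = all_elem 0 (all_elem 1 (all_set 0 (Neg (Conj
     (Conj (Conj (Mem 0 X) (Mem 1 Y)) (Conj (less_fm 0 1)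
       (all_elem 2 (iff_fm (Mem 2 0) (Conj (Le 0 2) (less_fm 2 1))))))
     (Neg f)))))"

text \<open>Set variable 1 holds \<open>P\<close>, the single label of \<open>type_fm k 1\<close>; 2
  and 3 hold \<open>Hl\<close> and \<open>Hr\<close>, while 0 stays free for the intervals.\<close>

definition factorisation_fm :: "nat \<Rightarrow> word \<times> word \<times> word \<Rightarrow> mso" where
  "factorisation_fm k t = ExSet 1 (Conj (all_elem 0 (iff_fm (Mem 0 1) (InP 0))) (ExSet 2 (ExSet 3
     (Conj (Conj (all_elem 0 (ExElem 1 (Conj (Mem 1 2) (less_fm 1 0))))
                 (all_elem 0 (ExElem 1 (Conj (Mem 1 3) (less_fm 0 1)))))
     (Conj (homogeneous_fm 2 2 (type_fm k 1 (unary (fst t))))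
     (Conj (homogeneous_fm 2 3 (type_fm k 1 (unary (fst (snd t)))))
           (homogeneous_fm 3 3 (type_fm k 1 (unary (snd (snd t)))))))))))"

lemma sentence_factorisation_fm: "sentence (factorisation_fm k t)"
proof -
  have free: "free1 (type_fm k 1 w) = {}" "free2 (type_fm k 1 w) \<subseteq> {0, 1}" for w
    using free_type_fm[of k 1 w] by auto
  show ?thesis
    using free(2)[of "unary (fst t)"] free(2)[of "unary (fst (snd t))"] free(2)[of "unary (snd (snd t))"]
    by (auto simp: sentence_def factorisation_fm_def homogeneous_fm_def less_fm_def free(1)[unfolded One_nat_def])
qed

lemma sat_homogeneous_fm:
  fixes E :: "nat \<Rightarrow> int set"
  assumes "E 1 = {i. \<xi> i}" "X \<noteq> 0" "Y \<noteq> 0"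
  shows "sat UNIV P e E (homogeneous_fm X Y (type_fm k 1 (unary u))) \<longleftrightarrow> homogeneous k \<xi> (E X) (E Y) u"
proof -
  have *: "sat UNIV P e' (E(0 := {i..<j})) (type_fm k 1 (unary u)) \<longleftrightarrow>
      wty k 1 (unary (factor \<xi> i (j - 1))) = wty k 1 (unary u)" for e' i j
  proof (subst sat_type_fm)
    show "\<forall>l\<in>set (unary u). length l = 1" by (simp add: unary_def)
    have "ty k 1 {i..<j} (\<lambda>p. [\<xi> p]) = wty k 1 (unary (factor \<xi> i (j - 1)))"
      unfolding unary_factor seg_def by (rule ty_interval)
    then show "ty k 1 ((E(0 := {i..<j})) 0) (\<lambda>p. map (\<lambda>i'. p \<in> (E(0 := {i..<j})) (1 - i')) [0..<1]) = wty k 1 (unary u)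
      \<longleftrightarrow> wty k 1 (unary (factor \<xi> i (j - 1))) = wty k 1 (unary u)"
      using assms(1) by simp
  qed simp
  have interval: "(\<forall>z. z \<in> A \<longleftrightarrow> i \<le> z \<and> z < j) \<longleftrightarrow> A = {i..<j}" for A and i j :: int
    by (simp add: set_eq_iff)
  let ?f = "type_fm k 1 (unary u)"
  have "sat UNIV P e E (homogeneous_fm X Y ?f) \<longleftrightarrow> (\<forall>i j A. i \<in> E X \<and> j \<in> E Y \<and> i < j \<and>
      (\<forall>z. z \<in> A \<longleftrightarrow> i \<le> z \<and> z < j) \<longrightarrow> sat UNIV P (e(0 := i, 1 := j)) (E(0 := A)) ?f)"
    using assms(2,3) by (simp add: homogeneous_fm_def) blast
  also have "\<dots> \<longleftrightarrow> (\<forall>i j. i \<in> E X \<and> j \<in> E Y \<and> i < j \<longrightarrow>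
      sat UNIV P (e(0 := i, 1 := j)) (E(0 := {i..<j})) ?f)"
    unfolding interval by blast
  also have "\<dots> \<longleftrightarrow> homogeneous k \<xi> (E X) (E Y) u"
    unfolding * homogeneous_def by blast
  finally show ?thesis .
qed

lemma models_factorisation_fm:
  "models UNIV {i. \<xi> i} (factorisation_fm k t) \<longleftrightarrow> (\<exists>Hl Hr. type_factorisation k \<xi> Hl Hr t)"
proof -
  let ?P = "{i. \<xi> i}"
  have "sat UNIV ?P e E (factorisation_fm k t) \<longleftrightarrow> (\<exists>Hl Hr. type_factorisation k \<xi> Hl Hr t)" for e E
  proof -
    have "sat UNIV ?P e E (factorisation_fm k t) \<longleftrightarrow> (\<exists>A\<subseteq>UNIV. (\<forall>c\<in>UNIV. c \<in> A \<longleftrightarrow> c \<in> ?P) \<and>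
      (\<exists>Hl Hr. (\<forall>x. \<exists>y. y \<in> Hl \<and> y < x) \<and> (\<forall>x. \<exists>y. y \<in> Hr \<and> x < y) \<and>
        sat UNIV ?P e (E(1 := A, 2 := Hl, 3 := Hr)) (homogeneous_fm 2 2 (type_fm k 1 (unary (fst t)))) \<and>
        sat UNIV ?P e (E(1 := A, 2 := Hl, 3 := Hr)) (homogeneous_fm 2 3 (type_fm k 1 (unary (fst (snd t))))) \<and>
        sat UNIV ?P e (E(1 := A, 2 := Hl, 3 := Hr)) (homogeneous_fm 3 3 (type_fm k 1 (unary (snd (snd t)))))))"
      by (simp add: factorisation_fm_def)
    also have "\<dots> \<longleftrightarrow> (\<exists>Hl Hr. (\<forall>x. \<exists>y. y \<in> Hl \<and> y < x) \<and> (\<forall>x. \<exists>y. y \<in> Hr \<and> x < y) \<and>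
        sat UNIV ?P e (E(1 := ?P, 2 := Hl, 3 := Hr)) (homogeneous_fm 2 2 (type_fm k 1 (unary (fst t)))) \<and>
        sat UNIV ?P e (E(1 := ?P, 2 := Hl, 3 := Hr)) (homogeneous_fm 2 3 (type_fm k 1 (unary (fst (snd t))))) \<and>
        sat UNIV ?P e (E(1 := ?P, 2 := Hl, 3 := Hr)) (homogeneous_fm 3 3 (type_fm k 1 (unary (snd (snd t))))))"
      by (rule ex_defined_subset) simp
    also have "\<dots> \<longleftrightarrow> (\<exists>Hl Hr. type_factorisation k \<xi> Hl Hr t)"
    proof -
      have "(\<forall>x. \<exists>y. y \<in> H \<and> y < x) \<longleftrightarrow> \<not> bdd_below H" "(\<forall>x. \<exists>y. y \<in> H \<and> x < y) \<longleftrightarrow> \<not> bdd_above H"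
        for H :: "int set"
        unfolding bdd_below_def bdd_above_def by (meson not_le)+
      moreover have
        "sat UNIV ?P e (E(1 := ?P, 2 := Hl, 3 := Hr)) (homogeneous_fm 2 2 (type_fm k 1 (unary u))) \<longleftrightarrow> homogeneous k \<xi> Hl Hl u"
        "sat UNIV ?P e (E(1 := ?P, 2 := Hl, 3 := Hr)) (homogeneous_fm 2 3 (type_fm k 1 (unary u))) \<longleftrightarrow> homogeneous k \<xi> Hl Hr u"
        "sat UNIV ?P e (E(1 := ?P, 2 := Hl, 3 := Hr)) (homogeneous_fm 3 3 (type_fm k 1 (unary u))) \<longleftrightarrow> homogeneous k \<xi> Hr Hr u"
        for Hl Hr u
        by (subst sat_homogeneous_fm[where \<xi> = \<xi>]; simp)+
      ultimately show ?thesis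
        by (simp only: type_factorisation_def)
    qed
    finally show ?thesis .
  qed
  then show ?thesis by (simp add: models_def)
qed

section \<open>Computability of the constructions\<close>

lemma computable_label [computable_intros]:
  assumes "computable r" "computable l" "computable s"
  shows "computable (\<lambda>x. label (r x) (l x) (s x))"
  unfolding label_def by (intro computable_intros assms computable_comp[OF assms(3)])

lemma computable_word_meets [computable_intros]:
  assumes "computable r" "computable w" "computable s" "computable t"
  shows "computable (\<lambda>x. word_meets (r x) (w x) (s x) (t x))"
  unfolding word_meets_def by (intro computable_intros assms assms[THEN computable_comp])

lemma computable_word_precedes [computable_intros]:
  assumes "computable r" "computable w" "computable s" "computable t"
  shows "computable (\<lambda>x. word_precedes (r x) (w x) (s x) (t x))"
  unfolding word_precedes_def by (intro computable_intros assms assms[THEN computable_comp])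

lemma computable_relabelings [computable_intros]:
  assumes "computable w" shows "computable (\<lambda>x. relabelings (w x))"
  unfolding relabelings_def by (intro computable_intros assms)

lemma computable_power_word [computable_intros]:
  assumes "computable m" "computable w" shows "computable (\<lambda>x. power_word (m x) (w x))"
  unfolding power_word_def by (intro computable_intros assms)

lemma computable_expanded [computable_intros]:
  assumes "computable m" "computable u" "computable v" "computable w"
  shows "computable (\<lambda>x. expanded (m x) (u x) (v x) (w x))"
  unfolding expanded_def by (intro computable_intros assms)

lemma computable_period_meets [computable_intros]:
  assumes "computable r" "computable t" "computable i" "computable j"
  shows "computable (\<lambda>x. period_meets (r x) (t x) (i x) (j x))"
  unfolding period_meets_def by (intro computable_intros assms)

lemma computable_period_precedes [computable_intros]:
  assumes "computable r" "computable t" "computable i" "computable j"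
  shows "computable (\<lambda>x. period_precedes (r x) (t x) (i x) (j x))"
  unfolding period_precedes_def per_precedes_def by (intro computable_intros assms)

lemma computable_period_relabelings [computable_intros]:
  assumes "computable m" "computable t"
  shows "computable (\<lambda>x. period_relabelings (m x) (t x))"
  unfolding period_relabelings_def by (intro computable_intros assms assms[THEN computable_comp])

lemma computable_unary [computable_intros]:
  assumes "computable w" shows "computable (\<lambda>x. unary (w x))"
  unfolding unary_def by (intro computable_intros assms)

lemma computable_ty_bound [computable_intros]:
  assumes "computable k" "computable n" shows "computable (\<lambda>x. ty_bound (k x) (n x))"
  unfolding ty_bound_def by (intro computable_intros assms)

lemma computable_conjs [computable_intros]:
  assumes "computable fs" shows "computable (\<lambda>x. conjs (fs x))"
  unfolding conjs_def by (intro computable_intros assms)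

text \<open>Every recursive call changes the word, and the number of calls depends on it, so the
  call tree is evaluated with \<open>k\<close> as measure.\<close>

lemma computable_type_fm [computable_intros]:
  assumes "computable k" "computable n" "computable w"
  shows "computable (\<lambda>x. type_fm (k x) (n x) (w x))"
proof (rule computable_comp3[OF _ assms])
  let ?calls = "\<lambda>z. case fst z of 0 \<Rightarrow> []
    | Suc k \<Rightarrow> map (\<lambda>w'. (k, Suc (fst (snd z)), w')) (relabelings (snd (snd z)))"
  let ?G = "\<lambda>z fs. case fst z of 0 \<Rightarrow> type_fm 0 (fst (snd z)) (snd (snd z))
    | Suc k \<Rightarrow> Conj (conjs (map (ExSet (Suc (fst (snd z)))) fs)) (Neg (ExSet (Suc (fst (snd z))) (conjs (map Neg fs))))"
  show "computable (\<lambda>z. type_fm (fst z) (fst (snd z)) (snd (snd z)))"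
  proof (rule computable_rec)
    show "computable ?calls" by (intro computable_intros)
    show "computable (\<lambda>z. ?G (fst z) (snd z))"
      unfolding type_fm.simps signed_fm_def meets_fm_def precedes_fm_def by (intro computable_intros)
    show "computable (\<lambda>z :: nat \<times> nat \<times> bool list list. fst z)" by (intro computable_intros)
    show "type_fm (fst z) (fst (snd z)) (snd (snd z)) =
        ?G z (map (\<lambda>z. type_fm (fst z) (fst (snd z)) (snd (snd z))) (?calls z))" for z
      by (cases "fst z") (simp_all add: comp_def Let_def)
    show "y \<in> set (?calls z) \<Longrightarrow> fst y < fst z" for y z
      by (cases "fst z") auto
  qed
qed

lemma computable_factorisation_fm [computable_intros]:
  assumes "computable k" "computable t" shows "computable (\<lambda>x. factorisation_fm (k x) (t x))"
  unfolding factorisation_fm_def homogeneous_fm_def all_elem_def all_set_def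
  by (intro computable_intros assms)

text \<open>The code of a formula is a computable measure for recursion over its structure.\<close>

lemma enc_less_subformula:
  "enc f < enc (Neg f)" "enc f < enc (Conj f g)" "enc g < enc (Conj f g)"
  "enc f < enc (ExElem a f)" "enc f < enc (ExSet a f)"
proof -
  have *: "b < prod_encode (c, prod_encode (a, b))" "a < prod_encode (c, prod_encode (a, b))"
    if "0 < c" for a b c
    using less_prod_encode_2[OF that, of "prod_encode (a, b)"] le_prod_encode_1[of a b] le_prod_encode_2[of b a]
    by simp_all
  show "enc f < enc (Neg f)" "enc f < enc (Conj f g)" "enc g < enc (Conj f g)"
    "enc f < enc (ExElem a f)" "enc f < enc (ExSet a f)"
    by (simp_all add: enc_mso_def less_prod_encode_2 *)
qed

text \<open>This allows the decision procedure to take its input as a bound on the rank.\<close>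

lemma qrank_le_enc: "qrank f \<le> enc f"
proof (induction f)
  case (Neg f)
  then show ?case using enc_less_subformula(1)[of f] by simp
next
  case (Conj f g)
  then show ?case using enc_less_subformula(2,3)[where f = f and g = g] by simp
next
  case (ExElem a f)
  then show ?case using enc_less_subformula(4)[of f a] by simp
next
  case (ExSet a f)
  then show ?case using enc_less_subformula(5)[of f a] by simp
qed simp_all

text \<open>The free variables as a list, in the naming scheme of \<open>label\<close>, which makes
  being a sentence a computable test.\<close>

primrec free_labels :: "mso \<Rightarrow> nat list" where
  "free_labels (Eq a b) = [2 * a + 1, 2 * b + 1]"
| "free_labels (Le a b) = [2 * a + 1, 2 * b + 1]"
| "free_labels (InP a) = [2 * a + 1]"
| "free_labels (Mem a b) = [2 * a + 1, 2 * b + 2]"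
| "free_labels (Neg f) = free_labels f"
| "free_labels (Conj f g) = free_labels f @ free_labels g"
| "free_labels (ExElem a f) = filter (\<lambda>s. s \<noteq> 2 * a + 1) (free_labels f)"
| "free_labels (ExSet a f) = filter (\<lambda>s. s \<noteq> 2 * a + 2) (free_labels f)"

lemma set_free_labels:
  "set (free_labels f) = (\<lambda>a. 2 * a + 1) ` free1 f \<union> (\<lambda>a. 2 * a + 2) ` free2 f"
proof (induction f)
  case (ExElem a f)
  have "Suc (2 * b) \<noteq> 2 * a" "2 * a \<noteq> Suc (2 * b)" for b by presburger+
  with ExElem show ?case by auto
next
  case (ExSet a f)
  have "Suc (2 * a) \<noteq> 2 * b" "2 * b \<noteq> Suc (2 * a)" for b by presburger+
  with ExSet show ?case by auto
qed auto

lemma sentence_iff_free_labels: "sentence f \<longleftrightarrow> free_labels f = []"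
  unfolding sentence_def set_empty[symmetric] set_free_labels by simp

lemma computable_free_labels [computable_intros]:
  assumes "computable g" shows "computable (\<lambda>x. free_labels (g x))"
proof (rule computable_comp[OF _ assms])
  let ?hd = "\<lambda>vs. case vs of [] \<Rightarrow> [] | v # _ \<Rightarrow> v"
  let ?calls = "\<lambda>f. case f of Neg f \<Rightarrow> [f] | Conj f g \<Rightarrow> [f, g] | ExElem a f \<Rightarrow> [f] | ExSet a f \<Rightarrow> [f]
    | Eq a b \<Rightarrow> [] | Le a b \<Rightarrow> [] | InP a \<Rightarrow> [] | Mem a b \<Rightarrow> []"
  let ?G = "\<lambda>f vs. case f of Eq a b \<Rightarrow> [2 * a + 1, 2 * b + 1] | Le a b \<Rightarrow> [2 * a + 1, 2 * b + 1]
    | InP a \<Rightarrow> [2 * a + 1] | Mem a b \<Rightarrow> [2 * a + 1, 2 * b + 2] | Neg f \<Rightarrow> ?hd vs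
    | Conj f g \<Rightarrow> ?hd vs @ ?hd (tl vs) | ExElem a f \<Rightarrow> filter (\<lambda>s. s \<noteq> 2 * a + 1) (?hd vs)
    | ExSet a f \<Rightarrow> filter (\<lambda>s. s \<noteq> 2 * a + 2) (?hd vs)"
  show "computable free_labels"
  proof (rule computable_rec)
    show "computable ?calls" by (intro computable_intros)
    show "computable (\<lambda>z. ?G (fst z) (snd z))" by (intro computable_intros)
    show "computable (enc :: mso \<Rightarrow> nat)" by (intro computable_enc computable_id)
    show "free_labels f = ?G f (map free_labels (?calls f))" for f by (cases f) simp_all
    show "g \<in> set (?calls f) \<Longrightarrow> enc g < enc f" for f g
      by (cases f) (auto simp: enc_less_subformula)
  qed
qed

lemma computable_psat [computable_intros]:
  assumes "computable f" "computable m" "computable r" "computable t"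
  shows "computable (\<lambda>x. psat (f x) (m x) (r x) (t x))"
proof -
  let ?hd = "\<lambda>vs. case vs of [] \<Rightarrow> False | v # _ \<Rightarrow> v"
  let ?m = "\<lambda>z. fst (snd z)" and ?r = "\<lambda>z. fst (snd (snd z))" and ?t = "\<lambda>z. snd (snd (snd z))"
  let ?psat = "\<lambda>z :: mso \<times> nat \<times> nat list \<times> period. psat (fst z) (?m z) (?r z) (?t z)"
  let ?calls = "\<lambda>z. case fst z of
      Neg f \<Rightarrow> [(f, ?m z, ?r z, ?t z)] | Conj f g \<Rightarrow> [(f, ?m z, ?r z, ?t z), (g, ?m z, ?r z, ?t z)]
    | ExElem a f \<Rightarrow> map (\<lambda>t'. (f, ?m z, (2 * a + 1) # ?r z, t')) (period_relabelings (?m z) (?t z))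
    | ExSet a f \<Rightarrow> map (\<lambda>t'. (f, ?m z, (2 * a + 2) # ?r z, t')) (period_relabelings (?m z) (?t z))
    | Eq a b \<Rightarrow> [] | Le a b \<Rightarrow> [] | InP a \<Rightarrow> [] | Mem a b \<Rightarrow> []"
  let ?G = "\<lambda>z vs. case fst z of Eq a b \<Rightarrow> period_meets (?r z) (?t z) (2 * a + 1) (2 * b + 1)
    | Le a b \<Rightarrow> period_meets (?r z) (?t z) (2 * a + 1) (2 * b + 1) \<or> period_precedes (?r z) (?t z) (2 * a + 1) (2 * b + 1)
    | InP a \<Rightarrow> period_meets (?r z) (?t z) (2 * a + 1) 0
    | Mem a b \<Rightarrow> period_meets (?r z) (?t z) (2 * a + 1) (2 * b + 2)
    | Neg f \<Rightarrow> \<not> ?hd vs | Conj f g \<Rightarrow> ?hd vs \<and> ?hd (tl vs)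
    | ExElem a f \<Rightarrow> (\<exists>q\<in>set (zip (period_relabelings (?m z) (?t z)) vs).
        period_meets ((2 * a + 1) # ?r z) (fst q) (2 * a + 1) (2 * a + 1) \<and>
        \<not> period_precedes ((2 * a + 1) # ?r z) (fst q) (2 * a + 1) (2 * a + 1) \<and> snd q)
    | ExSet a f \<Rightarrow> (\<exists>v\<in>set vs. v)"
  have "computable ?psat"
  proof (rule computable_rec)
    show "computable ?calls" by (intro computable_intros)
    show "computable (\<lambda>z. ?G (fst z) (snd z))" by (intro computable_intros)
    show "computable (\<lambda>z :: mso \<times> nat \<times> nat list \<times> period. enc (fst z))" by (intro computable_intros)
    show "?psat z = ?G z (map ?psat (?calls z))" for z
    proof -
      have "(\<exists>q\<in>set (zip ts (map h ts)). Q q) \<longleftrightarrow> (\<exists>t\<in>set ts. Q (t, h t))"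
        for ts :: "period list" and h :: "period \<Rightarrow> bool" and Q
        by (induction ts) auto
      then show ?thesis by (cases "fst z") (simp_all add: comp_def Let_def)
    qed
    show "y \<in> set (?calls z) \<Longrightarrow> enc (fst y) < enc (fst z)" for y z
      by (cases "fst z") (auto simp: enc_less_subformula)
  qed
  from computable_comp[OF this, of "\<lambda>x. (f x, m x, r x, t x)"] assms show ?thesis
    by (simp add: computable_Pair)
qed

section \<open>Decidability and type-functions\<close>

lemma decidable_iff_computable: "decidable A \<longleftrightarrow> computable (\<lambda>n :: nat. n \<in> mso_encode ` A)"
  by (simp add: decidable_def computable_nat_iff total_rec_def enc_bool_def)

lemma enc_triple: "enc (t :: word \<times> word \<times> word) = triple_encode t"
proof -
  have "enc w = word_encode w" for w :: word
    unfolding enc_list_def word_encode_def enc_bool_def by simp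
  then show ?thesis by (simp add: enc_prod_def triple_encode_def split: prod.splits)
qed

lemma recursive_iff_computable: "recursive tp \<longleftrightarrow> computable tp"
  by (simp add: recursive_def computable_nat_iff total_rec_def enc_triple)

definition word_decode :: "nat \<Rightarrow> word" where
  "word_decode n = map (\<lambda>x. x \<noteq> 0) (list_decode n)"

definition triple_decode :: "nat \<Rightarrow> word \<times> word \<times> word" where
  "triple_decode n = (word_decode (pfst n), word_decode (pfst (psnd n)), word_decode (psnd (psnd n)))"

lemma triple_decode_encode: "triple_decode (triple_encode t) = t"
proof -
  have "word_decode (word_encode w) = w" for w
    by (simp add: word_decode_def word_encode_def comp_def)
  then show ?thesis by (simp add: triple_decode_def triple_encode_def split: prod.splits)
qed

lemma computable_triple_decode [computable_intros]:
  assumes "computable n" shows "computable (\<lambda>x. triple_decode (n x))"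
proof -
  \<comment> \<open>The code of \<open>list_decode n\<close> is \<open>n\<close> again, so on codes
    this is the identity.\<close>
  have "computable list_decode"
    by (rule computableI[OF total_rec_id]) (simp add: enc_list_def enc_nat_def[abs_def])
  from computable_comp[OF this] have *: "computable f \<Longrightarrow> computable (\<lambda>x. list_decode (f x))"
    for f :: "'c::encodable \<Rightarrow> nat" .
  show ?thesis
    unfolding triple_decode_def word_decode_def by (intro computable_intros * assms)
qed

lemma ex_recursive_type_function:
  assumes "decidable (MTh \<xi>)"
  shows "\<exists>tp. type_function \<xi> tp \<and> recursive tp"
proof -
  define good where "good k t \<longleftrightarrow> fst t \<noteq> [] \<and> fst (snd t) \<noteq> [] \<and> snd (snd t) \<noteq> [] \<and>
    enc (factorisation_fm k t) \<in> mso_encode ` MTh \<xi>" for k t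
  have good_iff: "good k t \<longleftrightarrow> fst t \<noteq> [] \<and> fst (snd t) \<noteq> [] \<and> snd (snd t) \<noteq> [] \<and>
    (\<exists>Hl Hr. type_factorisation k \<xi> Hl Hr t)" for k t
  proof -
    have "enc f \<in> mso_encode ` MTh \<xi> \<longleftrightarrow> f \<in> MTh \<xi>" for f
      by (auto simp: enc_mso_def mso_encode_inject)
    then show ?thesis
      by (simp add: good_def MTh_def sentence_factorisation_fm models_factorisation_fm)
  qed
  have ex: "\<exists>n. good k (triple_decode n)" for k
  proof -
    obtain u v w Hl Hr where "u \<noteq> []" "v \<noteq> []" "w \<noteq> []" "type_factorisation k \<xi> Hl Hr (u, v, w)"
      using ex_type_factorisation[of k \<xi>] by blast
    then have "good k (u, v, w)" unfolding good_iff by auto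
    then show ?thesis by (intro exI[of _ "triple_encode (u, v, w)"]) (simp add: triple_decode_encode)
  qed
  define tp where "tp k = triple_decode (LEAST n. good k (triple_decode n))" for k
  have good: "good k (tp k)" for k
    unfolding tp_def by (rule LeastI_ex) (rule ex)
  have "type_function \<xi> tp"
    unfolding type_function_def
  proof (intro allI conjI)
    fix k
    show "case tp k of (u, v, w) \<Rightarrow> u \<noteq> [] \<and> v \<noteq> [] \<and> w \<noteq> []"
      using good[of k] by (cases "tp k") (simp add: good_iff)
    show "\<exists>Hl Hr. homogeneous_factorisation k \<xi> Hl Hr (tp k)"
      using good[of k] homogeneous_factorisation_if_type_factorisation unfolding good_iff by blast
  qed
  moreover have "computable tp"
  proof -
    have mem: "computable (\<lambda>n. n \<in> mso_encode ` MTh \<xi>)" using assms by (simp add: decidable_iff_computable)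
    have "computable (\<lambda>z. good (fst z) (triple_decode (snd z)))"
      unfolding good_def by (intro computable_intros computable_comp[OF mem])
    from computable_Least[OF this ex] show ?thesis
      unfolding tp_def by (intro computable_intros)
  qed
  ultimately show ?thesis by (auto simp: recursive_iff_computable)
qed

lemma mem_MTh_iff_psat:
  assumes "type_function \<xi> tp" "sentence f" "qrank f \<le> k"
  shows "f \<in> MTh \<xi> \<longleftrightarrow> psat f (fact (ty_bound k 1)) [0]
    (unary (fst (tp (k + 4))), unary (fst (snd (tp (k + 4)))), unary (snd (snd (tp (k + 4)))))"
proof -
  obtain u v w where tp: "tp (k + 4) = (u, v, w)" by (cases "tp (k + 4)") auto
  from assms(1) have "(case tp (k + 4) of (u, v, w) \<Rightarrow> u \<noteq> [] \<and> v \<noteq> [] \<and> w \<noteq> []) \<and>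
    (\<exists>Hl Hr. homogeneous_factorisation (k + 4) \<xi> Hl Hr (tp (k + 4)))"
    unfolding type_function_def by (rule spec)
  then obtain Hl Hr where ne: "u \<noteq> []" "v \<noteq> []" "w \<noteq> []"
    and fact: "homogeneous_factorisation (k + 4) \<xi> Hl Hr (u, v, w)"
    unfolding tp by auto
  let ?t = "(unary u, unary v, unary w)"
  have ok: "letters_ok (length [0 :: nat]) ?t" using ne by (auto simp: letters_ok_def unary_def)
  have "f \<in> MTh \<xi> \<longleftrightarrow> lsat f [0] UNIV (\<lambda>p. [\<xi> p])"
    using assms(2) by (simp add: MTh_def sat_sentence_iff_lsat)
  also have "\<dots> \<longleftrightarrow> lsat f [0] UNIV (tper ?t)"
  proof (rule lsat_cong_ty[OF _ assms(3)])
    show "ty k (length [0 :: nat]) UNIV (\<lambda>p. [\<xi> p]) = ty k (length [0 :: nat]) UNIV (tper ?t)"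
      using ty_eq_per_if_homogeneous_factorisation[OF fact ne] by (simp add: tper_def)
    show "length (tper ?t p) = length [0 :: nat]" for p by (rule length_tper[OF ok])
  qed simp
  also have "\<dots> \<longleftrightarrow> psat f (fact (ty_bound k 1)) [0] ?t"
    by (rule psat_iff_lsat[OF ok assms(3), symmetric]) simp_all
  finally show ?thesis by (simp add: tp)
qed

lemma decidable_MTh:
  assumes "type_function \<xi> tp" "recursive tp"
  shows "decidable (MTh \<xi>)"
proof -
  \<comment> \<open>The first conjunct rejects numbers that encode no formula, the second formulas
    with free variables. In the third, \<open>n\<close> bounds the rank of the formula that it
    encodes.\<close>
  let ?D = "\<lambda>n. enc (mso_decode n) = n \<and> free_labels (mso_decode n) = [] \<and>
    psat (mso_decode n) (fact (ty_bound n 1)) [0]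
      (unary (fst (tp (n + 4))), unary (fst (snd (tp (n + 4)))), unary (snd (snd (tp (n + 4)))))"
  have tp: "computable tp" using assms(2) by (simp add: recursive_iff_computable)
  have "computable ?D"
    by (intro computable_intros computable_comp[OF tp] computable_comp[OF computable_mso_decode])
  moreover have "?D n \<longleftrightarrow> n \<in> mso_encode ` MTh \<xi>" for n
  proof
    assume D: "?D n"
    then have "mso_decode n \<in> MTh \<xi>"
      using mem_MTh_iff_psat[OF assms(1), of "mso_decode n" n] qrank_le_enc[of "mso_decode n"]
      by (simp add: sentence_iff_free_labels)
    with D show "n \<in> mso_encode ` MTh \<xi>" by (intro image_eqI[of _ _ "mso_decode n"]) (simp_all add: enc_mso_def)
  next
    assume "n \<in> mso_encode ` MTh \<xi>"
    then obtain f where f: "f \<in> MTh \<xi>" "n = enc f" by (auto simp: enc_mso_def)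
    then have "mso_decode n = f" "sentence f" by (simp_all add: enc_mso_def mso_decode_encode MTh_def)
    with f show "?D n"
      using mem_MTh_iff_psat[OF assms(1), of f n] qrank_le_enc[of f]
      by (simp add: sentence_iff_free_labels)
  qed
  ultimately show ?thesis by (simp add: decidable_iff_computable)
qed

theorem theorem5p22:
  fixes \<xi> :: biword
  shows "decidable (MTh \<xi>) \<longleftrightarrow> (\<exists>tp. type_function \<xi> tp \<and> recursive tp)"
  using ex_recursive_type_function decidable_MTh by blast

end
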